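(* Let $1\to A\xrightarrow{\alpha} B\xrightarrow{\beta} C\to 1$ be a central extension of Lie groups with Lie algebras $\mathfrak a,\mathfrak b,\mathfrak c$, and assume an $\mathrm{Ad}|_B$-equivariant splitting $(s,t)$ of it, i.e. an $\mathrm{Ad}|_B$-equivariant linear section $s\colon\mathfrak c\to\mathfrak b$ of $\beta_*\colon\mathfrak b\to\mathfrak c$ with associated projection $t\colon\mathfrak b\to\mathfrak a$ characterized by $\mathrm{id}_{\mathfrak b}=\alpha_*\circ t+s\circ\beta_*$. Let $G$ be a Lie group acting on a manifold $X$, and let $\rho\colon R\xrightarrow{\sigma}P\xrightarrow{\pi}X$ be a $G$-equivariant central extension. Then the space $\mathcal A^G(R\to X)$ of $G$-equivariant connections on $\rho$ is parameterized by pairs $(\omega^\sigma,\omega^\pi)$ of $G$-equivariant connections on $\sigma$ and $\pi$ satisfying $$\mathrm{pr}_2^*\omega^\sigma-\mathrm{pr}_1^*\omega^\sigma=\psi^*t(\theta_B)\in\Omega^1(R\times_XR;\mathfrak a),$$ where $\theta_B$ denotes the Maurer–Cartan form on $B$ and the map $\psi\colon R\times_XR\to B$ encodes the $B$-action on $R$.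
   Context: Principal bundles are smooth with structure group acting from the right. A $G$-equivariant principal bundle carries a smooth left $G$-action covering that on the base and commuting with the structure group. Connections are given by connection $1$-forms; a $G$-equivariant connection is one whose connection $1$-form is $G$-invariant. A $G$-equivariant central extension $\rho\colon R\xrightarrow{\sigma}P\xrightarrow{\pi}X$ consists of a $G$-equivariant principal $C$-bundle $\pi\colon P\to X$, a $G$-equivariant principal $B$-bundle $\rho\colon R\to X$, and a $G$-equivariant bundle map $\sigma\colon R\to P$ over $X$ with $\sigma(rb)=\sigma(r)\beta(b)$. Then $\sigma\colon R\to P$ is a $G$-equivariant principal $A$-bundle (with $A$ acting through $\alpha$). $\mathrm{Ad}|_B$-equivariance of $s$ means equivariance for the adjoint action of $B$ on $\mathfrak b$ and the action of $B$ on $\mathfrak c$ by $\mathrm{Ad}\circ\beta$. The map $\psi\colon R\times_XR\to B$ is defined by $r_1\psi(r_1,r_2)=r_2$. The Maurer–Cartan form is $\theta_B\in\Omega^1(B;\mathfrak b)$, $\theta_B(\xi)=b^{-1}\xi$ for $\xi\in T_bB$. The maps $\mathrm{pr}_1,\mathrm{pr}_2\colon R\times_XR\to R$ are the projections. *)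

theory Defs
  imports "HOL-Analysis.Analysis" "HOL-Algebra.Coset"
begin

section \<open>Model spaces\<close>

text \<open>
  Manifolds are modelled on finite-dimensional real inner product spaces. The class
  \<^class>\<open>euclidean_space\<close> is not used because it forces the dimension to be positive, which would
  exclude discrete Lie groups, for instance finite groups.
\<close>

class model_space = real_inner +
  assumes ex_orthonormal_basis:
    "\<exists>U. finite U \<and> (\<forall>u\<in>U. \<forall>v\<in>U. inner u v = (if u = v then 1 else 0)) \<and>
       (\<forall>x. (\<forall>u\<in>U. inner x u = 0) \<longrightarrow> x = 0)"

instance euclidean_space \<subseteq> model_space
proof
  show "\<exists>U::'a set. finite U \<and> (\<forall>u\<in>U. \<forall>v\<in>U. inner u v = (if u = v then 1 else 0)) \<and>
       (\<forall>x. (\<forall>u\<in>U. inner x u = 0) \<longrightarrow> x = 0)"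
    by (rule exI[of _ Basis]) (simp add: inner_Basis euclidean_all_zero_iff)
qed

instance prod :: (model_space, model_space) model_space
proof
  obtain U :: "'a set" where U: "finite U" "\<forall>u\<in>U. \<forall>v\<in>U. inner u v = (if u = v then 1 else 0)"
    "\<forall>x. (\<forall>u\<in>U. inner x u = 0) \<longrightarrow> x = 0"
    using ex_orthonormal_basis by (elim exE conjE) (rule that)
  obtain V :: "'b set" where V: "finite V" "\<forall>u\<in>V. \<forall>v\<in>V. inner u v = (if u = v then 1 else 0)"
    "\<forall>x. (\<forall>u\<in>V. inner x u = 0) \<longrightarrow> x = 0"
    using ex_orthonormal_basis by (elim exE conjE) (rule that)
  let ?W = "(\<lambda>u. (u, 0)) ` U \<union> (\<lambda>v. (0, v)) ` V"
  have "finite ?W"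
    using U(1) V(1) by (intro finite_UnI finite_imageI)
  moreover have "inner u v = (if u = v then 1 else 0)" if "u \<in> ?W" "v \<in> ?W" for u v
    using that
  proof (elim UnE imageE)
    fix x y assume "u = (x, 0)" "x \<in> U" "v = (y, 0)" "y \<in> U"
    then show ?thesis using U(2)[rule_format, of x y] by simp
  next
    fix x y assume *: "u = (x, 0)" "x \<in> U" "v = (0, y)" "y \<in> V"
    then have "x \<noteq> 0" using U(2)[rule_format, of x x] by auto
    with * show ?thesis by simp
  next
    fix x y assume *: "u = (0, x)" "x \<in> V" "v = (y, 0)" "y \<in> U"
    then have "x \<noteq> 0" using V(2)[rule_format, of x x] by auto
    with * show ?thesis by simp
  next
    fix x y assume "u = (0, x)" "x \<in> V" "v = (0, y)" "y \<in> V"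
    then show ?thesis using V(2)[rule_format, of x y] by simp
  qed
  moreover have "x = 0" if *: "\<forall>u\<in>?W. inner x u = 0" for x
  proof -
    have "inner (fst x) u = 0" if "u \<in> U" for u
      using bspec[OF *, of "(u, 0)"] that by (simp add: inner_prod_def)
    moreover have "inner (snd x) v = 0" if "v \<in> V" for v
      using bspec[OF *, of "(0, v)"] that by (simp add: inner_prod_def)
    ultimately show ?thesis
      using U(3) V(3) by (intro prod_eqI) simp_all
  qed
  ultimately show "\<exists>U::('a \<times> 'b) set. finite U \<and>
       (\<forall>u\<in>U. \<forall>v\<in>U. inner u v = (if u = v then 1 else 0)) \<and>
       (\<forall>x. (\<forall>u\<in>U. inner x u = 0) \<longrightarrow> x = 0)"
    by (intro exI[of _ ?W] conjI ballI allI impI)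
qed

text \<open>A model space of dimension zero.\<close>

instantiation unit :: model_space
begin

definition zero_unit :: unit where "zero_unit = ()"
definition plus_unit :: "unit \<Rightarrow> unit \<Rightarrow> unit" where "plus_unit x y = ()"
definition scaleR_unit :: "real \<Rightarrow> unit \<Rightarrow> unit" where "scaleR_unit r x = ()"
definition norm_unit :: "unit \<Rightarrow> real" where "norm_unit x = 0"
definition dist_unit :: "unit \<Rightarrow> unit \<Rightarrow> real" where "dist_unit x y = 0"
definition sgn_unit :: "unit \<Rightarrow> unit" where "sgn_unit x = ()"
definition inner_unit :: "unit \<Rightarrow> unit \<Rightarrow> real" where "inner_unit x y = 0"
definition uniformity_unit :: "(unit \<times> unit) filter"
  where "uniformity_unit = (INF e\<in>{0<..}. principal {(x, y). dist x y < e})"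
definition open_unit :: "unit set \<Rightarrow> bool"
  where "open_unit U = (\<forall>x\<in>U. eventually (\<lambda>(x', y). x' = x \<longrightarrow> y \<in> U) uniformity)"

instance
proof
  have eq: "x = y" for x y :: unit
    by (metis old.unit.exhaust)
  show "a + b + c = a + (b + c)" "a + b = b + a" "0 + a = a" "- a + a = 0" "a - b = a + - b"
    "r *\<^sub>R (a + b) = r *\<^sub>R a + r *\<^sub>R b" "(r + q) *\<^sub>R a = r *\<^sub>R a + q *\<^sub>R a"
    "r *\<^sub>R q *\<^sub>R a = (r * q) *\<^sub>R a" "1 *\<^sub>R a = a" "sgn a = inverse (norm a) *\<^sub>R a"
    for a b c :: unit and r q :: real
    by (rule eq)+
  show "inner a a = 0 \<longleftrightarrow> a = 0" for a :: unit
    unfolding inner_unit_def by (rule iffI, rule eq, rule refl)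
  show "dist a b = norm (a - b)" "inner a b = inner b a" "0 \<le> inner a a" "norm a = sqrt (inner a a)"
    "inner (a + b) c = inner a c + inner b c" "inner (r *\<^sub>R a) b = r * inner a b"
    for a b c :: unit and r :: real
    unfolding dist_unit_def norm_unit_def inner_unit_def
    by (rule refl order_refl real_sqrt_zero[symmetric] add_0[symmetric] mult_zero_right[symmetric])+
  show "uniformity = (INF e\<in>{0<..}. principal {(x::unit, y). dist x y < e})"
    by (rule uniformity_unit_def)
  show "open U = (\<forall>x\<in>U. eventually (\<lambda>(x', y). x' = x \<longrightarrow> y \<in> U) uniformity)" for U :: "unit set"
    by (rule open_unit_def)
  show "\<exists>U::unit set. finite U \<and> (\<forall>u\<in>U. \<forall>v\<in>U. inner u v = (if u = v then 1 else 0)) \<and>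
       (\<forall>x. (\<forall>u\<in>U. inner x u = 0) \<longrightarrow> x = 0)"
    by (rule exI[of _ "{}"]) simp
qed

end


section \<open>Smooth functions on open subsets of normed spaces\<close>

text \<open>In both definitions the set \<open>S\<close> is meant to be open.\<close>

primrec Ck_on :: "nat \<Rightarrow> 'a::real_normed_vector set \<Rightarrow> ('a \<Rightarrow> 'b::real_normed_vector) \<Rightarrow> bool"
  where
    "Ck_on 0 S f \<longleftrightarrow> continuous_on S f"
  | "Ck_on (Suc k) S f \<longleftrightarrow>
       (\<forall>x\<in>S. f differentiable (at x)) \<and> (\<forall>v. Ck_on k S (\<lambda>x. frechet_derivative f (at x) v))"

definition smooth_on :: "'a::real_normed_vector set \<Rightarrow> ('a \<Rightarrow> 'b::real_normed_vector) \<Rightarrow> bool"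
  where "smooth_on S f \<longleftrightarrow> (\<forall>k. Ck_on k S f)"


section \<open>Manifolds and smooth maps\<close>

type_synonym ('p, 'e) chart = "'p set \<times> ('p \<Rightarrow> 'e)"

record ('p, 'e) mfd =
  mtop :: "'p topology"
  atlas :: "('p, 'e) chart set"

abbreviation points :: "('p, 'e) mfd \<Rightarrow> 'p set"
  where "points M \<equiv> topspace (mtop M)"

definition is_chart :: "'p topology \<Rightarrow> ('p, 'e::real_normed_vector) chart \<Rightarrow> bool"
  where "is_chart T c \<longleftrightarrow>
    openin T (fst c) \<and> open (snd c ` fst c) \<and>
    homeomorphic_map (subtopology T (fst c)) (top_of_set (snd c ` fst c)) (snd c)"

definition chart_inv :: "('p, 'e) chart \<Rightarrow> 'e \<Rightarrow> 'p"
  where "chart_inv c = inv_into (fst c) (snd c)"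

text \<open>The atlas need not be maximal.\<close>

definition manifold :: "('p, 'e::model_space) mfd \<Rightarrow> bool"
  where "manifold M \<longleftrightarrow>
    Hausdorff_space (mtop M) \<and> second_countable (mtop M) \<and>
    (\<forall>c\<in>atlas M. is_chart (mtop M) c) \<and> (\<Union>c\<in>atlas M. fst c) = points M \<and>
    (\<forall>c\<in>atlas M. \<forall>d\<in>atlas M. smooth_on (snd c ` (fst c \<inter> fst d)) (snd d \<circ> chart_inv c))"

definition smooth_map ::
  "('p, 'e::real_normed_vector) mfd \<Rightarrow> ('q, 'f::real_normed_vector) mfd \<Rightarrow> ('p \<Rightarrow> 'q) \<Rightarrow> bool"
  where "smooth_map M N f \<longleftrightarrow>
    continuous_map (mtop M) (mtop N) f \<and>
    (\<forall>c\<in>atlas M. \<forall>d\<in>atlas N.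
       smooth_on (snd c ` {p \<in> fst c. f p \<in> fst d}) (snd d \<circ> f \<circ> chart_inv c))"

definition diffeo ::
  "('p, 'e::real_normed_vector) mfd \<Rightarrow> ('q, 'f::real_normed_vector) mfd \<Rightarrow> ('p \<Rightarrow> 'q) \<Rightarrow> bool"
  where "diffeo M N f \<longleftrightarrow>
    smooth_map M N f \<and>
    (\<exists>g. smooth_map N M g \<and> (\<forall>p\<in>points M. g (f p) = p) \<and> (\<forall>q\<in>points N. f (g q) = q))"

definition model_mfd :: "('e::real_normed_vector, 'e) mfd"
  where "model_mfd = \<lparr>mtop = euclidean, atlas = {(UNIV, id)}\<rparr>"

definition open_sub :: "('p, 'e) mfd \<Rightarrow> 'p set \<Rightarrow> ('p, 'e) mfd"
  where "open_sub M U =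
    \<lparr>mtop = subtopology (mtop M) U, atlas = (\<lambda>c. (fst c \<inter> U, snd c)) ` atlas M\<rparr>"

definition prod_mfd :: "('p, 'e) mfd \<Rightarrow> ('q, 'f) mfd \<Rightarrow> ('p \<times> 'q, 'e \<times> 'f) mfd"
  where "prod_mfd M N =
    \<lparr>mtop = prod_topology (mtop M) (mtop N),
     atlas = (\<lambda>(c, d). (fst c \<times> fst d, map_prod (snd c) (snd d))) ` (atlas M \<times> atlas N)\<rparr>"

text \<open>
  The smooth structure of an embedded submanifold \<open>S\<close> of \<open>M\<close> whose dimension is that of the type
  \<open>'f\<close>: the charts are all homeomorphisms from relatively open subsets of \<open>S\<close> onto open subsets
  of \<open>'f\<close> that extend locally to smooth functions on \<open>M\<close> and whose inverse is smooth into \<open>M\<close>.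
  Such charts cover \<open>S\<close> exactly if \<open>S\<close> is an embedded submanifold of that dimension.
\<close>

definition submanifold ::
  "('p, 'e::real_normed_vector) mfd \<Rightarrow> 'p set \<Rightarrow> ('p, 'f::real_normed_vector) mfd"
  where "submanifold M S =
    \<lparr>mtop = subtopology (mtop M) S,
     atlas = {c. is_chart (subtopology (mtop M) S) c \<and>
       smooth_map (open_sub model_mfd (snd c ` fst c)) M (chart_inv c) \<and>
       (\<forall>p\<in>fst c. \<exists>W h. openin (mtop M) W \<and> p \<in> W \<and> smooth_map (open_sub M W) model_mfd h \<and>
          (\<forall>q\<in>W \<inter> fst c. h q = snd c q))}\<rparr>"


section \<open>Tangent vectors and differential forms\<close>

text \<open>
  The tangent space at \<open>p\<close> is represented by the model space itself: a tangent vector is its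
  coordinate vector in the chosen chart \<open>chart_at M p\<close> around \<open>p\<close>. Another choice of charts changes the objects below
  only by the induced linear isomorphisms of tangent spaces.
\<close>

definition chart_at :: "('p, 'e) mfd \<Rightarrow> 'p \<Rightarrow> ('p, 'e) chart"
  where "chart_at M p = (SOME c. c \<in> atlas M \<and> p \<in> fst c)"

definition differential ::
  "('p, 'e::real_normed_vector) mfd \<Rightarrow> ('q, 'f::real_normed_vector) mfd \<Rightarrow> ('p \<Rightarrow> 'q) \<Rightarrow> 'p \<Rightarrow> 'e \<Rightarrow> 'f"
  where "differential M N f p =
    frechet_derivative (snd (chart_at N (f p)) \<circ> f \<circ> chart_inv (chart_at M p))
      (at (snd (chart_at M p) p))"

text \<open>The tangent vector at \<open>p\<close> whose coordinate vector in the chart \<open>c\<close> is \<open>v\<close>.\<close>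

definition coord_vector ::
  "('p, 'e::real_normed_vector) mfd \<Rightarrow> ('p, 'e) chart \<Rightarrow> 'p \<Rightarrow> 'e \<Rightarrow> 'e"
  where "coord_vector M c p = frechet_derivative (snd (chart_at M p) \<circ> chart_inv c) (at (snd c p))"

text \<open>
  Forms are \<^const>\<open>undefined\<close> outside the manifold, so that forms agreeing on the manifold are
  equal.
\<close>

definition one_form ::
  "('p, 'e::real_normed_vector) mfd \<Rightarrow> ('p \<Rightarrow> 'e \<Rightarrow> 'v::real_normed_vector) \<Rightarrow> bool"
  where "one_form M \<omega> \<longleftrightarrow>
    \<omega> \<in> extensional (points M) \<and>
    (\<forall>p\<in>points M. linear (\<omega> p)) \<and>
    (\<forall>c\<in>atlas M. \<forall>v. smooth_on (snd c ` fst c)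
       (\<lambda>x. \<omega> (chart_inv c x) (coord_vector M c (chart_inv c x) v)))"

definition pullback ::
  "('p, 'e::real_normed_vector) mfd \<Rightarrow> ('q, 'f::real_normed_vector) mfd \<Rightarrow> ('p \<Rightarrow> 'q) \<Rightarrow>
     ('q \<Rightarrow> 'f \<Rightarrow> 'v) \<Rightarrow> 'p \<Rightarrow> 'e \<Rightarrow> 'v"
  where "pullback M N f \<omega> = (\<lambda>p\<in>points M. \<lambda>v. \<omega> (f p) (differential M N f p v))"

definition apply_form :: "('p, 'e) mfd \<Rightarrow> ('v \<Rightarrow> 'w) \<Rightarrow> ('p \<Rightarrow> 'e \<Rightarrow> 'v) \<Rightarrow> 'p \<Rightarrow> 'e \<Rightarrow> 'w"
  where "apply_form M l \<omega> = (\<lambda>p\<in>points M. \<lambda>v. l (\<omega> p v))"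

definition add_form ::
  "('p, 'e) mfd \<Rightarrow> ('p \<Rightarrow> 'e \<Rightarrow> 'v::plus) \<Rightarrow> ('p \<Rightarrow> 'e \<Rightarrow> 'v) \<Rightarrow> 'p \<Rightarrow> 'e \<Rightarrow> 'v"
  where "add_form M \<omega> \<eta> = (\<lambda>p\<in>points M. \<lambda>v. \<omega> p v + \<eta> p v)"

definition diff_form ::
  "('p, 'e) mfd \<Rightarrow> ('p \<Rightarrow> 'e \<Rightarrow> 'v::minus) \<Rightarrow> ('p \<Rightarrow> 'e \<Rightarrow> 'v) \<Rightarrow> 'p \<Rightarrow> 'e \<Rightarrow> 'v"
  where "diff_form M \<omega> \<eta> = (\<lambda>p\<in>points M. \<lambda>v. \<omega> p v - \<eta> p v)"


section \<open>Lie groups\<close>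

text \<open>
  The Lie algebra of a Lie group modelled on \<open>'e\<close> is its tangent space at the identity, hence the
  type \<open>'e\<close>. Its bracket plays no role below.
\<close>

record ('g, 'e) lie_grp = "'g monoid" +
  mfd_of :: "('g, 'e) mfd"

definition lie_group :: "('g, 'e::model_space) lie_grp \<Rightarrow> bool"
  where "lie_group G \<longleftrightarrow>
    group G \<and> manifold (mfd_of G) \<and> points (mfd_of G) = carrier G \<and>
    smooth_map (prod_mfd (mfd_of G) (mfd_of G)) (mfd_of G) (\<lambda>(x, y). x \<otimes>\<^bsub>G\<^esub> y) \<and>
    smooth_map (mfd_of G) (mfd_of G) (\<lambda>x. inv\<^bsub>G\<^esub> x)"

definition lie_hom ::
  "('g, 'e::real_normed_vector) lie_grp \<Rightarrow> ('h, 'f::real_normed_vector) lie_grp \<Rightarrow> ('g \<Rightarrow> 'h) \<Rightarrow> bool"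
  where "lie_hom G H f \<longleftrightarrow> f \<in> hom G H \<and> smooth_map (mfd_of G) (mfd_of H) f"

definition lie_algebra_map ::
  "('g, 'e::real_normed_vector) lie_grp \<Rightarrow> ('h, 'f::real_normed_vector) lie_grp \<Rightarrow> ('g \<Rightarrow> 'h) \<Rightarrow> 'e \<Rightarrow> 'f"
  where "lie_algebra_map G H f = differential (mfd_of G) (mfd_of H) f \<one>\<^bsub>G\<^esub>"

definition Ad :: "('g, 'e::real_normed_vector) lie_grp \<Rightarrow> 'g \<Rightarrow> 'e \<Rightarrow> 'e"
  where "Ad G g = lie_algebra_map G G (\<lambda>x. g \<otimes>\<^bsub>G\<^esub> x \<otimes>\<^bsub>G\<^esub> inv\<^bsub>G\<^esub> g)"

definition maurer_cartan :: "('g, 'e::real_normed_vector) lie_grp \<Rightarrow> 'g \<Rightarrow> 'e \<Rightarrow> 'e"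
  where "maurer_cartan G =
    (\<lambda>g\<in>carrier G. differential (mfd_of G) (mfd_of G) (\<lambda>x. inv\<^bsub>G\<^esub> g \<otimes>\<^bsub>G\<^esub> x) g)"

definition central_extension ::
  "('a, 'ea::model_space) lie_grp \<Rightarrow> ('b, 'eb::model_space) lie_grp \<Rightarrow> ('c, 'ec::model_space) lie_grp \<Rightarrow>
     ('a \<Rightarrow> 'b) \<Rightarrow> ('b \<Rightarrow> 'c) \<Rightarrow> bool"
  where "central_extension A B C \<alpha> \<beta> \<longleftrightarrow>
    lie_group A \<and> lie_group B \<and> lie_group C \<and> lie_hom A B \<alpha> \<and> lie_hom B C \<beta> \<and>
    inj_on \<alpha> (carrier A) \<and> \<alpha> ` carrier A = kernel B C \<beta> \<and> \<beta> ` carrier B = carrier C \<and>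
    (\<forall>a\<in>carrier A. \<forall>b\<in>carrier B. \<alpha> a \<otimes>\<^bsub>B\<^esub> b = b \<otimes>\<^bsub>B\<^esub> \<alpha> a)"

definition Ad_splitting ::
  "('a, 'ea::model_space) lie_grp \<Rightarrow> ('b, 'eb::model_space) lie_grp \<Rightarrow> ('c, 'ec::model_space) lie_grp \<Rightarrow>
     ('a \<Rightarrow> 'b) \<Rightarrow> ('b \<Rightarrow> 'c) \<Rightarrow> ('ec \<Rightarrow> 'eb) \<Rightarrow> ('eb \<Rightarrow> 'ea) \<Rightarrow> bool"
  where "Ad_splitting A B C \<alpha> \<beta> s t \<longleftrightarrow>
    linear s \<and> (\<forall>\<zeta>. lie_algebra_map B C \<beta> (s \<zeta>) = \<zeta>) \<and>
    (\<forall>b\<in>carrier B. \<forall>\<zeta>. s (Ad C (\<beta> b) \<zeta>) = Ad B b (s \<zeta>)) \<and>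
    linear t \<and> (\<forall>\<xi>. \<xi> = lie_algebra_map A B \<alpha> (t \<xi>) + s (lie_algebra_map B C \<beta> \<xi>))"


section \<open>Equivariant principal bundles and connections\<close>

definition left_action ::
  "('g, 'eg::model_space) lie_grp \<Rightarrow> ('p, 'e::model_space) mfd \<Rightarrow> ('g \<Rightarrow> 'p \<Rightarrow> 'p) \<Rightarrow> bool"
  where "left_action G M act \<longleftrightarrow>
    smooth_map (prod_mfd (mfd_of G) M) M (\<lambda>(g, p). act g p) \<and>
    (\<forall>p\<in>points M. act \<one>\<^bsub>G\<^esub> p = p) \<and>
    (\<forall>g\<in>carrier G. \<forall>h\<in>carrier G. \<forall>p\<in>points M. act (g \<otimes>\<^bsub>G\<^esub> h) p = act g (act h p))"

definition right_action ::
  "('g, 'eg::model_space) lie_grp \<Rightarrow> ('p, 'e::model_space) mfd \<Rightarrow> ('p \<Rightarrow> 'g \<Rightarrow> 'p) \<Rightarrow> bool"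
  where "right_action G M act \<longleftrightarrow>
    smooth_map (prod_mfd M (mfd_of G)) M (\<lambda>(p, g). act p g) \<and>
    (\<forall>p\<in>points M. act p \<one>\<^bsub>G\<^esub> = p) \<and>
    (\<forall>g\<in>carrier G. \<forall>h\<in>carrier G. \<forall>p\<in>points M. act p (g \<otimes>\<^bsub>G\<^esub> h) = act (act p g) h)"

record ('r, 'er, 'x, 'b, 'g) eq_bundle =
  total :: "('r, 'er) mfd"
  proj :: "'r \<Rightarrow> 'x"
  ract :: "'r \<Rightarrow> 'b \<Rightarrow> 'r"
  lact :: "'g \<Rightarrow> 'r \<Rightarrow> 'r"

definition principal_bundle ::
  "('b, 'eb::model_space) lie_grp \<Rightarrow> ('x, 'ex::model_space) mfd \<Rightarrow>
     ('r, 'er::model_space, 'x, 'b, 'g) eq_bundle \<Rightarrow> bool"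
  where "principal_bundle B X E \<longleftrightarrow>
    lie_group B \<and> manifold X \<and> manifold (total E) \<and>
    smooth_map (total E) X (proj E) \<and> right_action B (total E) (ract E) \<and>
    (\<forall>r\<in>points (total E). \<forall>b\<in>carrier B. proj E (ract E r b) = proj E r) \<and>
    (\<forall>x\<in>points X. \<exists>U \<Phi>. openin (mtop X) U \<and> x \<in> U \<and>
       diffeo (prod_mfd (open_sub X U) (mfd_of B))
         (open_sub (total E) {r \<in> points (total E). proj E r \<in> U}) \<Phi> \<and>
       (\<forall>y\<in>U. \<forall>b\<in>carrier B. proj E (\<Phi> (y, b)) = y \<and>
          (\<forall>b'\<in>carrier B. ract E (\<Phi> (y, b)) b' = \<Phi> (y, b \<otimes>\<^bsub>B\<^esub> b'))))"

definition equivariant_principal_bundle ::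
  "('g, 'eg::model_space) lie_grp \<Rightarrow> ('b, 'eb::model_space) lie_grp \<Rightarrow>
     ('x, 'ex::model_space) mfd \<Rightarrow> ('g \<Rightarrow> 'x \<Rightarrow> 'x) \<Rightarrow>
     ('r, 'er::model_space, 'x, 'b, 'g) eq_bundle \<Rightarrow> bool"
  where "equivariant_principal_bundle G B X actX E \<longleftrightarrow>
    lie_group G \<and> principal_bundle B X E \<and>
    left_action G X actX \<and> left_action G (total E) (lact E) \<and>
    (\<forall>g\<in>carrier G. \<forall>r\<in>points (total E). proj E (lact E g r) = actX g (proj E r)) \<and>
    (\<forall>g\<in>carrier G. \<forall>r\<in>points (total E). \<forall>b\<in>carrier B.
       lact E g (ract E r b) = ract E (lact E g r) b)"

text \<open>The value at \<open>r\<close> of the fundamental vector field generated by \<open>\<xi>\<close>.\<close>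

definition fundamental_vector ::
  "('b, 'eb::real_normed_vector) lie_grp \<Rightarrow> ('r, 'er::real_normed_vector, 'x, 'b, 'g) eq_bundle \<Rightarrow>
     'eb \<Rightarrow> 'r \<Rightarrow> 'er"
  where "fundamental_vector B E \<xi> r =
    differential (mfd_of B) (total E) (\<lambda>b. ract E r b) \<one>\<^bsub>B\<^esub> \<xi>"

definition connection ::
  "('b, 'eb::real_normed_vector) lie_grp \<Rightarrow> ('r, 'er::real_normed_vector, 'x, 'b, 'g) eq_bundle \<Rightarrow>
     ('r \<Rightarrow> 'er \<Rightarrow> 'eb) \<Rightarrow> bool"
  where "connection B E \<omega> \<longleftrightarrow>
    one_form (total E) \<omega> \<and>
    (\<forall>r\<in>points (total E). \<forall>\<xi>. \<omega> r (fundamental_vector B E \<xi> r) = \<xi>) \<and>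
    (\<forall>b\<in>carrier B. pullback (total E) (total E) (\<lambda>r. ract E r b) \<omega> =
       apply_form (total E) (Ad B (inv\<^bsub>B\<^esub> b)) \<omega>)"

definition equivariant_connections ::
  "('g, 'eg::real_normed_vector) lie_grp \<Rightarrow> ('b, 'eb::real_normed_vector) lie_grp \<Rightarrow>
     ('r, 'er::real_normed_vector, 'x, 'b, 'g) eq_bundle \<Rightarrow> ('r \<Rightarrow> 'er \<Rightarrow> 'eb) set"
  where "equivariant_connections G B E =
    {\<omega>. connection B E \<omega> \<and>
       (\<forall>g\<in>carrier G. pullback (total E) (total E) (lact E g) \<omega> = \<omega>)}"


section \<open>Equivariant central extensions\<close>

definition equivariant_central_extension ::
  "('g, 'eg::model_space) lie_grp \<Rightarrow> ('b, 'eb::model_space) lie_grp \<Rightarrow> ('c, 'ec::model_space) lie_grp \<Rightarrow>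
     ('b \<Rightarrow> 'c) \<Rightarrow> ('x, 'ex::model_space) mfd \<Rightarrow> ('g \<Rightarrow> 'x \<Rightarrow> 'x) \<Rightarrow>
     ('r, 'er::model_space, 'x, 'b, 'g) eq_bundle \<Rightarrow> ('p, 'ep::model_space, 'x, 'c, 'g) eq_bundle \<Rightarrow>
     ('r \<Rightarrow> 'p) \<Rightarrow> bool"
  where "equivariant_central_extension G B C \<beta> X actX R P \<sigma> \<longleftrightarrow>
    equivariant_principal_bundle G C X actX P \<and>
    equivariant_principal_bundle G B X actX R \<and>
    smooth_map (total R) (total P) \<sigma> \<and>
    (\<forall>r\<in>points (total R). proj P (\<sigma> r) = proj R r) \<and>
    (\<forall>r\<in>points (total R). \<forall>b\<in>carrier B. \<sigma> (ract R r b) = ract P (\<sigma> r) (\<beta> b)) \<and>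
    (\<forall>g\<in>carrier G. \<forall>r\<in>points (total R). \<sigma> (lact R g r) = lact P g (\<sigma> r))"

text \<open>The \<open>A\<close>-bundle \<open>\<sigma>: R \<rightarrow> P\<close>, where \<open>A\<close> acts on \<open>R\<close> through \<open>\<alpha>\<close>.\<close>

definition sigma_bundle ::
  "('a \<Rightarrow> 'b) \<Rightarrow> ('r, 'er, 'x, 'b, 'g) eq_bundle \<Rightarrow> ('r \<Rightarrow> 'p) \<Rightarrow> ('r, 'er, 'p, 'a, 'g) eq_bundle"
  where "sigma_bundle \<alpha> R \<sigma> =
    \<lparr>total = total R, proj = \<sigma>, ract = (\<lambda>r a. ract R r (\<alpha> a)), lact = lact R\<rparr>"

text \<open>
  \<open>R \<times>\<^sub>X R\<close> has dimension \<open>dim R + dim B\<close>; the argument \<open>B\<close> only serves to fix the type of the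
  model space.
\<close>

definition fibre_square ::
  "('b, 'eb::real_normed_vector) lie_grp \<Rightarrow> ('r, 'er::real_normed_vector, 'x, 'b, 'g) eq_bundle \<Rightarrow>
     ('r \<times> 'r, 'er \<times> 'eb) mfd"
  where "fibre_square B R = submanifold (prod_mfd (total R) (total R))
    {(r1, r2). r1 \<in> points (total R) \<and> r2 \<in> points (total R) \<and> proj R r1 = proj R r2}"

definition bundle_difference ::
  "('b, 'eb) lie_grp \<Rightarrow> ('r, 'er, 'x, 'b, 'g) eq_bundle \<Rightarrow> 'r \<times> 'r \<Rightarrow> 'b"
  where "bundle_difference B R = (\<lambda>(r1, r2). THE b. b \<in> carrier B \<and> ract R r1 b = r2)"

definition compatible_connections ::
  "('b, 'eb::real_normed_vector) lie_grp \<Rightarrow> ('eb \<Rightarrow> 'ea::real_normed_vector) \<Rightarrow>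
     ('r, 'er::real_normed_vector, 'x, 'b, 'g) eq_bundle \<Rightarrow> ('r \<Rightarrow> 'er \<Rightarrow> 'ea) \<Rightarrow> bool"
  where "compatible_connections B t R \<omega>\<sigma> \<longleftrightarrow>
    (let F = fibre_square B R in
     diff_form F (pullback F (total R) snd \<omega>\<sigma>) (pullback F (total R) fst \<omega>\<sigma>) =
       pullback F (mfd_of B) (bundle_difference B R)
         (apply_form (mfd_of B) t (maurer_cartan B)))"

text \<open>The form \<open>\<alpha>\<^sub>* \<omega>\<^sup>\<sigma> + s (\<sigma>\<^sup>* \<omega>\<^sup>\<pi>)\<close> on \<open>R\<close>.\<close>

definition assembled_form ::
  "('a, 'ea::real_normed_vector) lie_grp \<Rightarrow> ('b, 'eb::real_normed_vector) lie_grp \<Rightarrow> ('a \<Rightarrow> 'b) \<Rightarrow>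
     ('ec \<Rightarrow> 'eb) \<Rightarrow> ('r, 'er::real_normed_vector, 'x, 'b, 'g) eq_bundle \<Rightarrow>
     ('p, 'ep::real_normed_vector, 'x, 'c, 'g) eq_bundle \<Rightarrow> ('r \<Rightarrow> 'p) \<Rightarrow>
     ('r \<Rightarrow> 'er \<Rightarrow> 'ea) \<Rightarrow> ('p \<Rightarrow> 'ep \<Rightarrow> 'ec) \<Rightarrow> 'r \<Rightarrow> 'er \<Rightarrow> 'eb"
  where "assembled_form A B \<alpha> s R P \<sigma> \<omega>\<sigma> \<omega>\<pi> =
    add_form (total R)
      (apply_form (total R) (lie_algebra_map A B \<alpha>) \<omega>\<sigma>)
      (apply_form (total R) s (pullback (total R) (total P) \<sigma> \<omega>\<pi>))"

end

theory Submission
  imports Defs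
begin

text \<open>
  Write \<open>\<alpha>'\<close> and \<open>\<beta>'\<close> for the maps of Lie algebras induced by \<open>\<alpha>\<close> and \<open>\<beta>\<close>. The splitting
  decomposes every element of the Lie algebra of \<open>B\<close> as \<open>\<xi> = \<alpha>' (t \<xi>) + s (\<beta>' \<xi>)\<close>, so a form on \<open>R\<close>
  with values in that Lie algebra is the same as its two components under \<open>t\<close> and \<open>\<beta>'\<close>. For a
  \<open>B\<close>-connection \<open>\<omega>\<close> the first component \<open>t \<circ> \<omega>\<close> is an \<open>A\<close>-connection on \<open>\<sigma>\<close>, and the second one
  \<open>\<beta>' \<circ> \<omega>\<close> is the pullback along \<open>\<sigma>\<close> of a unique \<open>C\<close>-connection on \<open>P\<close>. Compatibility of the
  first component expresses that it comes from a \<open>B\<close>-connection: differentiating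
  \<open>r\<^sub>2 = r\<^sub>1 \<psi>(r\<^sub>1, r\<^sub>2)\<close> on the fibre square gives
  \<open>\<omega>(dr\<^sub>2) = Ad(\<psi>\<inverse>) (\<omega>(dr\<^sub>1)) + \<theta>(d\<psi>)\<close>, and \<open>t\<close> is invariant under the adjoint action, so
  applying \<open>t\<close> yields the condition. Conversely, the condition on the pairs \<open>(r, r b)\<close> says, for
  \<open>b\<close> moving through the identity, that the form is \<open>t\<close> on all vertical vectors
  (\<open>compatible_fund\<close>) and, for constant \<open>b\<close>, that it is invariant under all of \<open>B\<close>
  (\<open>compatible_invariant\<close>); this is what makes the assembled form a \<open>B\<close>-connection.

  Three ingredients need an argument beyond this computation.

  First, \<open>t \<circ> \<alpha>'\<close> is the identity only because \<open>\<alpha>'\<close> is injective, that is, because an injective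
  homomorphism of Lie groups is an immersion. This is proved in \<open>injective_hom_immersion\<close> by
  following the powers of a small group element.

  Secondly, the tangent space of the fibre square must be known: \<open>ex_fibre_square_chart\<close> constructs
  its charts from local trivialisations of \<open>R\<close>, and \<open>compatible_connections_along\<close> and
  \<open>compatible_connectionsI\<close> turn the compatibility condition into a statement about pairs of maps
  into \<open>R\<close> with the same projection.

  Thirdly, \<open>\<beta>' \<circ> \<omega>\<close> must descend smoothly to \<open>P\<close>. It kills the kernel of the differential of
  \<open>\<sigma>\<close> (\<open>d\<sigma>_kernel\<close>, \<open>descent_well_defined\<close>), and near each point the descended form is expressed by
  a local section of \<open>R\<close> over \<open>X\<close> and the Maurer-Cartan form of \<open>C\<close> (\<open>descended_smooth\<close>), so that no
  local section of \<open>\<beta>\<close> is needed.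

  All differential identities are obtained by one method. A tangent vector is presented as the
  velocity \<open>vel\<close> of a smooth map \<open>psmooth\<close> from an open set of a model space, an identity between
  such maps is differentiated by the chain rule \<open>vel_smooth_map\<close>, and two moving factors are
  separated by the Leibniz rule \<open>vel_diagonal\<close>.
\<close>


section \<open>Linear algebra in model spaces\<close>

text \<open>The substitute in a model space for \<^const>\<open>Basis\<close> of a Euclidean space.\<close>

definition onb :: "'e::model_space set"
  where "onb = (SOME U. finite U \<and> (\<forall>u\<in>U. \<forall>v\<in>U. inner u v = (if u = v then 1 else 0)) \<and>
    (\<forall>x. (\<forall>u\<in>U. inner x u = 0) \<longrightarrow> x = 0))"

lemma onb_props:
  shows finite_onb: "finite (onb :: 'e::model_space set)"
    and inner_onb: "u \<in> onb \<Longrightarrow> v \<in> onb \<Longrightarrow> inner u (v::'e) = (if u = v then 1 else 0)"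
    and onb_zero: "(\<And>u. u \<in> onb \<Longrightarrow> inner (x::'e) u = 0) \<Longrightarrow> x = 0"
proof -
  have "finite (onb :: 'e set) \<and> (\<forall>u\<in>(onb :: 'e set). \<forall>v\<in>onb. inner u v = (if u = v then 1 else 0)) \<and>
    (\<forall>x::'e. (\<forall>u\<in>onb. inner x u = 0) \<longrightarrow> x = 0)"
    unfolding onb_def by (rule someI_ex[OF ex_orthonormal_basis])
  then show "finite (onb :: 'e::model_space set)"
    "u \<in> onb \<Longrightarrow> v \<in> onb \<Longrightarrow> inner u (v::'e) = (if u = v then 1 else 0)"
    "(\<And>u. u \<in> onb \<Longrightarrow> inner (x::'e) u = 0) \<Longrightarrow> x = 0"
    by blast+
qed

lemma onb_expand: "(x::'e::model_space) = (\<Sum>u\<in>onb. inner x u *\<^sub>R u)"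
proof -
  have "x - (\<Sum>u\<in>onb. inner x u *\<^sub>R u) = 0"
  proof (rule onb_zero)
    fix v :: 'e assume v: "v \<in> onb"
    have "inner (\<Sum>u\<in>onb. inner x u *\<^sub>R u) v = (\<Sum>u\<in>onb. inner x u * (if u = v then 1 else 0))"
      using v by (auto simp: inner_sum_left inner_onb intro!: sum.cong)
    also have "\<dots> = inner x v"
      using v by (simp add: finite_onb if_distrib[of "\<lambda>c. _ * c"] cong: if_cong)
    finally show "inner (x - (\<Sum>u\<in>onb. inner x u *\<^sub>R u)) v = 0"
      by (simp add: inner_diff_left)
  qed
  then show ?thesis by simp
qed

lemma linear_onb_expand:
  assumes "linear (L :: 'e::model_space \<Rightarrow> 'v::real_normed_vector)"
  shows "L x = (\<Sum>u\<in>onb. inner x u *\<^sub>R L u)"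
  by (subst onb_expand[of x]) (simp add: linear_sum[OF assms] linear_scale[OF assms])

lemma norm_onb: "u \<in> onb \<Longrightarrow> norm (u::'e::model_space) = 1"
  by (simp add: norm_eq_sqrt_inner inner_onb)

lemma linear_bounded_model:
  assumes "linear (L :: 'e::model_space \<Rightarrow> 'v::real_normed_vector)"
  shows "norm (L x) \<le> norm x * (\<Sum>u\<in>onb. norm (L u))"
proof -
  have "norm (L x) \<le> (\<Sum>u\<in>onb. norm (inner x u *\<^sub>R L u))"
    by (subst linear_onb_expand[OF assms]) (rule norm_sum)
  also have "\<dots> \<le> (\<Sum>u\<in>onb. norm x * norm (L u))"
  proof (rule sum_mono)
    fix u :: 'e assume "u \<in> onb"
    then have "\<bar>inner x u\<bar> \<le> norm x"
      using Cauchy_Schwarz_ineq2[of x u] by (simp add: norm_onb)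
    then show "norm (inner x u *\<^sub>R L u) \<le> norm x * norm (L u)"
      by (simp add: mult_right_mono)
  qed
  finally show ?thesis by (simp add: sum_distrib_left)
qed

lemma bounded_linear_model:
  assumes "linear (L :: 'e::model_space \<Rightarrow> 'v::real_normed_vector)"
  shows "bounded_linear L"
proof -
  interpret linear L by fact
  show ?thesis
    by unfold_locales (use linear_bounded_model[OF assms] in blast)
qed

text \<open>
  The ball is a closed subset of the cube of all vectors with coordinates in \<open>[-r, r]\<close>, and this cube
  is compact by adding one basis direction at a time.
\<close>

lemma compact_cball_model: "compact (cball (x::'e::model_space) r)"
proof -
  have cube: "compact {\<Sum>u\<in>U. c u *\<^sub>R u | c. \<forall>u\<in>U. \<bar>c u\<bar> \<le> r}"
    if "finite U" for U :: "'e set"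
    using that
  proof (induction U)
    case empty
    then show ?case by simp
  next
    case (insert v U)
    let ?K = "{\<Sum>u\<in>U. c u *\<^sub>R u | c. \<forall>u\<in>U. \<bar>c u\<bar> \<le> r}"
    have "compact ((\<lambda>c. c *\<^sub>R v) ` {-r..r})"
      by (intro compact_continuous_image continuous_intros) simp
    with insert.IH have "compact {a + b | a b. a \<in> (\<lambda>c. c *\<^sub>R v) ` {-r..r} \<and> b \<in> ?K}"
      by (intro compact_sums)
    also have "{a + b | a b. a \<in> (\<lambda>c. c *\<^sub>R v) ` {-r..r} \<and> b \<in> ?K} =
      {\<Sum>u\<in>insert v U. c u *\<^sub>R u | c. \<forall>u\<in>insert v U. \<bar>c u\<bar> \<le> r}" (is "?L = ?R")
    proof (intro equalityI subsetI)
      fix z assume "z \<in> ?L"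
      then obtain a b where ab: "a \<in> (\<lambda>c. c *\<^sub>R v) ` {-r..r}" "b \<in> ?K" "z = a + b"
        by blast
      from ab(1) obtain d where "d \<in> {-r..r}" and d': "a = d *\<^sub>R v"
        by blast
      then have d: "\<bar>d\<bar> \<le> r" "a = d *\<^sub>R v"
        by auto
      from ab(2) obtain c where "\<forall>u\<in>U. \<bar>c u\<bar> \<le> r" "b = (\<Sum>u\<in>U. c u *\<^sub>R u)"
        by blast
      with ab(3) d have dc: "\<bar>d\<bar> \<le> r" "\<forall>u\<in>U. \<bar>c u\<bar> \<le> r" "z = d *\<^sub>R v + (\<Sum>u\<in>U. c u *\<^sub>R u)"
        by simp_all
      have "(\<Sum>u\<in>U. (if u = v then d else c u) *\<^sub>R u) = (\<Sum>u\<in>U. c u *\<^sub>R u)"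
        using insert.hyps by (intro sum.cong) auto
      with dc insert.hyps show "z \<in> ?R"
        by (intro CollectI exI[of _ "c(v := d)"]) (auto simp: fun_upd_def)
    next
      fix z assume "z \<in> ?R"
      then obtain c where c: "\<forall>u\<in>insert v U. \<bar>c u\<bar> \<le> r" "z = (\<Sum>u\<in>insert v U. c u *\<^sub>R u)"
        by blast
      have "c v *\<^sub>R v \<in> (\<lambda>c. c *\<^sub>R v) ` {-r..r}"
        using c(1) by (intro imageI) (simp add: abs_le_iff)
      moreover have "(\<Sum>u\<in>U. c u *\<^sub>R u) \<in> ?K"
        using c(1) by blast
      moreover have "z = c v *\<^sub>R v + (\<Sum>u\<in>U. c u *\<^sub>R u)"
        using c(2) insert.hyps by simp
      ultimately show "z \<in> ?L" by blast
    qed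
    finally show ?case .
  qed
  have "compact (cball 0 r \<inter> {\<Sum>u\<in>(onb::'e set). c u *\<^sub>R u | c. \<forall>u\<in>onb. \<bar>c u\<bar> \<le> r})"
    by (intro closed_Int_compact cube finite_onb) simp
  also have "cball 0 r \<inter> {\<Sum>u\<in>(onb::'e set). c u *\<^sub>R u | c. \<forall>u\<in>onb. \<bar>c u\<bar> \<le> r} = cball 0 r"
  proof (intro equalityI subsetI IntI CollectI)
    fix z :: 'e assume z: "z \<in> cball 0 r"
    show "\<exists>c. z = (\<Sum>u\<in>onb. c u *\<^sub>R u) \<and> (\<forall>u\<in>onb. \<bar>c u\<bar> \<le> r)"
    proof (intro exI conjI ballI)
      show "z = (\<Sum>u\<in>onb. inner z u *\<^sub>R u)" by (rule onb_expand)
      fix u :: 'e assume "u \<in> onb"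
      then show "\<bar>inner z u\<bar> \<le> r"
        using Cauchy_Schwarz_ineq2[of z u] z by (simp add: norm_onb)
    qed
  qed auto
  finally have "compact ((+) x ` cball 0 r)"
    by (rule compact_translation)
  also have "(+) x ` cball 0 r = cball x r"
    by (simp add: image_add_cball)
  finally show ?thesis .
qed

section \<open>Smooth functions\<close>

lemma Ck_on_cong:
  assumes "open S" "\<And>x. x \<in> S \<Longrightarrow> f x = g x" "Ck_on k S f"
  shows "Ck_on k S g"
  using assms(2,3)
proof (induction k arbitrary: f g)
  case 0
  then show ?case using continuous_on_cong[OF refl, of S f g] by simp
next
  case (Suc k)
  have dg: "(g has_derivative D) (at x) \<longleftrightarrow> (f has_derivative D) (at x)" if "x \<in> S" for x D
    using has_derivative_transform_within_open[OF _ assms(1) that] Suc.prems(1) by metis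
  then have *: "frechet_derivative f (at x) = frechet_derivative g (at x)" if "x \<in> S" for x
    using that by (simp add: frechet_derivative_def)
  have "Ck_on k S (\<lambda>x. frechet_derivative g (at x) v)" for v
    by (rule Suc.IH[where f = "\<lambda>x. frechet_derivative f (at x) v"]) (use * Suc.prems(2) in auto)
  moreover have "g differentiable (at x)" if "x \<in> S" for x
    using Suc.prems(2) dg[OF that] that by (simp add: differentiable_def)
  ultimately show ?case by simp
qed

lemma Ck_on_subset: "Ck_on k S f \<Longrightarrow> T \<subseteq> S \<Longrightarrow> Ck_on k T f"
  by (induction k arbitrary: f) (auto intro: continuous_on_subset)

lemma Ck_on_local:
  assumes "\<And>x. x \<in> S \<Longrightarrow> \<exists>T. open T \<and> x \<in> T \<and> Ck_on k (S \<inter> T) f"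
  shows "Ck_on k S f"
  using assms
proof (induction k arbitrary: f)
  case 0
  have "continuous (at x within S) f" if x: "x \<in> S" for x
  proof -
    obtain T where T: "open T" "x \<in> T" "continuous_on (S \<inter> T) f"
      using 0[OF x] by auto
    then have "continuous (at x within S \<inter> T) f"
      using x by (simp add: continuous_on_eq_continuous_within)
    moreover have "at x within S = at x within S \<inter> T"
      by (rule at_within_nhd[OF T(2,1)]) auto
    ultimately show ?thesis by simp
  qed
  then show ?case by (simp add: continuous_on_eq_continuous_within)
next
  case (Suc k)
  have "Ck_on k S (\<lambda>x. frechet_derivative f (at x) v)" for v
  proof (rule Suc.IH)
    fix x assume "x \<in> S"
    from Suc.prems[OF this] obtain T where "open T" "x \<in> T" "Ck_on (Suc k) (S \<inter> T) f" by blast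
    then show "\<exists>T. open T \<and> x \<in> T \<and> Ck_on k (S \<inter> T) (\<lambda>x. frechet_derivative f (at x) v)"
      by auto
  qed
  moreover have "f differentiable (at x)" if x: "x \<in> S" for x
    using Suc.prems[OF x] x by auto
  ultimately show ?case by simp
qed

lemma Ck_on_Suc_imp: "Ck_on (Suc k) S f \<Longrightarrow> Ck_on k S f"
proof (induction k arbitrary: f)
  case 0
  then show ?case
    by (auto intro!: differentiable_imp_continuous_on differentiable_at_imp_differentiable_on)
next
  case (Suc k)
  show ?case
    unfolding Ck_on.simps(2)[of k]
  proof (intro conjI allI)
    show "\<forall>x\<in>S. f differentiable at x" using Suc.prems by simp
    show "Ck_on k S (\<lambda>x. frechet_derivative f (at x) v)" for v
      using Suc.prems by (intro Suc.IH) (simp only: Ck_on.simps(2)[of "Suc k"])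
  qed
qed

text \<open>
  On an open set any expression for the derivative may replace the one chosen by
  \<^const>\<open>frechet_derivative\<close>; the induction steps below differentiate by rules and never unfold it.
\<close>

lemma Ck_on_SucI:
  assumes "open S" and D: "\<And>x. x \<in> S \<Longrightarrow> (f has_derivative D x) (at x)"
    and "\<And>v. Ck_on k S (\<lambda>x. D x v)"
  shows "Ck_on (Suc k) S f"
proof -
  have "Ck_on k S (\<lambda>x. frechet_derivative f (at x) v)" for v
    by (rule Ck_on_cong[OF assms(1) _ assms(3)]) (simp add: frechet_derivative_at[OF D, symmetric])
  then show ?thesis using D by (auto simp: differentiable_def)
qed

lemma Ck_on_const: "Ck_on k S (\<lambda>x. c)"
  by (induction k arbitrary: c) (auto simp: frechet_derivative_const)

lemma Ck_on_bounded_linear: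
  assumes "bounded_linear L" "open S" "Ck_on k S f"
  shows "Ck_on k S (\<lambda>x. L (f x))"
  using assms(3)
proof (induction k arbitrary: f)
  case 0
  then show ?case
    by (auto intro!: bounded_linear.continuous_on[OF assms(1)])
next
  case (Suc k)
  show ?case
  proof (rule Ck_on_SucI[OF assms(2)])
    show "((\<lambda>x. L (f x)) has_derivative (\<lambda>v. L (frechet_derivative f (at x) v))) (at x)"
      if "x \<in> S" for x
      using Suc.prems that
      by (intro bounded_linear.has_derivative[OF assms(1)]) (simp add: frechet_derivative_works)
    show "Ck_on k S (\<lambda>x. L (frechet_derivative f (at x) v))" for v
      using Suc.prems by (intro Suc.IH) simp
  qed
qed

lemma Ck_on_add:
  assumes "open S" "Ck_on k S f" "Ck_on k S g"
  shows "Ck_on k S (\<lambda>x. f x + g x)"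
  using assms(2,3)
proof (induction k arbitrary: f g)
  case 0
  then show ?case by (auto intro: continuous_on_add)
next
  case (Suc k)
  show ?case
  proof (rule Ck_on_SucI[OF assms(1)])
    show "((\<lambda>x. f x + g x) has_derivative
        (\<lambda>v. frechet_derivative f (at x) v + frechet_derivative g (at x) v)) (at x)"
      if "x \<in> S" for x
      using Suc.prems that
      by (intro has_derivative_add) (simp_all add: frechet_derivative_works[symmetric])
    show "Ck_on k S (\<lambda>x. frechet_derivative f (at x) v + frechet_derivative g (at x) v)" for v
      using Suc.prems by (intro Suc.IH) simp_all
  qed
qed

lemma Ck_on_scaleR:
  assumes "open S" "Ck_on k S f" "Ck_on k S g"
  shows "Ck_on k S (\<lambda>x. f x *\<^sub>R g x)"
  using assms(2,3)
proof (induction k arbitrary: f g)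
  case 0
  then show ?case by (auto intro: continuous_on_scaleR)
next
  case (Suc k)
  show ?case
  proof (rule Ck_on_SucI[OF assms(1)])
    show "((\<lambda>x. f x *\<^sub>R g x) has_derivative
        (\<lambda>v. f x *\<^sub>R frechet_derivative g (at x) v + frechet_derivative f (at x) v *\<^sub>R g x)) (at x)"
      if "x \<in> S" for x
      using Suc.prems that
      by (intro has_derivative_scaleR) (simp_all add: frechet_derivative_works[symmetric])
    show "Ck_on k S (\<lambda>x. f x *\<^sub>R frechet_derivative g (at x) v + frechet_derivative f (at x) v *\<^sub>R g x)" for v
      using Suc.prems Ck_on_Suc_imp[OF Suc.prems(1)] Ck_on_Suc_imp[OF Suc.prems(2)]
      by (intro Ck_on_add[OF assms(1)] Suc.IH) (simp_all del: Ck_on.simps(1))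
  qed
qed

lemma Ck_on_sum:
  assumes "open S" "finite I" "\<And>i. i \<in> I \<Longrightarrow> Ck_on k S (f i)"
  shows "Ck_on k S (\<lambda>x. \<Sum>i\<in>I. f i x)"
  using assms(2,3) by (induction I) (simp_all add: Ck_on_const Ck_on_add[OF assms(1)])

text \<open>
  The derivative of a composite is not a composite: \<open>D(g \<circ> f)(x) v = Dg(f x)(Df(x) v)\<close> has a
  variable direction. In finite dimension expanding this direction in an orthonormal basis reduces
  the induction step to products of composites. This is where the smooth calculus needs
  finite-dimensional domains.
\<close>

lemma Ck_on_compose:
  fixes f :: "'a::real_normed_vector \<Rightarrow> 'b::model_space"
  assumes S: "open S" and fS: "f ` S \<subseteq> T" and "Ck_on k S f" "Ck_on k T g"
  shows "Ck_on k S (\<lambda>x. g (f x))"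
  using assms(3,4)
proof (induction k arbitrary: g)
  case 0
  then show ?case using fS by (auto intro: continuous_on_compose2)
next
  case (Suc k)
  have df: "(f has_derivative frechet_derivative f (at x)) (at x)" if "x \<in> S" for x
    using Suc.prems(1) that by (simp add: frechet_derivative_works[symmetric])
  have dg: "(g has_derivative frechet_derivative g (at (f x))) (at (f x))" if "x \<in> S" for x
    using Suc.prems(2) fS that by (auto simp add: frechet_derivative_works[symmetric])
  have expand: "frechet_derivative g (at (f x)) w =
      (\<Sum>u\<in>onb. inner w u *\<^sub>R frechet_derivative g (at (f x)) u)" if "x \<in> S" for x w
    by (rule linear_onb_expand[OF has_derivative_linear[OF dg[OF that]]])
  show ?case
  proof (rule Ck_on_SucI[OF S])
    fix x assume x: "x \<in> S"
    show "((\<lambda>x. g (f x)) has_derivative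
        (\<lambda>v. \<Sum>u\<in>onb. inner (frechet_derivative f (at x) v) u *\<^sub>R frechet_derivative g (at (f x)) u)) (at x)"
      unfolding expand[OF x, symmetric] by (rule has_derivative_compose[OF df[OF x] dg[OF x]])
  next
    fix v
    show "Ck_on k S (\<lambda>x. \<Sum>u\<in>onb. inner (frechet_derivative f (at x) v) u *\<^sub>R
        frechet_derivative g (at (f x)) u)"
      using Suc.prems Ck_on_Suc_imp[OF Suc.prems(1)]
      by (intro Ck_on_sum finite_onb Ck_on_scaleR S Suc.IH
          Ck_on_bounded_linear[OF bounded_linear_inner_left]) simp_all
  qed
qed

lemma smooth_on_cong:
  "open S \<Longrightarrow> (\<And>x. x \<in> S \<Longrightarrow> f x = g x) \<Longrightarrow> smooth_on S f \<longleftrightarrow> smooth_on S g"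
  unfolding smooth_on_def using Ck_on_cong[of S f g] Ck_on_cong[of S g f] by auto

lemma smooth_on_congI:
  "smooth_on S g \<Longrightarrow> open S \<Longrightarrow> (\<And>x. x \<in> S \<Longrightarrow> f x = g x) \<Longrightarrow> smooth_on S f"
  using smooth_on_cong[of S f g] by simp

lemma smooth_on_subset: "smooth_on S f \<Longrightarrow> T \<subseteq> S \<Longrightarrow> smooth_on T f"
  unfolding smooth_on_def by (blast intro: Ck_on_subset)

lemma smooth_on_local:
  assumes "\<And>x. x \<in> S \<Longrightarrow> \<exists>T. open T \<and> x \<in> T \<and> smooth_on (S \<inter> T) f"
  shows "smooth_on S f"
  unfolding smooth_on_def
proof
  show "Ck_on k S f" for k
    by (rule Ck_on_local) (use assms smooth_on_def in blast)
qed

lemma smooth_on_const [simp]: "smooth_on S (\<lambda>x. c)"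
  by (simp add: smooth_on_def Ck_on_const)

lemma smooth_on_bounded_linear:
  "bounded_linear L \<Longrightarrow> open S \<Longrightarrow> smooth_on S f \<Longrightarrow> smooth_on S (\<lambda>x. L (f x))"
  unfolding smooth_on_def by (blast intro: Ck_on_bounded_linear)

lemma smooth_on_add: "open S \<Longrightarrow> smooth_on S f \<Longrightarrow> smooth_on S g \<Longrightarrow> smooth_on S (\<lambda>x. f x + g x)"
  unfolding smooth_on_def by (blast intro: Ck_on_add)

lemma smooth_on_compose:
  fixes f :: "'a::real_normed_vector \<Rightarrow> 'b::model_space"
  shows "open S \<Longrightarrow> f ` S \<subseteq> T \<Longrightarrow> smooth_on S f \<Longrightarrow> smooth_on T g \<Longrightarrow> smooth_on S (\<lambda>x. g (f x))"
  unfolding smooth_on_def by (blast intro: Ck_on_compose)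

lemma smooth_on_derivative: "smooth_on S f \<Longrightarrow> smooth_on S (\<lambda>x. frechet_derivative f (at x) v)"
  unfolding smooth_on_def using Ck_on.simps(2) by blast

lemma smooth_on_has_derivative:
  "smooth_on S f \<Longrightarrow> x \<in> S \<Longrightarrow> (f has_derivative frechet_derivative f (at x)) (at x)"
  unfolding smooth_on_def using Ck_on.simps(2)[of 0 S f] by (metis frechet_derivative_works)

lemma smooth_on_continuous: "smooth_on S f \<Longrightarrow> continuous_on S f"
  unfolding smooth_on_def using Ck_on.simps(1) by blast

lemma smooth_on_id: "open S \<Longrightarrow> smooth_on S (\<lambda>x. x)"
proof -
  have "Ck_on k S (\<lambda>x. x)" for k
    by (cases k) (auto simp: Ck_on_const continuous_on_id frechet_derivative_ident)
  then show ?thesis by (simp add: smooth_on_def)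
qed

lemma smooth_on_Pair:
  assumes "open S" "smooth_on S f" "smooth_on S g"
  shows "smooth_on S (\<lambda>x. (f x, g x))"
proof -
  have "smooth_on S (\<lambda>x. (f x, 0) + (0, g x))"
    using assms
    by (intro smooth_on_add smooth_on_bounded_linear[where L = "\<lambda>x. (x, 0)"]
        smooth_on_bounded_linear[where L = "\<lambda>x. (0, x)"] bounded_linear_Pair
        bounded_linear_ident bounded_linear_zero)
  then show ?thesis by simp
qed

lemma smooth_on_fst: "open S \<Longrightarrow> smooth_on S f \<Longrightarrow> smooth_on S (\<lambda>x. fst (f x))"
  by (rule smooth_on_bounded_linear[OF bounded_linear_fst])

lemma smooth_on_snd: "open S \<Longrightarrow> smooth_on S f \<Longrightarrow> smooth_on S (\<lambda>x. snd (f x))"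
  by (rule smooth_on_bounded_linear[OF bounded_linear_snd])

text \<open>
  As for composites, the variable argument is expanded in an orthonormal basis. This reduces the
  smoothness of a form on a variable vector to its smoothness on constant ones.
\<close>

lemma smooth_on_linear_family:
  fixes g :: "'a::real_normed_vector \<Rightarrow> 'e::model_space"
  assumes "open S" "\<And>x. x \<in> S \<Longrightarrow> linear (L x)" "\<And>v. smooth_on S (\<lambda>x. L x v)" "smooth_on S g"
  shows "smooth_on S (\<lambda>x. L x (g x))"
proof -
  have "Ck_on k S (\<lambda>x. \<Sum>u\<in>onb. inner (g x) u *\<^sub>R L x u)" for k
    using assms
    by (intro Ck_on_sum finite_onb Ck_on_scaleR Ck_on_bounded_linear[OF bounded_linear_inner_left])
      (simp_all add: smooth_on_def)
  then have "smooth_on S (\<lambda>x. \<Sum>u\<in>onb. inner (g x) u *\<^sub>R L x u)"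
    by (simp add: smooth_on_def)
  then show ?thesis
    by (rule smooth_on_congI[OF _ assms(1) linear_onb_expand[OF assms(2)]])
qed

section \<open>Charts\<close>

lemma is_chart_props:
  assumes "is_chart T c"
  shows chart_inj: "inj_on (snd c) (fst c)"
    and chart_open: "openin T (fst c)"
    and chart_open_image: "open (snd c ` fst c)"
    and chart_continuous: "continuous_map (subtopology T (fst c)) euclidean (snd c)"
    and chart_inv_continuous: "continuous_map (top_of_set (snd c ` fst c)) T (chart_inv c)"
proof -
  have h: "homeomorphic_map (subtopology T (fst c)) (top_of_set (snd c ` fst c)) (snd c)"
    and o: "openin T (fst c)" "open (snd c ` fst c)"
    using assms by (auto simp: is_chart_def)
  show "openin T (fst c)" "open (snd c ` fst c)" by fact+
  have ts: "topspace (subtopology T (fst c)) = fst c"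
    using openin_subset[OF o(1)] by (simp add: inf_absorb2)
  show inj: "inj_on (snd c) (fst c)"
    using h ts by (simp add: homeomorphic_eq_everything_map)
  have cm: "continuous_map (subtopology T (fst c)) (top_of_set (snd c ` fst c)) (snd c)"
    using h by (simp add: homeomorphic_eq_everything_map)
  then show "continuous_map (subtopology T (fst c)) euclidean (snd c)"
    using continuous_map_in_subtopology by blast
  obtain g where g: "homeomorphic_maps (subtopology T (fst c)) (top_of_set (snd c ` fst c)) (snd c) g"
    using h homeomorphic_map_maps by blast
  have "continuous_map (top_of_set (snd c ` fst c)) (subtopology T (fst c)) g"
    using g by (simp add: homeomorphic_maps_def)
  moreover have "g x = chart_inv c x" if "x \<in> snd c ` fst c" for x
  proof -
    from that obtain p where p: "p \<in> fst c" "x = snd c p" by blast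
    then have "g x = p" using g ts by (auto simp: homeomorphic_maps_def)
    then show ?thesis using p inj by (simp add: chart_inv_def)
  qed
  ultimately have "continuous_map (top_of_set (snd c ` fst c)) (subtopology T (fst c)) (chart_inv c)"
    by (rule continuous_map_eq) auto
  then show "continuous_map (top_of_set (snd c ` fst c)) T (chart_inv c)"
    using continuous_map_in_subtopology by blast
qed

lemma chart_inv_left: "is_chart T c \<Longrightarrow> p \<in> fst c \<Longrightarrow> chart_inv c (snd c p) = p"
  by (simp add: chart_inv_def chart_inj)

lemma chart_inv_right: "x \<in> snd c ` fst c \<Longrightarrow> snd c (chart_inv c x) = x"
  by (simp add: chart_inv_def f_inv_into_f)

lemma chart_inv_into: "x \<in> snd c ` fst c \<Longrightarrow> chart_inv c x \<in> fst c"
  by (simp add: chart_inv_def inv_into_into)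

text \<open>
  Compositions and the chain rule only need charts that cover the space. Smoothness of the
  transition maps enters separately, through smoothness of the inverse charts. The distinction allows
  the fibre square to be treated through its charts alone.
\<close>

definition charted :: "('p, 'e::model_space) mfd \<Rightarrow> bool"
  where "charted M \<longleftrightarrow> (\<forall>c\<in>atlas M. is_chart (mtop M) c) \<and> (\<Union>c\<in>atlas M. fst c) = points M"

definition smooth_atlas :: "('p, 'e::model_space) mfd \<Rightarrow> bool"
  where "smooth_atlas M \<longleftrightarrow> charted M \<and>
    (\<forall>c\<in>atlas M. \<forall>d\<in>atlas M. smooth_on (snd c ` (fst c \<inter> fst d)) (snd d \<circ> chart_inv c))"

lemma manifold_smooth_atlas: "manifold M \<Longrightarrow> smooth_atlas M"
  by (simp add: manifold_def smooth_atlas_def charted_def)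

lemma smooth_atlas_charted: "smooth_atlas M \<Longrightarrow> charted M"
  by (simp add: smooth_atlas_def)

lemma charted_chart: "charted M \<Longrightarrow> c \<in> atlas M \<Longrightarrow> is_chart (mtop M) c"
  by (simp add: charted_def)

lemma chart_at_props:
  assumes "charted M" "p \<in> points M"
  shows chart_at_atlas: "chart_at M p \<in> atlas M"
    and chart_at_mem: "p \<in> fst (chart_at M p)"
    and chart_at_chart: "is_chart (mtop M) (chart_at M p)"
proof -
  have "\<exists>c. c \<in> atlas M \<and> p \<in> fst c"
    using assms unfolding charted_def by blast
  then have "chart_at M p \<in> atlas M \<and> p \<in> fst (chart_at M p)"
    unfolding chart_at_def by (rule someI_ex)
  then show "chart_at M p \<in> atlas M" "p \<in> fst (chart_at M p)" "is_chart (mtop M) (chart_at M p)"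
    using assms charted_chart by blast+
qed

section \<open>Smooth parametrisations and their velocities\<close>

text \<open>
  A tangent vector is a coordinate vector in a chosen chart, and the charts chosen for products and
  open subsets are unrelated to those of the spaces that they are made from. Maps out of model spaces
  avoid the resulting changes of coordinates, since only the chart of the target matters.
\<close>

definition psmooth :: "'a::model_space set \<Rightarrow> ('p, 'e::model_space) mfd \<Rightarrow> ('a \<Rightarrow> 'p) \<Rightarrow> bool"
  where "psmooth S M \<phi> \<longleftrightarrow> open S \<and> continuous_map (top_of_set S) (mtop M) \<phi> \<and>
    (\<forall>d\<in>atlas M. smooth_on {x \<in> S. \<phi> x \<in> fst d} (snd d \<circ> \<phi>))"

definition vel :: "('p, 'e::model_space) mfd \<Rightarrow> ('a::model_space \<Rightarrow> 'p) \<Rightarrow> 'a \<Rightarrow> 'a \<Rightarrow> 'e"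
  where "vel M \<phi> x = frechet_derivative (snd (chart_at M (\<phi> x)) \<circ> \<phi>) (at x)"

lemma psmooth_open: "psmooth S M \<phi> \<Longrightarrow> open S"
  by (simp add: psmooth_def)

lemma psmooth_continuous: "psmooth S M \<phi> \<Longrightarrow> continuous_map (top_of_set S) (mtop M) \<phi>"
  by (simp add: psmooth_def)

lemma psmooth_smooth_on: "psmooth S M \<phi> \<Longrightarrow> d \<in> atlas M \<Longrightarrow> smooth_on {x \<in> S. \<phi> x \<in> fst d} (snd d \<circ> \<phi>)"
  by (simp add: psmooth_def)

lemma psmooth_points: "psmooth S M \<phi> \<Longrightarrow> x \<in> S \<Longrightarrow> \<phi> x \<in> points M"
  using continuous_map_image_subset_topspace[of "top_of_set S" "mtop M" \<phi>] by (auto simp: psmooth_def)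

lemma psmooth_open_preimage:
  assumes "psmooth S M \<phi>" "openin (mtop M) U"
  shows "open {x \<in> S. \<phi> x \<in> U}"
proof -
  have "openin (top_of_set S) {x \<in> S. \<phi> x \<in> U}"
    using openin_continuous_map_preimage[OF psmooth_continuous[OF assms(1)] assms(2)] by simp
  then show ?thesis
    using psmooth_open[OF assms(1)] by (meson openin_open_trans)
qed

lemma psmooth_open_chart:
  "charted M \<Longrightarrow> psmooth S M \<phi> \<Longrightarrow> c \<in> atlas M \<Longrightarrow> open {x \<in> S. \<phi> x \<in> fst c}"
  by (rule psmooth_open_preimage[OF _ chart_open[OF charted_chart]])

lemma psmooth_subset:
  assumes "psmooth S M \<phi>" "T \<subseteq> S" "open T"
  shows "psmooth T M \<phi>"
  unfolding psmooth_def
proof (intro conjI ballI)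
  show "continuous_map (top_of_set T) (mtop M) \<phi>"
    using psmooth_continuous[OF assms(1)] assms(2) continuous_map_from_subtopology_mono by blast
  show "smooth_on {x \<in> T. \<phi> x \<in> fst d} (snd d \<circ> \<phi>)" if "d \<in> atlas M" for d
    by (rule smooth_on_subset[OF psmooth_smooth_on[OF assms(1) that]]) (use assms(2) in auto)
qed fact

lemma psmooth_cong:
  assumes "charted M" "psmooth S M \<phi>" "\<And>x. x \<in> S \<Longrightarrow> \<phi> x = \<eta> x"
  shows "psmooth S M \<eta>"
  unfolding psmooth_def
proof (intro conjI ballI)
  show "open S" using assms(2) by (rule psmooth_open)
  show "continuous_map (top_of_set S) (mtop M) \<eta>"
    by (rule continuous_map_eq[OF psmooth_continuous[OF assms(2)]]) (simp add: assms(3))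
  fix d assume d: "d \<in> atlas M"
  have "{x \<in> S. \<eta> x \<in> fst d} = {x \<in> S. \<phi> x \<in> fst d}" using assms(3) by auto
  moreover have "smooth_on {x \<in> S. \<phi> x \<in> fst d} (snd d \<circ> \<eta>)"
    by (rule smooth_on_congI[OF psmooth_smooth_on[OF assms(2) d] psmooth_open_chart[OF assms(1,2) d]])
      (use assms(3) in auto)
  ultimately show "smooth_on {x \<in> S. \<eta> x \<in> fst d} (snd d \<circ> \<eta>)" by simp
qed

lemma psmooth_local:
  assumes "open S" and loc: "\<And>x. x \<in> S \<Longrightarrow> \<exists>T. open T \<and> x \<in> T \<and> psmooth (S \<inter> T) M \<phi>"
  shows "psmooth S M \<phi>"
  unfolding psmooth_def
proof (intro conjI ballI)
  obtain T where T: "\<And>x. x \<in> S \<Longrightarrow> open (T x) \<and> x \<in> T x \<and> psmooth (S \<inter> T x) M \<phi>"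
    using loc by metis
  show "continuous_map (top_of_set S) (mtop M) \<phi>"
  proof (rule pasting_lemma[where I = S and T = "\<lambda>x. S \<inter> T x" and f = "\<lambda>_. \<phi>"])
    fix x assume x: "x \<in> S"
    show "openin (top_of_set S) (S \<inter> T x)"
      using T[OF x] by (simp add: openin_open_Int)
    show "continuous_map (subtopology (top_of_set S) (S \<inter> T x)) (mtop M) \<phi>"
      using T[OF x] psmooth_continuous by (metis Int_assoc inf.idem subtopology_subtopology)
  qed (use T in auto)
  fix d assume d: "d \<in> atlas M"
  show "smooth_on {x \<in> S. \<phi> x \<in> fst d} (snd d \<circ> \<phi>)"
  proof (rule smooth_on_local)
    fix x assume "x \<in> {x \<in> S. \<phi> x \<in> fst d}"
    then have x: "x \<in> S" by simp
    have "smooth_on ({x \<in> S. \<phi> x \<in> fst d} \<inter> T x) (snd d \<circ> \<phi>)"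
      by (rule smooth_on_subset[OF psmooth_smooth_on[OF _ d, of "S \<inter> T x"]]) (use T[OF x] in auto)
    then show "\<exists>T. open T \<and> x \<in> T \<and> smooth_on ({x \<in> S. \<phi> x \<in> fst d} \<inter> T) (snd d \<circ> \<phi>)"
      using T[OF x] by blast
  qed
qed fact

lemma psmooth_reparam:
  assumes "charted M" "psmooth S M \<phi>" "open T" "smooth_on T f" "f ` T \<subseteq> S"
  shows "psmooth T M (\<lambda>x. \<phi> (f x))"
  unfolding psmooth_def
proof (intro conjI ballI)
  have f: "continuous_map (top_of_set T) (top_of_set S) f"
    using smooth_on_continuous[OF assms(4)] assms(5) by auto
  show c: "continuous_map (top_of_set T) (mtop M) (\<lambda>x. \<phi> (f x))"
    using continuous_map_compose[OF f psmooth_continuous[OF assms(2)]] by (simp add: comp_def)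
  fix d assume d: "d \<in> atlas M"
  have "openin (top_of_set T) {x \<in> T. \<phi> (f x) \<in> fst d}"
    using openin_continuous_map_preimage[OF c, of "fst d"] chart_open[OF charted_chart[OF assms(1) d]]
    by simp
  then have o: "open {x \<in> T. \<phi> (f x) \<in> fst d}"
    using assms(3) openin_open_trans by blast
  have "smooth_on {x \<in> T. \<phi> (f x) \<in> fst d} (\<lambda>x. (snd d \<circ> \<phi>) (f x))"
    by (rule smooth_on_compose[OF o _ smooth_on_subset[OF assms(4)] psmooth_smooth_on[OF assms(2) d]])
      (use assms(5) in auto)
  then show "smooth_on {x \<in> T. \<phi> (f x) \<in> fst d} (snd d \<circ> (\<lambda>x. \<phi> (f x)))"
    by (simp add: comp_def)
qed fact

lemma psmooth_has_derivative:
  assumes "charted M" "psmooth S M \<phi>" "x \<in> S" "d \<in> atlas M" "\<phi> x \<in> fst d"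
  shows "((snd d \<circ> \<phi>) has_derivative frechet_derivative (snd d \<circ> \<phi>) (at x)) (at x)"
  by (rule smooth_on_has_derivative[OF psmooth_smooth_on[OF assms(2,4)]]) (use assms in auto)

lemma psmooth_has_vel:
  assumes "charted M" "psmooth S M \<phi>" "x \<in> S"
  shows "((snd (chart_at M (\<phi> x)) \<circ> \<phi>) has_derivative vel M \<phi> x) (at x)"
  unfolding vel_def
  using psmooth_has_derivative[OF assms] chart_at_props[OF assms(1) psmooth_points[OF assms(2,3)]]
  by blast

lemma linear_vel: "charted M \<Longrightarrow> psmooth S M \<phi> \<Longrightarrow> x \<in> S \<Longrightarrow> linear (vel M \<phi> x)"
  using has_derivative_linear[OF psmooth_has_vel] .

lemma vel_eqI:
  assumes "((snd (chart_at M (\<phi> x)) \<circ> \<phi>) has_derivative D) (at x)"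
  shows "vel M \<phi> x = D"
  unfolding vel_def using frechet_derivative_at[OF assms] by simp

lemma vel_cong:
  fixes M :: "('p, 'e::model_space) mfd"
  assumes "open S" "x \<in> S" "\<And>y. y \<in> S \<Longrightarrow> \<phi> y = \<eta> y"
  shows "vel M \<phi> x = vel M \<eta> x"
proof -
  have "((snd d \<circ> \<phi>) has_derivative D) (at x) \<longleftrightarrow> ((snd d \<circ> \<eta>) has_derivative D) (at x)" 
    for d :: "('p, 'e) chart" and D
    using has_derivative_transform_within_open[OF _ assms(1,2), of "snd d \<circ> \<phi>" _ UNIV "snd d \<circ> \<eta>"]
      has_derivative_transform_within_open[OF _ assms(1,2), of "snd d \<circ> \<eta>" _ UNIV "snd d \<circ> \<phi>"]
      assms(3) by auto
  then show ?thesis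
    using assms(2,3) by (simp add: vel_def frechet_derivative_def)
qed

lemma vel_const: "vel M (\<lambda>x. p) x v = 0"
proof -
  have "vel M (\<lambda>x. p) x = (\<lambda>v. 0)"
    by (rule vel_eqI) (simp add: comp_def)
  then show ?thesis by simp
qed

lemma vel_reparam:
  assumes "charted M" "psmooth S M \<phi>" "f x \<in> S" "(f has_derivative D) (at x)"
  shows "vel M (\<lambda>x. \<phi> (f x)) x v = vel M \<phi> (f x) (D v)"
proof -
  have "vel M (\<lambda>x. \<phi> (f x)) x = (\<lambda>v. vel M \<phi> (f x) (D v))"
    using has_derivative_compose[OF assms(4) psmooth_has_vel[OF assms(1-3)]]
    by (intro vel_eqI) (simp add: comp_def)
  then show ?thesis by simp
qed

lemma psmooth_const:
  assumes "charted M" "p \<in> points M" "open S"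
  shows "psmooth S M (\<lambda>x. p)"
  using assms by (auto simp: psmooth_def comp_def)

lemma psmooth_chart_inv:
  assumes "smooth_atlas M" "c \<in> atlas M"
  shows "psmooth (snd c ` fst c) M (chart_inv c)"
  unfolding psmooth_def
proof (intro conjI ballI)
  have c: "is_chart (mtop M) c"
    using assms by (simp add: smooth_atlas_charted charted_chart)
  show "open (snd c ` fst c)" "continuous_map (top_of_set (snd c ` fst c)) (mtop M) (chart_inv c)"
    using c by (rule chart_open_image chart_inv_continuous)+
  fix d assume d: "d \<in> atlas M"
  have "{x \<in> snd c ` fst c. chart_inv c x \<in> fst d} = snd c ` (fst c \<inter> fst d)"
    by (auto simp: chart_inv_left[OF c])
  then show "smooth_on {x \<in> snd c ` fst c. chart_inv c x \<in> fst d} (snd d \<circ> chart_inv c)"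
    using assms d by (simp add: smooth_atlas_def)
qed

lemma vel_chart_inv:
  assumes "charted M" "p \<in> points M"
  shows "vel M (chart_inv (chart_at M p)) (snd (chart_at M p) p) v = v"
proof -
  let ?c = "chart_at M p"
  note c = chart_at_props[OF assms]
  have "((snd ?c \<circ> chart_inv ?c) has_derivative (\<lambda>v. v)) (at (snd ?c p))"
    by (rule has_derivative_transform_within_open[OF has_derivative_ident chart_open_image[OF c(3)]])
      (use c in \<open>auto simp: chart_inv_right\<close>)
  then have "vel M (chart_inv ?c) (snd ?c p) = (\<lambda>v. v)"
    by (intro vel_eqI) (simp add: chart_inv_left[OF c(3,2)])
  then show ?thesis by simp
qed

lemma differential_eq_vel:
  assumes "charted M" "p \<in> points M"
  shows "differential M N f p v = vel N (\<lambda>x. f (chart_inv (chart_at M p) x)) (snd (chart_at M p) p) v"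
  using chart_inv_left[OF chart_at_props(3,2)[OF assms]]
  by (simp add: differential_def vel_def comp_def)

lemma coord_vector_eq_vel:
  assumes "charted M" "c \<in> atlas M" "p \<in> fst c"
  shows "coord_vector M c p v = vel M (chart_inv c) (snd c p) v"
  using chart_inv_left[OF charted_chart[OF assms(1,2)] assms(3)]
  by (simp add: coord_vector_def vel_def)

text \<open>
  Near \<open>x\<close> the map is the inverse of the chart \<open>c\<close> after its own coordinate expression in \<open>c\<close>.
\<close>

lemma vel_coord_vector:
  assumes "smooth_atlas M" "psmooth S M \<phi>" "x \<in> S" "c \<in> atlas M" "\<phi> x \<in> fst c"
  shows "vel M \<phi> x v = coord_vector M c (\<phi> x) (frechet_derivative (snd c \<circ> \<phi>) (at x) v)"
proof -
  note ch = smooth_atlas_charted[OF assms(1)]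
  have "vel M \<phi> x v = vel M (\<lambda>y. chart_inv c ((snd c \<circ> \<phi>) y)) x v"
    by (subst vel_cong[OF psmooth_open_chart[OF ch assms(2,4)]])
      (use assms chart_inv_left[OF charted_chart[OF ch assms(4)]] in auto)
  also have "\<dots> = vel M (chart_inv c) ((snd c \<circ> \<phi>) x) (frechet_derivative (snd c \<circ> \<phi>) (at x) v)"
    by (rule vel_reparam[OF ch psmooth_chart_inv[OF assms(1,4)] _
          psmooth_has_derivative[OF ch assms(2-5)]]) (use assms in auto)
  finally show ?thesis
    by (simp add: coord_vector_eq_vel[OF ch assms(4,5)])
qed

lemma psmooth_smooth_map:
  assumes "charted M" "smooth_map M N f" "psmooth S M \<phi>" and N: "charted N"
  shows "psmooth S N (\<lambda>x. f (\<phi> x))"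
  unfolding psmooth_def
proof (intro conjI ballI)
  show "open S" using assms(3) by (rule psmooth_open)
  have fc: "continuous_map (mtop M) (mtop N) f"
    using assms(2) by (simp add: smooth_map_def)
  show cont: "continuous_map (top_of_set S) (mtop N) (\<lambda>x. f (\<phi> x))"
    using continuous_map_compose[OF psmooth_continuous[OF assms(3)] fc] by (simp add: comp_def)
  fix d assume d: "d \<in> atlas N"
  let ?V = "{x \<in> S. f (\<phi> x) \<in> fst d}"
  show "smooth_on ?V (snd d \<circ> (\<lambda>x. f (\<phi> x)))"
  proof (rule smooth_on_local)
    fix x assume x: "x \<in> ?V"
    have p: "\<phi> x \<in> points M" using psmooth_points[OF assms(3)] x by auto
    define c where "c = chart_at M (\<phi> x)"
    note c = chart_at_props[OF assms(1) p, folded c_def]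
    let ?W = "{y \<in> S. \<phi> y \<in> fst c}"
    have oW: "open ?W" by (rule psmooth_open_chart[OF assms(1,3) c(1)])
    have "openin (top_of_set S) ?V"
      using openin_continuous_map_preimage[OF cont, of "fst d"] chart_open[OF charted_chart[OF N d]]
      by simp
    then have oV: "open ?V"
      using psmooth_open[OF assms(3)] openin_open_trans by blast
    have "smooth_on (?V \<inter> ?W) (\<lambda>y. (snd d \<circ> f \<circ> chart_inv c) ((snd c \<circ> \<phi>) y))"
    proof (rule smooth_on_compose[where f = "snd c \<circ> \<phi>" and g = "snd d \<circ> f \<circ> chart_inv c"])
      show "smooth_on (snd c ` {p \<in> fst c. f p \<in> fst d}) (snd d \<circ> f \<circ> chart_inv c)"
        using assms(2) c(1) d by (simp add: smooth_map_def)
      show "smooth_on (?V \<inter> ?W) (snd c \<circ> \<phi>)"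
        by (rule smooth_on_subset[OF psmooth_smooth_on[OF assms(3) c(1)]]) auto
    qed (use oV oW in auto)
    then have "smooth_on (?V \<inter> ?W) (snd d \<circ> (\<lambda>x. f (\<phi> x)))"
      by (rule smooth_on_congI[OF _ open_Int[OF oV oW]]) (simp add: chart_inv_left[OF c(3)])
    then show "\<exists>T. open T \<and> x \<in> T \<and> smooth_on (?V \<inter> T) (snd d \<circ> (\<lambda>x. f (\<phi> x)))"
      using oW x c(2) by blast
  qed
qed

lemma psmooth_of_smooth_map:
  assumes "charted M" "smooth_map M N f" "c \<in> atlas M"
  shows "psmooth (snd c ` fst c) N (\<lambda>x. f (chart_inv c x))"
  unfolding psmooth_def
proof (intro conjI ballI)
  have c: "is_chart (mtop M) c"
    using assms by (simp add: charted_chart)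
  show "open (snd c ` fst c)"
    using c by (rule chart_open_image)
  have "continuous_map (mtop M) (mtop N) f"
    using assms(2) by (simp add: smooth_map_def)
  from continuous_map_compose[OF chart_inv_continuous[OF c] this]
  show "continuous_map (top_of_set (snd c ` fst c)) (mtop N) (\<lambda>x. f (chart_inv c x))"
    by (simp add: comp_def)
  fix d assume d: "d \<in> atlas N"
  have "{x \<in> snd c ` fst c. f (chart_inv c x) \<in> fst d} = snd c ` {p \<in> fst c. f p \<in> fst d}"
    by (auto simp: chart_inv_left[OF c])
  then show "smooth_on {x \<in> snd c ` fst c. f (chart_inv c x) \<in> fst d} (snd d \<circ> (\<lambda>x. f (chart_inv c x)))"
    using assms(2,3) d by (simp add: smooth_map_def comp_assoc) (simp add: comp_def)
qed

lemma smooth_mapI: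
  assumes M: "charted M"
    and f: "\<And>c. c \<in> atlas M \<Longrightarrow> psmooth (snd c ` fst c) N (\<lambda>x. f (chart_inv c x))"
  shows "smooth_map M N f"
  unfolding smooth_map_def
proof (intro conjI ballI)
  show "continuous_map (mtop M) (mtop N) f"
  proof (rule pasting_lemma[where I = "atlas M" and T = fst and f = "\<lambda>_. f"])
    fix c assume c: "c \<in> atlas M"
    note ch = charted_chart[OF M c]
    show "openin (mtop M) (fst c)" using ch by (rule chart_open)
    have "continuous_map (subtopology (mtop M) (fst c)) (top_of_set (snd c ` fst c)) (snd c)"
      using chart_continuous[OF ch] by (auto simp: continuous_map_in_subtopology)
    from continuous_map_compose[OF this psmooth_continuous[OF f[OF c]]]
    show "continuous_map (subtopology (mtop M) (fst c)) (mtop N) f"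
      by (rule continuous_map_eq) (simp add: chart_inv_left[OF ch])
  next
    show "\<exists>c. c \<in> atlas M \<and> p \<in> fst c \<and> f p = f p" if "p \<in> points M" for p
      using that M unfolding charted_def by blast
  qed simp
  fix c d assume cd: "c \<in> atlas M" "d \<in> atlas N"
  have "{x \<in> snd c ` fst c. f (chart_inv c x) \<in> fst d} = snd c ` {p \<in> fst c. f p \<in> fst d}"
    by (auto simp: chart_inv_left[OF charted_chart[OF M cd(1)]])
  then show "smooth_on (snd c ` {p \<in> fst c. f p \<in> fst d}) (snd d \<circ> f \<circ> chart_inv c)"
    using psmooth_smooth_on[OF f[OF cd(1)] cd(2)] by (simp add: comp_def)
qed

text \<open>
  Smoothness of a formula in smooth maps is shown by substituting a parametrisation for the
  variable.
\<close>

lemma smooth_map_psmoothI: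
  fixes M :: "('p, 'e::model_space) mfd"
  assumes "smooth_atlas M"
    and "\<And>S (\<phi> :: 'e \<Rightarrow> 'p). psmooth S M \<phi> \<Longrightarrow> psmooth S N (\<lambda>x. f (\<phi> x))"
  shows "smooth_map M N f"
  using smooth_mapI[OF smooth_atlas_charted[OF assms(1)]] assms(2) psmooth_chart_inv[OF assms(1)]
  by blast

lemma smooth_map_compose:
  assumes "charted M" "charted N" "charted P" "smooth_map M N f" "smooth_map N P g"
  shows "smooth_map M P (\<lambda>x. g (f x))"
  by (rule smooth_mapI[OF assms(1)], rule psmooth_smooth_map[OF assms(2,5) _ assms(3)],
      rule psmooth_of_smooth_map[OF assms(1,4)])

text \<open>
  Near \<open>x\<close> the composite factors through the chart at \<open>\<phi> x\<close> in which the differential is computed.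
\<close>

lemma vel_smooth_map:
  assumes M: "charted M" and N: "charted N" and f: "smooth_map M N f" and \<phi>: "psmooth S M \<phi>" and x: "x \<in> S"
  shows "vel N (\<lambda>x. f (\<phi> x)) x v = differential M N f (\<phi> x) (vel M \<phi> x v)"
proof -
  note p = psmooth_points[OF \<phi> x]
  define c where "c = chart_at M (\<phi> x)"
  note c = chart_at_props[OF M p, folded c_def]
  have "vel N (\<lambda>x. f (\<phi> x)) x v = vel N (\<lambda>y. f (chart_inv c ((snd c \<circ> \<phi>) y))) x v"
    by (subst vel_cong[OF psmooth_open_chart[OF M \<phi> c(1)]])
      (use x c chart_inv_left[OF c(3)] in auto)
  also have "\<dots> = vel N (\<lambda>y. f (chart_inv c y)) ((snd c \<circ> \<phi>) x) (vel M \<phi> x v)"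
    unfolding vel_def[of M] c_def[symmetric]
    by (rule vel_reparam[OF N psmooth_of_smooth_map[OF M f c(1)] _
          psmooth_has_derivative[OF M \<phi> x c(1,2)]]) (use c in auto)
  also have "\<dots> = differential M N f (\<phi> x) (vel M \<phi> x v)"
    by (simp add: differential_eq_vel[OF M p] c_def)
  finally show ?thesis .
qed

lemma differential_compose:
  assumes "charted M" "charted N" "charted P" "smooth_map M N f" "smooth_map N P g" "p \<in> points M"
  shows "differential M P (\<lambda>x. g (f x)) p v = differential N P g (f p) (differential M N f p v)"
proof -
  define c where "c = chart_at M p"
  note c = chart_at_props[OF assms(1,6), folded c_def]
  have "vel P (\<lambda>x. g (f (chart_inv c x))) (snd c p) v =
      differential N P g (f (chart_inv c (snd c p))) (vel N (\<lambda>x. f (chart_inv c x)) (snd c p) v)"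
    by (rule vel_smooth_map[OF assms(2,3,5) psmooth_of_smooth_map[OF assms(1,4) c(1)]]) (use c in auto)
  then show ?thesis
    by (simp add: differential_eq_vel[OF assms(1,6)] c_def[symmetric] chart_inv_left[OF c(3,2)])
qed

lemma differential_cong:
  fixes M :: "('p, 'e::model_space) mfd" and N :: "('q, 'f::model_space) mfd"
  assumes "charted M" "p \<in> points M" "\<And>q. q \<in> points M \<Longrightarrow> f q = g q"
  shows "differential M N f p v = differential M N g p v"
proof -
  note c = chart_at_props[OF assms(1,2)]
  have "fst (chart_at M p) \<subseteq> points M"
    using chart_open[OF c(3)] by (rule openin_subset)
  then have "vel N (\<lambda>x. f (chart_inv (chart_at M p) x)) (snd (chart_at M p) p) =
      vel N (\<lambda>x. g (chart_inv (chart_at M p) x)) (snd (chart_at M p) p)"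
    using chart_inv_into[of _ "chart_at M p"] c(2) assms(3)
    by (intro vel_cong[OF chart_open_image[OF c(3)]]) auto
  then show ?thesis
    by (simp add: differential_eq_vel[OF assms(1,2)])
qed

text \<open>
  All intertwining properties of differentials below (with translations, orbit maps, group actions
  and homomorphisms) come from a commuting square of maps.
\<close>

lemma differential_commute:
  assumes M: "charted M" and "charted N" "charted N'" and Q: "charted Q"
    and fg: "smooth_map M N f" "smooth_map N Q g" and hk: "smooth_map M N' h" "smooth_map N' Q k"
    and eq: "\<And>q. q \<in> points M \<Longrightarrow> g (f q) = k (h q)" and p: "p \<in> points M"
  shows "differential N Q g (f p) (differential M N f p v) =
    differential N' Q k (h p) (differential M N' h p v)"
  unfolding differential_compose[OF M assms(2) Q fg p, symmetric]
    differential_compose[OF M assms(3) Q hk p, symmetric]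
  by (rule differential_cong[OF M p eq])

lemma linear_differential:
  assumes "charted M" "charted N" "smooth_map M N f" "p \<in> points M"
  shows "linear (differential M N f p)"
proof -
  define c where "c = chart_at M p"
  note c = chart_at_props[OF assms(1,4), folded c_def]
  have "linear (vel N (\<lambda>x. f (chart_inv c x)) (snd c p))"
    by (rule linear_vel[OF assms(2) psmooth_of_smooth_map[OF assms(1,3) c(1)]]) (use c in auto)
  then show ?thesis
    by (simp add: differential_eq_vel[OF assms(1,4), abs_def] c_def[symmetric])
qed

lemma differential_id:
  assumes "charted M" "p \<in> points M"
  shows "differential M M (\<lambda>x. x) p v = v"
  by (simp add: differential_eq_vel[OF assms] vel_chart_inv[OF assms])

lemma differential_const:
  fixes M :: "('p, 'e::model_space) mfd" and N :: "('q, 'f::model_space) mfd"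
  shows "charted M \<Longrightarrow> p \<in> points M \<Longrightarrow> differential M N (\<lambda>x. q) p v = 0"
  by (simp add: differential_eq_vel vel_const)

text \<open>The inverse of the chosen chart has every coordinate vector as a velocity.\<close>

lemma tangent_vector_vel:
  fixes M :: "('p, 'e::model_space) mfd"
  assumes "smooth_atlas M" "p \<in> points M"
  obtains S and \<phi> :: "'e \<Rightarrow> 'p" and x
  where "psmooth S M \<phi>" "x \<in> S" "\<phi> x = p" "\<And>u. vel M \<phi> x u = u"
proof -
  note ch = smooth_atlas_charted[OF assms(1)]
  note c = chart_at_props[OF ch assms(2)]
  show ?thesis
    by (rule that[OF psmooth_chart_inv[OF assms(1) c(1)]])
      (use c vel_chart_inv[OF ch assms(2)] in \<open>auto simp: chart_inv_left\<close>)
qed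

section \<open>Products, open subsets and model spaces as manifolds\<close>

lemma charted_model: "charted (model_mfd :: ('e::model_space, 'e) mfd)"
  by (auto simp: charted_def model_mfd_def is_chart_def)

lemma psmooth_model: "psmooth S model_mfd f \<longleftrightarrow> open S \<and> smooth_on S f"
proof -
  have "psmooth S model_mfd f \<longleftrightarrow> open S \<and> continuous_on S f \<and> smooth_on S f"
    by (simp add: psmooth_def model_mfd_def comp_def)
  then show ?thesis using smooth_on_continuous by blast
qed

lemma smooth_atlas_psmooth:
  "charted M \<Longrightarrow> (\<And>c. c \<in> atlas M \<Longrightarrow> psmooth (snd c ` fst c) M (chart_inv c)) \<Longrightarrow> smooth_atlas M"
  unfolding smooth_atlas_def
proof (intro conjI ballI)
  fix c d assume M: "charted M" "\<And>c. c \<in> atlas M \<Longrightarrow> psmooth (snd c ` fst c) M (chart_inv c)"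
    and cd: "c \<in> atlas M" "d \<in> atlas M"
  have "snd c ` (fst c \<inter> fst d) = {x \<in> snd c ` fst c. chart_inv c x \<in> fst d}"
    by (auto simp: chart_inv_left[OF charted_chart[OF M(1) cd(1)]])
  then show "smooth_on (snd c ` (fst c \<inter> fst d)) (snd d \<circ> chart_inv c)"
    using psmooth_smooth_on[OF M(2)[OF cd(1)] cd(2)] by simp
qed

lemma smooth_atlas_model: "smooth_atlas (model_mfd :: ('e::model_space, 'e) mfd)"
proof (rule smooth_atlas_psmooth[OF charted_model])
  fix c :: "('e, 'e) chart" assume "c \<in> atlas model_mfd"
  then have "c = (UNIV, id)" by (simp add: model_mfd_def)
  then show "psmooth (snd c ` fst c) model_mfd (chart_inv c)"
    by (simp add: psmooth_model chart_inv_def smooth_on_id inv_id id_def del: inv_into_id)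
qed

lemma points_open_sub: "points (open_sub M U) = points M \<inter> U"
  by (simp add: open_sub_def)

lemma is_chart_restrict:
  assumes "is_chart T c" "openin T U"
  shows "is_chart (subtopology T U) (fst c \<inter> U, snd c)"
  unfolding is_chart_def
proof (intro conjI)
  have h: "homeomorphic_map (subtopology T (fst c)) (top_of_set (snd c ` fst c)) (snd c)"
    using assms by (auto simp: is_chart_def)
  have U: "openin (subtopology T (fst c)) (fst c \<inter> U)"
    using assms(2) by (metis Int_commute openin_subtopology_Int)
  have "openin (top_of_set (snd c ` fst c)) (snd c ` (fst c \<inter> U))"
    using homeomorphic_imp_open_map[OF h] U by (auto simp: open_map_def)
  then show "open (snd (fst c \<inter> U, snd c) ` fst (fst c \<inter> U, snd c))"
    using openin_open_trans[OF _ chart_open_image[OF assms(1)]] by simp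
  show "openin (subtopology T U) (fst (fst c \<inter> U, snd c))"
    using chart_open[OF assms(1)] by (simp add: openin_subtopology_Int)
  have ts: "topspace (subtopology T (fst c)) = fst c"
    using openin_subset[OF chart_open[OF assms(1)]] by (simp add: inf_absorb2)
  have "homeomorphic_map (subtopology (subtopology T (fst c)) (fst c \<inter> U))
      (subtopology (top_of_set (snd c ` fst c)) (snd c ` (fst c \<inter> U))) (snd c)"
    by (rule homeomorphic_map_subtopologies[OF h])
      (use chart_inj[OF assms(1)] ts in \<open>auto simp: inj_on_def\<close>)
  moreover have "subtopology (subtopology T (fst c)) (fst c \<inter> U) = 
      subtopology (subtopology T U) (fst (fst c \<inter> U, snd c))"
    by (simp add: subtopology_subtopology Int_ac)
  moreover have "subtopology (top_of_set (snd c ` fst c)) (snd c ` (fst c \<inter> U)) = 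
      top_of_set (snd (fst c \<inter> U, snd c) ` fst (fst c \<inter> U, snd c))"
    by (simp add: subtopology_subtopology image_mono inf_absorb2)
  ultimately show "homeomorphic_map (subtopology (subtopology T U) (fst (fst c \<inter> U, snd c)))
     (top_of_set (snd (fst c \<inter> U, snd c) ` fst (fst c \<inter> U, snd c))) (snd (fst c \<inter> U, snd c))"
    by simp
qed

lemma charted_open_sub:
  assumes "charted M" "openin (mtop M) U"
  shows "charted (open_sub M U)"
  using assms is_chart_restrict[OF _ assms(2)] openin_subset[OF assms(2)]
  unfolding charted_def open_sub_def by auto

lemma psmooth_open_sub:
  assumes "openin (mtop M) U"
  shows "psmooth S (open_sub M U) \<phi> \<longleftrightarrow> psmooth S M \<phi> \<and> \<phi> ` S \<subseteq> U"
proof -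
  have "{x \<in> S. \<phi> x \<in> fst c \<inter> U} = {x \<in> S. \<phi> x \<in> fst c}" if "\<phi> ` S \<subseteq> U" for c :: "('a, 'b) chart"
    using that by auto
  then have "(\<forall>c\<in>atlas (open_sub M U). smooth_on {x \<in> S. \<phi> x \<in> fst c} (snd c \<circ> \<phi>)) \<longleftrightarrow>
      (\<forall>c\<in>atlas M. smooth_on {x \<in> S. \<phi> x \<in> fst c} (snd c \<circ> \<phi>))" if "\<phi> ` S \<subseteq> U"
    using that by (simp add: open_sub_def)
  then show ?thesis
    by (auto simp: psmooth_def open_sub_def continuous_map_in_subtopology)
qed

lemma chart_inv_restrict:
  assumes "is_chart T c" "x \<in> snd c ` (fst c \<inter> U)"
  shows "chart_inv (fst c \<inter> U, snd c) x = chart_inv c x"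
proof -
  from assms(2) obtain p where p: "p \<in> fst c \<inter> U" "x = snd c p" by blast
  have "inj_on (snd c) (fst c \<inter> U)"
    using chart_inj[OF assms(1)] by (rule inj_on_subset) simp
  then show ?thesis
    using p chart_inj[OF assms(1)] by (simp add: chart_inv_def)
qed

lemma smooth_atlas_open_sub:
  assumes "smooth_atlas M" "openin (mtop M) U"
  shows "smooth_atlas (open_sub M U)"
proof (rule smooth_atlas_psmooth)
  note M = smooth_atlas_charted[OF assms(1)]
  show "charted (open_sub M U)" by (rule charted_open_sub[OF M assms(2)])
  fix c' assume c': "c' \<in> atlas (open_sub M U)"
  then obtain c where c: "c \<in> atlas M" "c' = (fst c \<inter> U, snd c)"
    by (auto simp: open_sub_def)
  note ch = charted_chart[OF M c(1)]
  have "psmooth (snd c ` (fst c \<inter> U)) M (chart_inv c')"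
  proof (rule psmooth_cong[OF M psmooth_subset[OF psmooth_chart_inv[OF assms(1) c(1)]]])
    show "open (snd c ` (fst c \<inter> U))"
      using chart_open_image[OF is_chart_restrict[OF ch assms(2)]] by simp
  qed (auto simp: c(2) chart_inv_restrict[OF ch])
  then show "psmooth (snd c' ` fst c') (open_sub M U) (chart_inv c')"
    using c(2) chart_inv_into[of _ c'] by (auto simp: psmooth_open_sub[OF assms(2)])
qed

lemma smooth_map_open_sub_model:
  fixes \<phi> :: "'a::model_space \<Rightarrow> 'p"
  assumes "open S" "charted M"
  shows "smooth_map (open_sub model_mfd S) M \<phi> \<longleftrightarrow> psmooth S M \<phi>"
proof
  have S: "openin (mtop (model_mfd :: ('a, 'a) mfd)) S"
    using assms(1) by (simp add: model_mfd_def)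
  note ch = smooth_atlas_open_sub[OF smooth_atlas_model S]
  {
    assume "smooth_map (open_sub model_mfd S) M \<phi>"
    moreover have "psmooth S (open_sub model_mfd S) (\<lambda>x. x)"
      using assms(1) by (simp add: psmooth_open_sub[OF S] psmooth_model smooth_on_id)
    ultimately show "psmooth S M \<phi>"
      using psmooth_smooth_map[OF smooth_atlas_charted[OF ch]] assms(2) by blast
  next
    assume \<phi>: "psmooth S M \<phi>"
    show "smooth_map (open_sub model_mfd S) M \<phi>"
    proof (rule smooth_map_psmoothI[OF ch])
      fix T and f :: "'a \<Rightarrow> 'a" assume "psmooth T (open_sub model_mfd S) f"
      then show "psmooth T M (\<lambda>x. \<phi> (f x))"
        by (intro psmooth_reparam[OF assms(2) \<phi>])
          (auto simp: psmooth_open_sub[OF S] psmooth_model)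
    qed
  }
qed

lemma points_prod_mfd: "points (prod_mfd M N) = points M \<times> points N"
  by (simp add: prod_mfd_def)

lemma is_chart_prod:
  assumes "is_chart T c" "is_chart T' d"
  shows "is_chart (prod_topology T T') (fst c \<times> fst d, map_prod (snd c) (snd d))"
proof -
  have im: "map_prod (snd c) (snd d) ` (fst c \<times> fst d) = (snd c ` fst c) \<times> (snd d ` fst d)"
    by force
  obtain g h where
    "homeomorphic_maps (subtopology T (fst c)) (top_of_set (snd c ` fst c)) (snd c) g"
    "homeomorphic_maps (subtopology T' (fst d)) (top_of_set (snd d ` fst d)) (snd d) h"
    using assms unfolding is_chart_def homeomorphic_map_maps by blast
  then have "homeomorphic_maps (prod_topology (subtopology T (fst c)) (subtopology T' (fst d)))
      (prod_topology (top_of_set (snd c ` fst c)) (top_of_set (snd d ` fst d)))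
      (\<lambda>(x, y). (snd c x, snd d y)) (\<lambda>(x, y). (g x, h y))"
    by (simp only: homeomorphic_maps_prod simp_thms)
  then have "homeomorphic_map (prod_topology (subtopology T (fst c)) (subtopology T' (fst d)))
      (prod_topology (top_of_set (snd c ` fst c)) (top_of_set (snd d ` fst d)))
      (\<lambda>(x, y). (snd c x, snd d y))"
    using homeomorphic_map_maps by blast
  moreover have "(\<lambda>(x, y). (snd c x, snd d y)) = map_prod (snd c) (snd d)"
    by auto
  ultimately show ?thesis
    using assms
    by (simp add: is_chart_def im openin_prod_Times_iff open_Times subtopology_Times[symmetric]
        euclidean_product_topology)
qed

lemma atlas_prod_mfdE:
  assumes "e \<in> atlas (prod_mfd M N)"
  obtains c d where "c \<in> atlas M" "d \<in> atlas N" "e = (fst c \<times> fst d, map_prod (snd c) (snd d))"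
  using assms by (auto simp: prod_mfd_def)

lemma atlas_prod_mfdI:
  "c \<in> atlas M \<Longrightarrow> d \<in> atlas N \<Longrightarrow> (fst c \<times> fst d, map_prod (snd c) (snd d)) \<in> atlas (prod_mfd M N)"
  unfolding prod_mfd_def by (simp, rule image_eqI[of _ _ "(c, d)"]) simp_all

lemma charted_prod:
  assumes "charted M" "charted N"
  shows "charted (prod_mfd M N)"
  unfolding charted_def
proof (intro conjI ballI)
  show "is_chart (mtop (prod_mfd M N)) e" if "e \<in> atlas (prod_mfd M N)" for e
  proof -
    from that obtain c d where "c \<in> atlas M" "d \<in> atlas N"
      "e = (fst c \<times> fst d, map_prod (snd c) (snd d))"
      by (rule atlas_prod_mfdE)
    then show ?thesis
      using is_chart_prod[OF charted_chart[OF assms(1)] charted_chart[OF assms(2)]]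
      by (simp add: prod_mfd_def)
  qed
  have "(\<Union>e\<in>atlas (prod_mfd M N). fst e) = (\<Union>c\<in>atlas M. fst c) \<times> (\<Union>d\<in>atlas N. fst d)"
    by (force simp: prod_mfd_def)
  then show "(\<Union>e\<in>atlas (prod_mfd M N). fst e) = points (prod_mfd M N)"
    using assms by (simp add: charted_def points_prod_mfd)
qed

lemma psmooth_Pair:
  assumes M: "charted M" "psmooth S M \<phi>" and N: "charted N" "psmooth S N \<eta>"
  shows "psmooth S (prod_mfd M N) (\<lambda>x. (\<phi> x, \<eta> x))"
  unfolding psmooth_def
proof (intro conjI ballI)
  show "open S" using M(2) by (rule psmooth_open)
  show "continuous_map (top_of_set S) (mtop (prod_mfd M N)) (\<lambda>x. (\<phi> x, \<eta> x))"
    using psmooth_continuous[OF M(2)] psmooth_continuous[OF N(2)]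
    by (simp add: prod_mfd_def continuous_map_pairedI)
  fix e assume "e \<in> atlas (prod_mfd M N)"
  then obtain c d where cd: "c \<in> atlas M" "d \<in> atlas N" "e = (fst c \<times> fst d, map_prod (snd c) (snd d))"
    by (rule atlas_prod_mfdE)
  let ?V = "{x \<in> S. \<phi> x \<in> fst c} \<inter> {x \<in> S. \<eta> x \<in> fst d}"
  have "open ?V"
    by (intro open_Int psmooth_open_chart[OF M cd(1)] psmooth_open_chart[OF N cd(2)])
  then have "smooth_on ?V (\<lambda>x. ((snd c \<circ> \<phi>) x, (snd d \<circ> \<eta>) x))"
    using smooth_on_subset[OF psmooth_smooth_on[OF M(2) cd(1)], of ?V]
      smooth_on_subset[OF psmooth_smooth_on[OF N(2) cd(2)], of ?V]
    by (intro smooth_on_Pair) blast+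
  moreover have "?V = {x \<in> S. (\<phi> x, \<eta> x) \<in> fst e}" using cd(3) by auto
  ultimately show "smooth_on {x \<in> S. (\<phi> x, \<eta> x) \<in> fst e} (snd e \<circ> (\<lambda>x. (\<phi> x, \<eta> x)))"
    by (simp add: cd(3) comp_def)
qed

text \<open>
  If the values stay in one chart, the coordinate expression in this chart suffices.
\<close>

lemma psmooth_in_chart:
  assumes M: "smooth_atlas M" and c: "c \<in> atlas M"
    and S: "open S" "smooth_on S (\<lambda>x. snd c (\<phi> x))" "\<And>x. x \<in> S \<Longrightarrow> \<phi> x \<in> fst c"
  shows "psmooth S M \<phi>"
proof (rule psmooth_cong)
  note ch = smooth_atlas_charted[OF M]
  show "charted M" by (rule ch)
  show "psmooth S M (\<lambda>x. chart_inv c (snd c (\<phi> x)))"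
    by (rule psmooth_reparam[OF ch psmooth_chart_inv[OF M c] S(1,2)]) (use S(3) in auto)
  show "chart_inv c (snd c (\<phi> x)) = \<phi> x" if "x \<in> S" for x
    by (rule chart_inv_left[OF charted_chart[OF ch c] S(3)[OF that]])
qed

lemma psmooth_fst_snd:
  fixes M :: "('p, 'e::model_space) mfd" and N :: "('q, 'f::model_space) mfd"
  assumes "smooth_atlas M" "smooth_atlas N" "psmooth S (prod_mfd M N) \<phi>"
  shows psmooth_fst: "psmooth S M (\<lambda>x. fst (\<phi> x))" and psmooth_snd: "psmooth S N (\<lambda>x. snd (\<phi> x))"
proof -
  note ch = assms(1,2)[THEN smooth_atlas_charted]
  have "\<exists>T. open T \<and> x \<in> T \<and> psmooth (S \<inter> T) M (\<lambda>x. fst (\<phi> x)) \<and> psmooth (S \<inter> T) N (\<lambda>x. snd (\<phi> x))"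
    if x: "x \<in> S" for x
  proof -
    have "fst (\<phi> x) \<in> points M" "snd (\<phi> x) \<in> points N"
      using psmooth_points[OF assms(3) x] by (auto simp: points_prod_mfd)
    note c = chart_at_props[OF ch(1) this(1)] and d = chart_at_props[OF ch(2) this(2)]
    let ?c = "chart_at M (fst (\<phi> x))" and ?d = "chart_at N (snd (\<phi> x))"
    let ?T = "{y \<in> S. \<phi> y \<in> fst ?c \<times> fst ?d}"
    note e = atlas_prod_mfdI[OF c(1) d(1)]
    have T: "open ?T" "x \<in> ?T" "S \<inter> ?T = ?T"
      using psmooth_open_chart[OF charted_prod[OF ch] assms(3) e] x c(2) d(2) by (auto simp: mem_Times_iff)
    have "smooth_on ?T (map_prod (snd ?c) (snd ?d) \<circ> \<phi>)"
      using psmooth_smooth_on[OF assms(3) e] by simp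
    from smooth_on_fst[OF T(1) this] smooth_on_snd[OF T(1) this]
    have "psmooth ?T M (\<lambda>x. fst (\<phi> x))" "psmooth ?T N (\<lambda>x. snd (\<phi> x))"
      by (auto intro!: psmooth_in_chart[OF assms(1) c(1) T(1)] psmooth_in_chart[OF assms(2) d(1) T(1)])
    then show ?thesis using T by (intro exI[of _ ?T]) simp
  qed
  then show "psmooth S M (\<lambda>x. fst (\<phi> x))" "psmooth S N (\<lambda>x. snd (\<phi> x))"
    using psmooth_local[OF psmooth_open[OF assms(3)]] by blast+
qed

lemma smooth_atlas_prod:
  fixes M :: "('p, 'e::model_space) mfd" and N :: "('q, 'f::model_space) mfd"
  assumes "smooth_atlas M" "smooth_atlas N"
  shows "smooth_atlas (prod_mfd M N)"
proof (rule smooth_atlas_psmooth)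
  note M = smooth_atlas_charted[OF assms(1)] and N = smooth_atlas_charted[OF assms(2)]
  show ch: "charted (prod_mfd M N)" by (rule charted_prod[OF M N])
  fix e assume e: "e \<in> atlas (prod_mfd M N)"
  then obtain c d where cd: "c \<in> atlas M" "d \<in> atlas N" "e = (fst c \<times> fst d, map_prod (snd c) (snd d))"
    by (rule atlas_prod_mfdE)
  note e' = charted_chart[OF ch e]
  let ?V = "snd e ` fst e"
  have "map_prod (snd c) (snd d) ` (fst c \<times> fst d) = (snd c ` fst c) \<times> (snd d ` fst d)"
    by force
  then have V: "open ?V" "?V = (snd c ` fst c) \<times> (snd d ` fst d)"
    using chart_open_image[OF e'] by (simp_all add: cd(3))
  have "psmooth ?V (prod_mfd M N) (\<lambda>z. (chart_inv c (fst z), chart_inv d (snd z)))"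
    by (intro psmooth_Pair M N psmooth_reparam[OF M psmooth_chart_inv[OF assms(1) cd(1)]] 
        psmooth_reparam[OF N psmooth_chart_inv[OF assms(2) cd(2)]] V(1) smooth_on_fst smooth_on_snd
        smooth_on_id) (auto simp: V(2))
  then show "psmooth ?V (prod_mfd M N) (chart_inv e)"
  proof (rule psmooth_cong[OF ch])
    fix z assume "z \<in> ?V"
    then obtain p q where pq: "p \<in> fst c" "q \<in> fst d" "z = (snd c p, snd d q)"
      using V(2) by auto
    then have "z = snd e (p, q)" "(p, q) \<in> fst e" by (simp_all add: cd(3))
    then have "chart_inv e z = (p, q)" using chart_inv_left[OF e'] by simp
    then show "(chart_inv c (fst z), chart_inv d (snd z)) = chart_inv e z"
      using pq charted_chart[OF M cd(1)] charted_chart[OF N cd(2)] by (simp add: chart_inv_left)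
  qed
qed

lemma smooth_map_Pair:
  assumes "charted L" "charted M" "charted N" "smooth_map L M f" "smooth_map L N g"
  shows "smooth_map L (prod_mfd M N) (\<lambda>x. (f x, g x))"
  by (rule smooth_mapI[OF assms(1)], rule psmooth_Pair[OF assms(2) _ assms(3)];
      rule psmooth_of_smooth_map[OF assms(1)], rule assms)

lemma smooth_map_snd:
  fixes M :: "('p, 'e::model_space) mfd" and N :: "('q, 'f::model_space) mfd"
  assumes "smooth_atlas M" "smooth_atlas N"
  shows "smooth_map (prod_mfd M N) N snd"
  by (rule smooth_map_psmoothI[OF smooth_atlas_prod[OF assms]])
    (rule psmooth_snd[OF assms])

lemma psmooth_two_args:
  assumes "charted M" "psmooth S M \<phi>" "open T"
  shows psmooth_first_arg: "psmooth (S \<times> T) M (\<lambda>z. \<phi> (fst z))"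
    and psmooth_second_arg: "psmooth (T \<times> S) M (\<lambda>z. \<phi> (snd z))"
proof -
  have o: "open (S \<times> T)" "open (T \<times> S)"
    using psmooth_open[OF assms(2)] assms(3) by (simp_all add: open_Times)
  show "psmooth (S \<times> T) M (\<lambda>z. \<phi> (fst z))" "psmooth (T \<times> S) M (\<lambda>z. \<phi> (snd z))"
    by (rule psmooth_reparam[OF assms(1,2) o(1) smooth_on_fst[OF o(1) smooth_on_id[OF o(1)]]]
        psmooth_reparam[OF assms(1,2) o(2) smooth_on_snd[OF o(2) smooth_on_id[OF o(2)]]], auto)+
qed

text \<open>
  Leibniz rule: a map of two variables restricted to the diagonal. It replaces any description of the
  tangent space of a product manifold.
\<close>

lemma vel_diagonal:
  fixes H :: "'a::model_space \<Rightarrow> 'a \<Rightarrow> 'p"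
  assumes M: "charted M" and H: "psmooth (S \<times> T) M (\<lambda>z. H (fst z) (snd z))" and x: "x \<in> S" "x \<in> T"
  shows "vel M (\<lambda>y. H y y) x v = vel M (\<lambda>y. H y x) x v + vel M (\<lambda>y. H x y) x v"
proof -
  let ?D = "vel M (\<lambda>z. H (fst z) (snd z)) (x, x)"
  have xx: "(x, x) \<in> S \<times> T" using x by simp
  have "vel M (\<lambda>y. H y y) x v = ?D (v, v)"
    using vel_reparam[OF M H, of "\<lambda>y. (y, y)" x "\<lambda>v. (v, v)" v] xx
    by (simp add: has_derivative_Pair)
  moreover have "vel M (\<lambda>y. H y x) x v = ?D (v, 0)"
    using vel_reparam[OF M H, of "\<lambda>y. (y, x)" x "\<lambda>v. (v, 0)" v] xx
    by (simp add: has_derivative_Pair)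
  moreover have "vel M (\<lambda>y. H x y) x v = ?D (0, v)"
    using vel_reparam[OF M H, of "\<lambda>y. (x, y)" x "\<lambda>v. (0, v)" v] xx
    by (simp add: has_derivative_Pair)
  moreover have "?D (v, v) = ?D (v, 0) + ?D (0, v)"
    using linear_add[OF linear_vel[OF M H xx], of "(v, 0)" "(0, v)"] by simp
  ultimately show ?thesis by simp
qed

text \<open>
  The partial velocities lie in varying tangent spaces in general. Here they are all taken at the
  fixed point \<open>m\<close>, so that a single chart computes them and they are partial derivatives of one smooth
  function. This applies to the Maurer-Cartan form and to the adjoint action, whose values are tangent
  at the identity.
\<close>

lemma smooth_on_partial_vel:
  fixes H :: "'a::model_space \<Rightarrow> 'b::model_space \<Rightarrow> 'p" and M :: "('p, 'e::model_space) mfd"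
  assumes M: "charted M" and H: "psmooth (S \<times> T) M (\<lambda>z. H (fst z) (snd z))" and S: "open S"
    and g: "smooth_on S g" "g ` S \<subseteq> T" "\<And>x. x \<in> S \<Longrightarrow> H x (g x) = m"
    and f: "smooth_on S f"
  shows "smooth_on S (\<lambda>x. vel M (\<lambda>y. H x y) (g x) (f x))"
proof (cases "S = {}")
  case True
  then show ?thesis by (auto intro: smooth_on_congI[OF smooth_on_const])
next
  case False
  then have "m \<in> points M"
    using psmooth_points[OF H] g(2,3) by force
  note c = chart_at_props[OF M this]
  let ?h = "snd (chart_at M m) \<circ> (\<lambda>z. H (fst z) (snd z))"
  let ?V = "{z \<in> S \<times> T. H (fst z) (snd z) \<in> fst (chart_at M m)}"
  have sm: "smooth_on ?V ?h"
    by (rule psmooth_smooth_on[OF H c(1)])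
  have gr: "(x, g x) \<in> ?V" if "x \<in> S" for x using g c(2) that by auto
  have "smooth_on S (\<lambda>x. (\<lambda>z. frechet_derivative ?h (at z) (0, w)) (x, g x))" for w
    by (rule smooth_on_compose[OF S _ smooth_on_Pair[OF S smooth_on_id[OF S] g(1)]
          smooth_on_derivative[OF sm]]) (use gr in auto)
  then have *: "smooth_on S (\<lambda>x. vel M (\<lambda>y. H x y) (g x) w)" for w
  proof (rule smooth_on_congI[OF _ S])
    fix x assume x: "x \<in> S"
    have "vel M (\<lambda>y. H x y) (g x) w = vel M (\<lambda>z. H (fst z) (snd z)) (x, g x) (0, w)"
      using vel_reparam[OF M H, of "\<lambda>y. (x, y)" "g x" "\<lambda>v. (0, v)" w] gr[OF x]
      by (simp add: has_derivative_Pair)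
    then show "vel M (\<lambda>y. H x y) (g x) w = (\<lambda>z. frechet_derivative ?h (at z) (0, w)) (x, g x)"
      using g(3)[OF x] by (simp add: vel_def)
  qed
  have lin: "linear (vel M (\<lambda>y. H x y) (g x))" if "x \<in> S" for x
  proof -
    have "psmooth T M (\<lambda>y. (\<lambda>z. H (fst z) (snd z)) (x, y))"
    proof (rule psmooth_reparam[OF M H])
      show "open T"
        using psmooth_open[OF H] open_image_snd[of "S \<times> T"] False by simp
      then show "smooth_on T (Pair x)"
        by (intro smooth_on_Pair smooth_on_id) simp_all
    qed (use that in auto)
    then show ?thesis using linear_vel[OF M, of T] g(2) that by auto
  qed
  show ?thesis by (rule smooth_on_linear_family[OF S lin * f])
qed

section \<open>Differential forms along parametrisations\<close>

text \<open>
  In a chart the velocity is the coordinate vector of a smooth function, and the form is smooth on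
  constant coordinate vectors by definition.
\<close>

lemma one_form_smooth:
  fixes M :: "('p, 'e::model_space) mfd"
  assumes M: "smooth_atlas M" and \<omega>: "one_form M \<omega>" and \<phi>: "psmooth S M \<phi>"
  shows "smooth_on S (\<lambda>x. \<omega> (\<phi> x) (vel M \<phi> x v))"
proof (rule smooth_on_local)
  note ch = smooth_atlas_charted[OF M]
  fix x assume x: "x \<in> S"
  define c where "c = chart_at M (\<phi> x)"
  note c = chart_at_props[OF ch psmooth_points[OF \<phi> x], folded c_def]
  let ?T = "{y \<in> S. \<phi> y \<in> fst c}"
  note T = psmooth_open_chart[OF ch \<phi> c(1)]
  note sm = psmooth_smooth_on[OF \<phi> c(1)]
  have "smooth_on ?T (\<lambda>y. \<omega> (\<phi> y) (coord_vector M c (\<phi> y) (frechet_derivative (snd c \<circ> \<phi>) (at y) v)))"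
  proof (rule smooth_on_linear_family[OF T, where L = "\<lambda>y w. \<omega> (\<phi> y) (coord_vector M c (\<phi> y) w)"
        and g = "\<lambda>y. frechet_derivative (snd c \<circ> \<phi>) (at y) v"])
    fix y assume y: "y \<in> ?T"
    have "linear (\<omega> (\<phi> y))"
      using \<omega> psmooth_points[OF \<phi>, of y] y by (auto simp: one_form_def)
    moreover have "linear (vel M (chart_inv c) (snd c (\<phi> y)))"
      by (rule linear_vel[OF ch psmooth_chart_inv[OF M c(1)]]) (use y in auto)
    then have "linear (coord_vector M c (\<phi> y))"
      using ext[of "coord_vector M c (\<phi> y)" "vel M (chart_inv c) (snd c (\<phi> y))",
          OF coord_vector_eq_vel[OF ch c(1)]] y by simp
    ultimately show "linear (\<lambda>w. \<omega> (\<phi> y) (coord_vector M c (\<phi> y) w))"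
      using linear_compose by (auto simp: comp_def)
  next
    fix w
    have s: "smooth_on (snd c ` fst c) (\<lambda>x. \<omega> (chart_inv c x) (coord_vector M c (chart_inv c x) w))"
      using \<omega> c(1) unfolding one_form_def by blast
    have "smooth_on ?T (\<lambda>y. (\<lambda>x. \<omega> (chart_inv c x) (coord_vector M c (chart_inv c x) w)) ((snd c \<circ> \<phi>) y))"
      by (rule smooth_on_compose[OF T _ sm s]) auto
    then show "smooth_on ?T (\<lambda>y. \<omega> (\<phi> y) (coord_vector M c (\<phi> y) w))"
      by (rule smooth_on_congI[OF _ T]) (simp add: chart_inv_left[OF c(3)])
  qed (rule smooth_on_derivative[OF sm])
  then have "smooth_on ?T (\<lambda>y. \<omega> (\<phi> y) (vel M \<phi> y v))"
    by (rule smooth_on_congI[OF _ T]) (simp add: vel_coord_vector[OF M \<phi> _ c(1)])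
  then show "\<exists>T. open T \<and> x \<in> T \<and> smooth_on (S \<inter> T) (\<lambda>y. \<omega> (\<phi> y) (vel M \<phi> y v))"
    using T x c(2) by (intro exI[of _ ?T]) (auto elim: smooth_on_subset)
qed

lemma one_formI:
  fixes M :: "('p, 'e::model_space) mfd"
  assumes M: "smooth_atlas M" and "\<omega> \<in> extensional (points M)"
    and "\<And>p. p \<in> points M \<Longrightarrow> linear (\<omega> p)"
    and sm: "\<And>S (\<phi> :: 'e \<Rightarrow> 'p) v. psmooth S M \<phi> \<Longrightarrow> smooth_on S (\<lambda>x. \<omega> (\<phi> x) (vel M \<phi> x v))"
  shows "one_form M \<omega>"
  unfolding one_form_def
proof (intro conjI ballI allI)
  note ch = smooth_atlas_charted[OF M]
  fix c v assume c: "c \<in> atlas M"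
  note c' = charted_chart[OF ch c]
  show "smooth_on (snd c ` fst c) (\<lambda>x. \<omega> (chart_inv c x) (coord_vector M c (chart_inv c x) v))"
    by (rule smooth_on_congI[OF sm[OF psmooth_chart_inv[OF M c]] chart_open_image[OF c']])
      (simp only: coord_vector_eq_vel[OF ch c chart_inv_into] chart_inv_right)
next
  show "\<omega> \<in> extensional (points M)" by fact
  show "linear (\<omega> p)" if "p \<in> points M" for p using that by fact
qed

lemma smooth_map_const:
  "charted M \<Longrightarrow> charted N \<Longrightarrow> p \<in> points N \<Longrightarrow> smooth_map M N (\<lambda>x. p)"
  by (rule smooth_mapI, assumption, rule psmooth_const)
    (auto dest: charted_chart chart_open_image)

lemma smooth_map_id: "smooth_atlas M \<Longrightarrow> smooth_map M M (\<lambda>x. x)"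
  by (rule smooth_mapI[OF smooth_atlas_charted psmooth_chart_inv])

lemma smooth_map_points: "smooth_map M N f \<Longrightarrow> p \<in> points M \<Longrightarrow> f p \<in> points N"
  using continuous_map_image_subset_topspace[of "mtop M" "mtop N" f] by (auto simp: smooth_map_def)

lemma psmooth_map2:
  assumes "charted L" "charted M" "charted N" "smooth_map (prod_mfd L M) N (\<lambda>(p, q). f p q)"
    and "psmooth S L \<phi>" "psmooth S M \<eta>"
  shows "psmooth S N (\<lambda>x. f (\<phi> x) (\<eta> x))"
  using psmooth_smooth_map[OF charted_prod[OF assms(1,2)] assms(4)
      psmooth_Pair[OF assms(1,5,2,6)] assms(3)] by simp

lemma smooth_map_map2:
  assumes "charted K" "charted L" "charted M" "charted N" "smooth_map (prod_mfd L M) N (\<lambda>(p, q). f p q)"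
    and "smooth_map K L g" "smooth_map K M h"
  shows "smooth_map K N (\<lambda>x. f (g x) (h x))"
  using smooth_map_compose[OF assms(1) charted_prod[OF assms(2,3)] assms(4)
      smooth_map_Pair[OF assms(1-3,6,7)] assms(5)] by simp

lemma smooth_map_from_open_sub:
  fixes L :: "('q, 'f::model_space) mfd" and M :: "('p, 'e::model_space) mfd"
  assumes "charted L" "openin (mtop M) U" "smooth_map L (open_sub M U) f"
  shows "smooth_map L M f"
  using psmooth_of_smooth_map[OF assms(1,3)] psmooth_open_sub[OF assms(2)]
  by (intro smooth_mapI[OF assms(1)]) blast

lemma psmooth_smooth_map_open_sub:
  assumes "charted M" "charted N" "openin (mtop M) U" "smooth_map (open_sub M U) N f"
    and "psmooth S M \<phi>" "\<And>x. x \<in> S \<Longrightarrow> \<phi> x \<in> U"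
  shows "psmooth S N (\<lambda>x. f (\<phi> x))"
  using assms(5,6)
  by (intro psmooth_smooth_map[OF charted_open_sub[OF assms(1,3)] assms(4) _ assms(2)])
    (auto simp: psmooth_open_sub[OF assms(3)])

text \<open>
  The tangent coordinates of an open subset differ from those of the whole space by a linear
  isomorphism. Vanishing of a velocity does not depend on this and is all that is used below.
\<close>

lemma vel_zero_open_sub:
  fixes M :: "('p, 'e::model_space) mfd" and N :: "('q, 'f::model_space) mfd"
  assumes M: "smooth_atlas M" and N: "charted N" and U: "openin (mtop M) U"
    and f: "smooth_map (open_sub M U) N f"
    and \<phi>: "psmooth S M \<phi>" and x: "x \<in> S" "\<phi> x \<in> U" and 0: "vel M \<phi> x v = 0"
  shows "vel N (\<lambda>y. f (\<phi> y)) x v = 0"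
proof -
  note ch = smooth_atlas_charted[OF M]
  define c where "c = chart_at M (\<phi> x)"
  note c = chart_at_props[OF ch psmooth_points[OF \<phi> x(1)], folded c_def]
  let ?T = "{y \<in> S. \<phi> y \<in> fst c \<inter> U}"
  note r = is_chart_restrict[OF c(3) U]
  have c': "psmooth (snd c ` (fst c \<inter> U)) M (chart_inv c)"
    by (rule psmooth_subset[OF psmooth_chart_inv[OF M c(1)]])
      (use chart_open_image[OF r] in auto)
  have f': "psmooth (snd c ` (fst c \<inter> U)) N (\<lambda>y. f (chart_inv c y))"
    by (rule psmooth_smooth_map_open_sub[OF ch N U f c']) (auto simp: chart_inv_left[OF c(3)])
  have "openin (mtop M) (fst c \<inter> U)" using chart_open[OF c(3)] U by blast
  then have T: "open ?T" by (rule psmooth_open_preimage[OF \<phi>])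
  have "vel N (\<lambda>y. f (\<phi> y)) x v = vel N (\<lambda>y. f (chart_inv c ((snd c \<circ> \<phi>) y))) x v"
    using x c(2) by (intro fun_cong[OF vel_cong[OF T]]) (auto simp: chart_inv_left[OF c(3)])
  also have "\<dots> = vel N (\<lambda>y. f (chart_inv c y)) ((snd c \<circ> \<phi>) x) (vel M \<phi> x v)"
    unfolding vel_def[of M] c_def[symmetric]
    by (rule vel_reparam[OF N f' _ psmooth_has_derivative[OF ch \<phi> x(1) c(1,2)]]) (use c x in auto)
  also have "\<dots> = 0"
    unfolding 0 by (rule linear_0[OF linear_vel[OF N f']]) (use c x in auto)
  finally show ?thesis .
qed

section \<open>Lie groups\<close>

locale lie = group G for G :: "('g, 'e::model_space) lie_grp" (structure) +
  assumes lie_group: "lie_group G"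
begin

lemma points: "points (mfd_of G) = carrier G"
  using lie_group by (simp add: lie_group_def)

lemma smooth_atlas: "smooth_atlas (mfd_of G)"
  using lie_group by (simp add: lie_group_def manifold_smooth_atlas)

lemma charted: "charted (mfd_of G)"
  by (rule smooth_atlas_charted[OF smooth_atlas])

lemma one_point: "\<one> \<in> points (mfd_of G)"
  by (simp add: points)

lemma smooth_mult: "smooth_map (prod_mfd (mfd_of G) (mfd_of G)) (mfd_of G) (\<lambda>(x, y). x \<otimes> y)"
  and smooth_inv: "smooth_map (mfd_of G) (mfd_of G) (\<lambda>x. inv x)"
  using lie_group by (simp_all add: lie_group_def)

lemmas psmooth_mult = psmooth_map2[OF charted charted charted smooth_mult]
lemmas psmooth_inv = psmooth_smooth_map[OF charted smooth_inv _ charted]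

lemma psmooth_carrier: "psmooth S (mfd_of G) \<phi> \<Longrightarrow> x \<in> S \<Longrightarrow> \<phi> x \<in> carrier G"
  using psmooth_points[of S "mfd_of G" \<phi> x] by (simp add: points)

lemma smooth_left_mult: "g \<in> carrier G \<Longrightarrow> smooth_map (mfd_of G) (mfd_of G) (\<lambda>x. g \<otimes> x)"
  using smooth_map_map2[OF charted charted charted charted smooth_mult
      smooth_map_const[OF charted charted, of g] smooth_map_id[OF smooth_atlas]] by (simp add: points)

lemma smooth_right_mult: "g \<in> carrier G \<Longrightarrow> smooth_map (mfd_of G) (mfd_of G) (\<lambda>x. x \<otimes> g)"
  using smooth_map_map2[OF charted charted charted charted smooth_mult
      smooth_map_id[OF smooth_atlas] smooth_map_const[OF charted charted, of g]] by (simp add: points)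

lemma smooth_conj: 
  assumes "g \<in> carrier G"
  shows "smooth_map (mfd_of G) (mfd_of G) (\<lambda>x. g \<otimes> x \<otimes> inv g)"
  using smooth_map_compose[OF charted charted charted smooth_left_mult[OF assms]
      smooth_right_mult[of "inv g"]] assms by simp

lemma linear_Ad: "g \<in> carrier G \<Longrightarrow> linear (Ad G g)"
  unfolding Ad_def lie_algebra_map_def
  by (rule linear_differential[OF charted charted smooth_conj one_point])

lemma maurer_cartan_vel:
  assumes "psmooth S (mfd_of G) \<phi>" "x \<in> S"
  shows "maurer_cartan G (\<phi> x) (vel (mfd_of G) \<phi> x v) = vel (mfd_of G) (\<lambda>y. inv (\<phi> x) \<otimes> \<phi> y) x v"
  using psmooth_carrier[OF assms]
    vel_smooth_map[OF charted charted smooth_left_mult[of "inv (\<phi> x)"] assms]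
  by (simp add: maurer_cartan_def)

lemma linear_maurer_cartan: "g \<in> carrier G \<Longrightarrow> linear (maurer_cartan G g)"
  using linear_differential[OF charted charted smooth_left_mult[of "inv g"], of g]
  by (simp add: maurer_cartan_def points)

lemma maurer_cartan_one: "maurer_cartan G \<one> v = v"
proof -
  have "differential (mfd_of G) (mfd_of G) (\<lambda>x. inv \<one> \<otimes> x) \<one> v =
      differential (mfd_of G) (mfd_of G) (\<lambda>x. x) \<one> v"
    by (rule differential_cong[OF charted one_point]) (simp add: points)
  then show ?thesis
    by (simp add: maurer_cartan_def differential_id[OF charted one_point] del: inv_one)
qed

lemma smooth_on_maurer_cartan:
  assumes "psmooth S (mfd_of G) \<phi>"
  shows "smooth_on S (\<lambda>x. maurer_cartan G (\<phi> x) (vel (mfd_of G) \<phi> x v))"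
proof -
  note S = psmooth_open[OF assms]
  have "psmooth (S \<times> S) (mfd_of G) (\<lambda>z. inv (\<phi> (fst z)) \<otimes> \<phi> (snd z))"
    by (intro psmooth_mult psmooth_inv psmooth_two_args[OF charted assms S])
  then have "smooth_on S (\<lambda>x. vel (mfd_of G) (\<lambda>y. inv (\<phi> x) \<otimes> \<phi> y) x v)"
    by (rule smooth_on_partial_vel[OF charted _ S smooth_on_id[OF S], where m = \<one>])
      (use psmooth_carrier[OF assms] in auto)
  then show ?thesis
    by (rule smooth_on_congI[OF _ S maurer_cartan_vel[OF assms]])
qed

text \<open>
  \<open>Ad G (inv g)\<close> is the partial velocity at the identity of \<open>inv g \<otimes> h \<otimes> g\<close> in the variable \<open>h\<close>.
\<close>

lemma smooth_on_Ad_inv: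
  fixes \<phi> :: "'a::model_space \<Rightarrow> 'g"
  assumes \<phi>: "psmooth S (mfd_of G) \<phi>" and f: "smooth_on S f"
  shows "smooth_on S (\<lambda>x. Ad G (inv (\<phi> x)) (f x))"
proof -
  define c where "c = chart_at (mfd_of G) \<one>"
  note c = chart_at_props[OF charted one_point, folded c_def]
  let ?T = "snd c ` fst c"
  note S = psmooth_open[OF \<phi>]
  have "psmooth (S \<times> ?T) (mfd_of G)
      (\<lambda>z. inv (\<phi> (fst z)) \<otimes> chart_inv c (snd z) \<otimes> inv (inv (\<phi> (fst z))))"
    by (intro psmooth_mult psmooth_inv psmooth_first_arg[OF charted \<phi> chart_open_image[OF c(3)]]
        psmooth_second_arg[OF charted psmooth_chart_inv[OF smooth_atlas c(1)] S])
  then have "smooth_on S (\<lambda>x. vel (mfd_of G) 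
      (\<lambda>y. inv (\<phi> x) \<otimes> chart_inv c y \<otimes> inv (inv (\<phi> x))) (snd c \<one>) (f x))"
    by (rule smooth_on_partial_vel[OF charted _ S smooth_on_const, where m = \<one>])
      (use psmooth_carrier[OF \<phi>] c f in \<open>auto simp: chart_inv_left[OF c(3)]\<close>)
  moreover have "vel (mfd_of G) (\<lambda>y. inv (\<phi> x) \<otimes> chart_inv c y \<otimes> inv (inv (\<phi> x))) (snd c \<one>) w
      = Ad G (inv (\<phi> x)) w" for x w
    by (simp add: Ad_def lie_algebra_map_def differential_eq_vel[OF charted one_point] c_def)
  ultimately show ?thesis by simp
qed

end

section \<open>Principal bundles\<close>

locale principal = B: lie B
  for B :: "('b, 'eb::model_space) lie_grp" (structure) +
  fixes X :: "('x, 'ex::model_space) mfd" and E :: "('r, 'er::model_space, 'x, 'b, 'g) eq_bundle"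
  assumes principal_bundle: "principal_bundle B X E"
begin

abbreviation T where "T \<equiv> total E"
abbreviation act (infixl "\<bullet>\<bullet>" 70) where "r \<bullet>\<bullet> b \<equiv> ract E r b"
abbreviation fund where "fund \<equiv> fundamental_vector B E"
abbreviation dact where "dact b \<equiv> differential T T (\<lambda>r. r \<bullet>\<bullet> b)"

lemma smooth_atlas_base: "smooth_atlas X" and smooth_atlas_total: "smooth_atlas T"
  using principal_bundle by (simp_all add: principal_bundle_def manifold_smooth_atlas)

lemmas charted_base = smooth_atlas_charted[OF smooth_atlas_base]
lemmas charted_total = smooth_atlas_charted[OF smooth_atlas_total]

lemma smooth_proj: "smooth_map T X (proj E)"
  using principal_bundle by (simp add: principal_bundle_def)

lemma proj_point: "r \<in> points T \<Longrightarrow> proj E r \<in> points X"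
  by (rule smooth_map_points[OF smooth_proj])

lemma smooth_act: "smooth_map (prod_mfd T (mfd_of B)) T (\<lambda>(r, b). r \<bullet>\<bullet> b)"
  using principal_bundle by (simp add: principal_bundle_def right_action_def)

lemma act_one: "r \<in> points T \<Longrightarrow> r \<bullet>\<bullet> \<one> = r"
  and act_mult: "g \<in> carrier B \<Longrightarrow> h \<in> carrier B \<Longrightarrow> r \<in> points T \<Longrightarrow> r \<bullet>\<bullet> (g \<otimes> h) = r \<bullet>\<bullet> g \<bullet>\<bullet> h"
  using principal_bundle by (simp_all add: principal_bundle_def right_action_def)

lemma proj_act: "r \<in> points T \<Longrightarrow> b \<in> carrier B \<Longrightarrow> proj E (r \<bullet>\<bullet> b) = proj E r"
  using principal_bundle by (simp add: principal_bundle_def)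

lemmas psmooth_act = psmooth_map2[OF charted_total B.charted charted_total smooth_act]
lemmas psmooth_proj = psmooth_smooth_map[OF charted_total smooth_proj _ charted_base]

lemma smooth_orbit: "r \<in> points T \<Longrightarrow> smooth_map (mfd_of B) T (\<lambda>b. r \<bullet>\<bullet> b)"
  by (rule smooth_map_map2[OF B.charted charted_total B.charted charted_total smooth_act
      smooth_map_const[OF B.charted charted_total] smooth_map_id[OF B.smooth_atlas]])

lemma smooth_translation: "b \<in> carrier B \<Longrightarrow> smooth_map T T (\<lambda>r. r \<bullet>\<bullet> b)"
  by (rule smooth_map_map2[OF charted_total charted_total B.charted charted_total smooth_act
      smooth_map_id[OF smooth_atlas_total] smooth_map_const[OF charted_total B.charted]])
    (simp add: B.points)

lemma act_point: "r \<in> points T \<Longrightarrow> b \<in> carrier B \<Longrightarrow> r \<bullet>\<bullet> b \<in> points T"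
  by (rule smooth_map_points[OF smooth_translation])

lemma fund_vel:
  assumes "psmooth S (mfd_of B) \<eta>" "x \<in> S" "\<eta> x = \<one>" "r \<in> points T"
  shows "vel T (\<lambda>y. r \<bullet>\<bullet> \<eta> y) x v = fund (vel (mfd_of B) \<eta> x v) r"
  using vel_smooth_map[OF B.charted charted_total smooth_orbit[OF assms(4)] assms(1,2)]
  by (simp add: fundamental_vector_def assms(3))

text \<open>
  The orbit map at \<open>r\<close> near \<open>b\<close> is the orbit map at \<open>r \<bullet> b\<close> near the identity after left translation
  by the inverse of \<open>b\<close>, whose differential is the Maurer-Cartan form.
\<close>

lemma vel_act_right:
  assumes \<eta>: "psmooth S (mfd_of B) \<eta>" and x: "x \<in> S" and r: "r \<in> points T"
  shows "vel T (\<lambda>y. r \<bullet>\<bullet> \<eta> y) x v =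
    fund (maurer_cartan B (\<eta> x) (vel (mfd_of B) \<eta> x v)) (r \<bullet>\<bullet> \<eta> x)"
proof -
  note S = psmooth_open[OF \<eta>]
  note \<eta>c = B.psmooth_carrier[OF \<eta>]
  have sm: "psmooth S (mfd_of B) (\<lambda>y. inv (\<eta> x) \<otimes> \<eta> y)"
    by (rule B.psmooth_mult[OF psmooth_const[OF B.charted _ S] \<eta>]) (simp add: B.points \<eta>c x)
  have "vel T (\<lambda>y. r \<bullet>\<bullet> \<eta> y) x v = vel T (\<lambda>y. (r \<bullet>\<bullet> \<eta> x) \<bullet>\<bullet> (inv (\<eta> x) \<otimes> \<eta> y)) x v"
    using \<eta>c x r
    by (intro fun_cong[OF vel_cong[OF S]])
      (simp_all add: act_mult[symmetric] B.m_assoc[symmetric] del: B.m_assoc)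
  also have "\<dots> = fund (vel (mfd_of B) (\<lambda>y. inv (\<eta> x) \<otimes> \<eta> y) x v) (r \<bullet>\<bullet> \<eta> x)"
    by (rule fund_vel[OF sm x]) (use \<eta>c x r act_point in auto)
  finally show ?thesis by (simp add: B.maurer_cartan_vel[OF \<eta> x])
qed

text \<open>
  The Leibniz rule for the action; the motion of the group element contributes the fundamental vector
  of its logarithmic derivative.
\<close>

lemma vel_act:
  assumes \<phi>: "psmooth S T \<phi>" and \<eta>: "psmooth S (mfd_of B) \<eta>" and x: "x \<in> S"
  shows "vel T (\<lambda>y. \<phi> y \<bullet>\<bullet> \<eta> y) x v = dact (\<eta> x) (\<phi> x) (vel T \<phi> x v) +
    fund (maurer_cartan B (\<eta> x) (vel (mfd_of B) \<eta> x v)) (\<phi> x \<bullet>\<bullet> \<eta> x)"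
proof -
  note S = psmooth_open[OF \<phi>]
  have "vel T (\<lambda>y. \<phi> y \<bullet>\<bullet> \<eta> y) x v =
      vel T (\<lambda>y. \<phi> y \<bullet>\<bullet> \<eta> x) x v + vel T (\<lambda>y. \<phi> x \<bullet>\<bullet> \<eta> y) x v"
    by (rule vel_diagonal[OF charted_total psmooth_act[OF psmooth_first_arg[OF charted_total \<phi> S]
          psmooth_second_arg[OF B.charted \<eta> S]] x x])
  also have "vel T (\<lambda>y. \<phi> y \<bullet>\<bullet> \<eta> x) x v = dact (\<eta> x) (\<phi> x) (vel T \<phi> x v)"
    by (rule vel_smooth_map[OF charted_total charted_total smooth_translation \<phi> x])
      (rule B.psmooth_carrier[OF \<eta> x])
  finally show ?thesis
    by (simp add: vel_act_right[OF \<eta> x psmooth_points[OF \<phi> x]])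
qed

text \<open>
  A local trivialisation in the form used below: a smooth section \<open>e\<close> over \<open>U\<close> and the smooth
  coordinate \<open>k\<close> in the structure group that it determines.
\<close>

definition trivialisation :: "'x set \<Rightarrow> ('x \<Rightarrow> 'r) \<Rightarrow> ('r \<Rightarrow> 'b) \<Rightarrow> bool"
  where "trivialisation U e k \<longleftrightarrow> openin (mtop X) U \<and> smooth_map (open_sub X U) T e \<and>
    openin (mtop T) {r \<in> points T. proj E r \<in> U} \<and>
    smooth_map (open_sub T {r \<in> points T. proj E r \<in> U}) (mfd_of B) k \<and>
    (\<forall>y\<in>U. e y \<in> points T \<and> proj E (e y) = y) \<and>
    (\<forall>r\<in>points T. proj E r \<in> U \<longrightarrow> k r \<in> carrier B \<and> e (proj E r) \<bullet>\<bullet> k r = r) \<and>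
    (\<forall>r\<in>points T. \<forall>b\<in>carrier B. proj E r \<in> U \<longrightarrow> k (r \<bullet>\<bullet> b) = k r \<otimes> b)"

lemma ex_trivialisation:
  assumes "x \<in> points X"
  shows "\<exists>U e k. x \<in> U \<and> trivialisation U e k"
proof -
  obtain U \<Phi> where U: "openin (mtop X) U" "x \<in> U"
    and \<Phi>: "diffeo (prod_mfd (open_sub X U) (mfd_of B)) (open_sub T {r \<in> points T. proj E r \<in> U}) \<Phi>"
    and eq: "\<And>y b. y \<in> U \<Longrightarrow> b \<in> carrier B \<Longrightarrow> proj E (\<Phi> (y, b)) = y"
      "\<And>y b b'. y \<in> U \<Longrightarrow> b \<in> carrier B \<Longrightarrow> b' \<in> carrier B \<Longrightarrow> \<Phi> (y, b) \<bullet>\<bullet> b' = \<Phi> (y, b \<otimes> b')"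
    using bspec[OF conjunct2[OF conjunct2[OF conjunct2[OF conjunct2[OF conjunct2[OF conjunct2[OF
      principal_bundle[unfolded principal_bundle_def]]]]]]] assms] by blast
  let ?V = "{r \<in> points T. proj E r \<in> U}"
  have "continuous_map (mtop T) (mtop X) (proj E)"
    using smooth_proj by (simp add: smooth_map_def)
  then have V: "openin (mtop T) ?V"
    using U(1) by (rule openin_continuous_map_preimage)
  have Us: "U \<subseteq> points X" using U(1) by (rule openin_subset)
  note cU = charted_open_sub[OF charted_base U(1)] and cV = charted_open_sub[OF charted_total V]
  note sU = smooth_atlas_open_sub[OF smooth_atlas_base U(1)]
  obtain g where g: "smooth_map (open_sub T ?V) (prod_mfd (open_sub X U) (mfd_of B)) g"
    "\<And>z. z \<in> U \<times> carrier B \<Longrightarrow> g (\<Phi> z) = z" "\<And>r. r \<in> ?V \<Longrightarrow> \<Phi> (g r) = r"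
    and s: "smooth_map (prod_mfd (open_sub X U) (mfd_of B)) (open_sub T ?V) \<Phi>"
    using \<Phi> Us by (auto simp: diffeo_def points_prod_mfd points_open_sub B.points inf_absorb2)
  have \<Phi>p: "\<Phi> z \<in> points T" if "z \<in> U \<times> carrier B" for z
    using smooth_map_points[OF s, of z] that Us
    by (auto simp: points_prod_mfd points_open_sub B.points)
  have gp: "g r \<in> U \<times> carrier B" if "r \<in> ?V" for r
    using smooth_map_points[OF g(1), of r] that
    by (auto simp: points_prod_mfd points_open_sub B.points)
  define e k where "e = (\<lambda>y. \<Phi> (y, \<one>))" and "k = (\<lambda>r. snd (g r))"
  have main: "\<exists>b\<in>carrier B. r = \<Phi> (proj E r, b) \<and> k r = b" if r: "r \<in> ?V" for r
  proof -
    obtain y b where yb: "g r = (y, b)" "y \<in> U" "b \<in> carrier B"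
      using gp[OF r] by (cases "g r") auto
    then have "\<Phi> (y, b) = r" using g(3)[OF r] by simp
    moreover have "proj E r = y" using eq(1)[OF yb(2,3)] calculation by simp
    ultimately show ?thesis using yb by (simp add: k_def)
  qed
  have "trivialisation U e k"
    unfolding trivialisation_def
  proof (intro conjI ballI impI U(1) V)
    have "smooth_map (open_sub X U) (open_sub T ?V) (\<lambda>y. \<Phi> (y, \<one>))"
      by (rule smooth_map_compose[OF cU charted_prod[OF cU B.charted] cV
            smooth_map_Pair[OF cU cU B.charted smooth_map_id[OF sU]
              smooth_map_const[OF cU B.charted B.one_point]] s])
    then show "smooth_map (open_sub X U) T e"
      unfolding e_def by (rule smooth_map_from_open_sub[OF cU V])
    show "smooth_map (open_sub T ?V) (mfd_of B) k"
      unfolding k_def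
      by (rule smooth_map_compose[OF cV charted_prod[OF cU B.charted] B.charted g(1)
            smooth_map_snd[OF sU B.smooth_atlas]])
    show "e y \<in> points T" "proj E (e y) = y" if "y \<in> U" for y
      using that \<Phi>p eq(1) by (auto simp: e_def)
    fix r assume r: "r \<in> points T"
    {
      assume rU: "proj E r \<in> U"
      with r main obtain b where b: "b \<in> carrier B" "r = \<Phi> (proj E r, b)" "k r = b" by blast
      have e': "e (proj E r) \<bullet>\<bullet> b' = \<Phi> (proj E r, b')" if "b' \<in> carrier B" for b'
        using eq(2)[OF rU _ that, of \<one>] that by (simp add: e_def)
      show "k r \<in> carrier B" "e (proj E r) \<bullet>\<bullet> k r = r"
        using b e' by simp_all
    }
    fix b' assume b': "b' \<in> carrier B" and rU: "proj E r \<in> U"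
    with r main obtain b where b: "b \<in> carrier B" "r = \<Phi> (proj E r, b)" "k r = b" by blast
    have "r \<bullet>\<bullet> b' = \<Phi> (proj E r, b \<otimes> b')"
      using eq(2)[OF rU b(1) b'] b(2) by simp
    then show "k (r \<bullet>\<bullet> b') = k r \<otimes> b'"
      using g(2)[of "(proj E r, b \<otimes> b')"] rU b b' by (simp add: k_def)
  qed
  with U(2) show ?thesis by blast
qed

context
  fixes U e k assumes triv: "trivialisation U e k"
begin

lemma triv_open: "openin (mtop X) U" "openin (mtop T) {r \<in> points T. proj E r \<in> U}"
  and triv_smooth_section: "smooth_map (open_sub X U) T e"
  and triv_smooth_coord: "smooth_map (open_sub T {r \<in> points T. proj E r \<in> U}) (mfd_of B) k"
  and triv_section: "y \<in> U \<Longrightarrow> e y \<in> points T" "y \<in> U \<Longrightarrow> proj E (e y) = y"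
  and triv_coord: "r \<in> points T \<Longrightarrow> proj E r \<in> U \<Longrightarrow> k r \<in> carrier B"
    "r \<in> points T \<Longrightarrow> proj E r \<in> U \<Longrightarrow> e (proj E r) \<bullet>\<bullet> k r = r"
    "r \<in> points T \<Longrightarrow> proj E r \<in> U \<Longrightarrow> b \<in> carrier B \<Longrightarrow> k (r \<bullet>\<bullet> b) = k r \<otimes> b"
  using triv by (simp_all add: trivialisation_def)

lemma psmooth_section: "psmooth S X \<phi> \<Longrightarrow> (\<And>x. x \<in> S \<Longrightarrow> \<phi> x \<in> U) \<Longrightarrow> psmooth S T (\<lambda>x. e (\<phi> x))"
  by (rule psmooth_smooth_map_open_sub[OF charted_base charted_total triv_open(1) triv_smooth_section])

lemma psmooth_coord:
  "psmooth S T \<phi> \<Longrightarrow> (\<And>x. x \<in> S \<Longrightarrow> proj E (\<phi> x) \<in> U) \<Longrightarrow> psmooth S (mfd_of B) (\<lambda>x. k (\<phi> x))"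
  by (rule psmooth_smooth_map_open_sub[OF charted_total B.charted triv_open(2) triv_smooth_coord])
    (auto dest: psmooth_points)

lemma triv_quotient:
  assumes "r \<in> points T" "r' \<in> points T" "proj E r = proj E r'" "proj E r \<in> U"
  shows "inv (k r) \<otimes> k r' \<in> carrier B" "r \<bullet>\<bullet> (inv (k r) \<otimes> k r') = r'"
proof -
  note k = triv_coord(1)[OF assms(1,4)] triv_coord(1)[OF assms(2)]
  then show c: "inv (k r) \<otimes> k r' \<in> carrier B" using assms by simp
  have "r \<bullet>\<bullet> (inv (k r) \<otimes> k r') = e (proj E r) \<bullet>\<bullet> k r \<bullet>\<bullet> (inv (k r) \<otimes> k r')"
    using triv_coord(2)[OF assms(1,4)] by simp
  also have "\<dots> = e (proj E r) \<bullet>\<bullet> k r'"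
    using k assms triv_section(1) c
    by (simp add: act_mult[symmetric] B.m_assoc[symmetric] del: B.m_assoc)
  finally show "r \<bullet>\<bullet> (inv (k r) \<otimes> k r') = r'"
    using triv_coord(2)[OF assms(2)] assms by simp
qed

end

text \<open>
  The fibre coordinate of a trivialisation turns the action into multiplication in the group.
\<close>

lemma act_free:
  assumes "r \<in> points T" "b \<in> carrier B" "b' \<in> carrier B" "r \<bullet>\<bullet> b = r \<bullet>\<bullet> b'"
  shows "b = b'"
proof -
  obtain U e k where t: "proj E r \<in> U" "trivialisation U e k"
    using ex_trivialisation[OF proj_point[OF assms(1)]] by blast
  have "k r \<otimes> b = k r \<otimes> b'"
    using triv_coord(3)[OF t(2) assms(1) t(1)] assms(2-4) by metis
  then show ?thesis
    using triv_coord(1)[OF t(2) assms(1) t(1)] assms(2,3) by simp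
qed

abbreviation difference where "difference \<equiv> bundle_difference B E"

lemma difference_act:
  "r \<in> points T \<Longrightarrow> b \<in> carrier B \<Longrightarrow> difference (r, r \<bullet>\<bullet> b) = b"
  unfolding bundle_difference_def prod.case
proof (rule the_equality)
  show "b' = b" if "r \<in> points T" "b \<in> carrier B" "b' \<in> carrier B \<and> r \<bullet>\<bullet> b' = r \<bullet>\<bullet> b" for b'
    using act_free[OF that(1), of b' b] that by blast
qed simp

lemma difference_triv:
  assumes "trivialisation U e k" "r \<in> points T" "r' \<in> points T" "proj E r = proj E r'" "proj E r \<in> U"
  shows "difference (r, r') = inv (k r) \<otimes> k r'"
  using difference_act[OF assms(2) triv_quotient(1)[OF assms]] triv_quotient(2)[OF assms] by simp

lemma difference_carrier:
  assumes "r \<in> points T" "r' \<in> points T" "proj E r = proj E r'"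
  shows "difference (r, r') \<in> carrier B" and act_difference: "r \<bullet>\<bullet> difference (r, r') = r'"
proof -
  obtain U e k where t: "proj E r \<in> U" "trivialisation U e k"
    using ex_trivialisation[OF proj_point[OF assms(1)]] by blast
  show "difference (r, r') \<in> carrier B" "r \<bullet>\<bullet> difference (r, r') = r'"
    using triv_quotient[OF t(2) assms t(1)] difference_triv[OF t(2) assms t(1)] by simp_all
qed

text \<open>
  In a trivialisation the difference of two points in a fibre is a quotient of fibre coordinates.
\<close>

lemma psmooth_difference:
  assumes \<phi>: "psmooth S T \<phi>" and \<eta>: "psmooth S T \<eta>"
    and eq: "\<And>x. x \<in> S \<Longrightarrow> proj E (\<phi> x) = proj E (\<eta> x)"
  shows "psmooth S (mfd_of B) (\<lambda>x. difference (\<phi> x, \<eta> x))"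
proof (rule psmooth_local[OF psmooth_open[OF \<phi>]])
  fix x assume x: "x \<in> S"
  obtain U e k where t: "proj E (\<phi> x) \<in> U" "trivialisation U e k"
    using ex_trivialisation[OF proj_point[OF psmooth_points[OF \<phi> x]]] by blast
  let ?W = "{y \<in> S. proj E (\<phi> y) \<in> U}"
  have W: "open ?W"
    by (rule psmooth_open_preimage[OF psmooth_proj[OF \<phi>] triv_open(1)[OF t(2)]])
  have "psmooth ?W (mfd_of B) (\<lambda>y. inv (k (\<phi> y)) \<otimes> k (\<eta> y))"
    by (intro B.psmooth_mult B.psmooth_inv psmooth_coord[OF t(2)] psmooth_subset[OF \<phi>] 
        psmooth_subset[OF \<eta>] W) (use eq in auto)
  then have "psmooth ?W (mfd_of B) (\<lambda>x. difference (\<phi> x, \<eta> x))"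
    by (rule psmooth_cong[OF B.charted])
      (use difference_triv[OF t(2)] psmooth_points[OF \<phi>] psmooth_points[OF \<eta>] eq in auto)
  moreover have "S \<inter> ?W = ?W" by auto
  ultimately show "\<exists>W. open W \<and> x \<in> W \<and> psmooth (S \<inter> W) (mfd_of B) (\<lambda>x. difference (\<phi> x, \<eta> x))"
    using W x t(1) by (intro exI[of _ ?W]) simp
qed

text \<open>
  The derivative of the equation \<open>r\<^sub>2 = r\<^sub>1 \<bullet> \<psi>(r\<^sub>1, r\<^sub>2)\<close> in the fibre square. A connection applied
  to it gives the compatibility condition; with a local section as first point it describes the
  vertical vectors.
\<close>

lemma vel_difference:
  assumes \<phi>: "psmooth S T \<phi>" and \<eta>: "psmooth S T \<eta>"
    and eq: "\<And>x. x \<in> S \<Longrightarrow> proj E (\<phi> x) = proj E (\<eta> x)" and x: "x \<in> S"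
  shows "vel T \<eta> x v = dact (difference (\<phi> x, \<eta> x)) (\<phi> x) (vel T \<phi> x v) +
    fund (maurer_cartan B (difference (\<phi> x, \<eta> x))
      (vel (mfd_of B) (\<lambda>x. difference (\<phi> x, \<eta> x)) x v)) (\<eta> x)"
proof -
  have a: "\<phi> y \<bullet>\<bullet> difference (\<phi> y, \<eta> y) = \<eta> y" if "y \<in> S" for y
    using act_difference psmooth_points[OF \<phi> that] psmooth_points[OF \<eta> that] eq[OF that] by blast
  have "vel T \<eta> x = vel T (\<lambda>y. \<phi> y \<bullet>\<bullet> difference (\<phi> y, \<eta> y)) x"
    using a by (intro vel_cong[OF psmooth_open[OF \<phi>] x]) simp
  then show ?thesis
    using vel_act[OF \<phi> psmooth_difference[OF \<phi> \<eta> eq] x, of v] a[OF x] by simp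
qed

text \<open>
  A parametrisation with velocity \<open>u\<close> is compared with the local section over the same base point.
  The section does not move to first order, so only the fundamental vector remains in the derivative
  of the difference.
\<close>

lemma vertical_fundamental:
  assumes r: "r \<in> points T" and u: "differential T X (proj E) r u = 0"
  shows "\<exists>\<xi>. u = fund \<xi> r"
proof -
  obtain S \<phi> x where \<phi>: "psmooth S T \<phi>" "x \<in> S" "\<phi> x = r" and vel: "vel T \<phi> x u = u"
    using tangent_vector_vel[OF smooth_atlas_total r] by metis
  obtain U e k where t: "proj E r \<in> U" "trivialisation U e k"
    using ex_trivialisation[OF proj_point[OF r]] by blast
  let ?W = "{y \<in> S. proj E (\<phi> y) \<in> U}"
  have W: "open ?W" "x \<in> ?W"
    using \<phi> t psmooth_open_preimage[OF psmooth_proj[OF \<phi>(1)] triv_open(1)[OF t(2)]] by auto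
  have \<phi>W: "psmooth ?W T \<phi>" by (rule psmooth_subset[OF \<phi>(1) _ W(1)]) auto
  let ?s = "\<lambda>y. e (proj E (\<phi> y))"
  have s: "psmooth ?W T ?s"
    by (rule psmooth_section[OF t(2) psmooth_proj[OF \<phi>W]]) simp
  have 0: "vel X (\<lambda>y. proj E (\<phi> y)) x u = 0"
    using vel_smooth_map[OF charted_total charted_base smooth_proj \<phi>(1,2)] u vel \<phi>(3) by simp
  have "vel T ?s x u = 0"
    by (rule vel_zero_open_sub[OF smooth_atlas_base charted_total triv_open(1)[OF t(2)]
          triv_smooth_section[OF t(2)] psmooth_proj[OF \<phi>(1)] \<phi>(2) _ 0]) (use W in auto)
  moreover have "vel T \<phi> x u = dact (difference (?s x, \<phi> x)) (?s x) (vel T ?s x u) +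
    fund (maurer_cartan B (difference (?s x, \<phi> x))
      (vel (mfd_of B) (\<lambda>x. difference (?s x, \<phi> x)) x u)) (\<phi> x)"
    by (rule vel_difference[OF s \<phi>W _ W(2)]) (simp add: triv_section[OF t(2)])
  moreover have "dact (difference (?s x, \<phi> x)) (?s x) 0 = 0"
  proof (rule linear_0, rule linear_differential[OF charted_total charted_total smooth_translation])
    show "difference (?s x, \<phi> x) \<in> carrier B" "?s x \<in> points T"
      using W(2) psmooth_points[OF \<phi>(1,2)] triv_section[OF t(2)]
      by (auto intro!: difference_carrier)
  qed
  ultimately show ?thesis using vel \<phi>(3) by auto
qed

text \<open>
  Up to a left translation the fibre coordinate is a left inverse of the orbit map.
\<close>

lemma fund_injective:
  assumes r: "r \<in> points T" and 0: "fund \<xi> r = 0"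
  shows "\<xi> = 0"
proof -
  obtain U e k where t: "proj E r \<in> U" "trivialisation U e k"
    using ex_trivialisation[OF proj_point[OF r]] by blast
  define c where "c = chart_at (mfd_of B) \<one>"
  note c = chart_at_props[OF B.charted B.one_point, folded c_def]
  let ?S = "snd c ` fst c"
  have \<eta>: "psmooth ?S (mfd_of B) (chart_inv c)"
    by (rule psmooth_chart_inv[OF B.smooth_atlas c(1)])
  have x: "snd c \<one> \<in> ?S" using c by auto
  have 1: "chart_inv c (snd c \<one>) = \<one>" by (rule chart_inv_left[OF c(3,2)])
  note cc = B.psmooth_carrier[OF \<eta>]
  have o: "psmooth ?S T (\<lambda>y. r \<bullet>\<bullet> chart_inv c y)"
    by (rule psmooth_act[OF psmooth_const[OF charted_total r psmooth_open[OF \<eta>]] \<eta>])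
  have 0: "vel T (\<lambda>y. r \<bullet>\<bullet> chart_inv c y) (snd c \<one>) \<xi> = 0"
    using fund_vel[OF \<eta> x 1 r, of \<xi>] 0 vel_chart_inv[OF B.charted B.one_point, of \<xi>] by (simp add: c_def)
  have "vel (mfd_of B) (\<lambda>y. k (r \<bullet>\<bullet> chart_inv c y)) (snd c \<one>) \<xi> = 0"
    by (rule vel_zero_open_sub[OF smooth_atlas_total B.charted triv_open(2)[OF t(2)]
          triv_smooth_coord[OF t(2)] o x _ 0])
      (use 1 r t(1) in \<open>simp add: act_one\<close>)
  moreover have "vel (mfd_of B) (\<lambda>y. inv (k r) \<otimes> k (r \<bullet>\<bullet> chart_inv c y)) (snd c \<one>) \<xi> =
    differential (mfd_of B) (mfd_of B) (\<lambda>g. inv (k r) \<otimes> g) (k (r \<bullet>\<bullet> chart_inv c (snd c \<one>)))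
     (vel (mfd_of B) (\<lambda>y. k (r \<bullet>\<bullet> chart_inv c y)) (snd c \<one>) \<xi>)"
    by (rule vel_smooth_map[OF B.charted B.charted B.smooth_left_mult 
          psmooth_coord[OF t(2) o] x]) 
      (use triv_coord(1)[OF t(2) r t(1)] t r cc proj_act in auto)
  moreover have "differential (mfd_of B) (mfd_of B) (\<lambda>g. inv (k r) \<otimes> g) (k (r \<bullet>\<bullet> chart_inv c (snd c \<one>))) 0 = 0"
    by (rule linear_0, rule linear_differential[OF B.charted B.charted B.smooth_left_mult])
      (use triv_coord(1)[OF t(2) r t(1)] r 1 in \<open>auto simp: act_one B.points\<close>)
  moreover have "vel (mfd_of B) (\<lambda>y. inv (k r) \<otimes> k (r \<bullet>\<bullet> chart_inv c y)) (snd c \<one>) =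
      vel (mfd_of B) (chart_inv c) (snd c \<one>)"
    using triv_coord(1,3)[OF t(2) r t(1)] cc
    by (intro vel_cong[OF psmooth_open[OF \<eta>] x]) (simp add: B.m_assoc[symmetric] del: B.m_assoc)
  ultimately show ?thesis
    using vel_chart_inv[OF B.charted B.one_point, of \<xi>] by (simp add: c_def)
qed

end

section \<open>Injective homomorphisms of Lie groups are immersions\<close>

text \<open>
  The mean value inequality for \<open>f - f'(z\<^sub>0)\<close>, whose derivative is small near \<open>z\<^sub>0\<close>. The operator
  norm is controlled by the values on an orthonormal basis, which are continuous by smoothness.
\<close>

lemma smooth_on_strict_derivative:
  fixes f :: "'e::model_space \<Rightarrow> 'v::real_normed_vector"
  assumes S: "open S" "z0 \<in> S" and f: "smooth_on S f" and "\<epsilon> > 0"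
  shows "\<exists>\<delta>>0. ball z0 \<delta> \<subseteq> S \<and> (\<forall>z\<in>ball z0 \<delta>. \<forall>z'\<in>ball z0 \<delta>.
    norm (f z - f z' - frechet_derivative f (at z0) (z - z')) \<le> \<epsilon> * norm (z - z'))"
proof -
  let ?D = "\<lambda>z. frechet_derivative f (at z)"
  let ?s = "\<lambda>z. \<Sum>u\<in>onb. norm (?D z u - ?D z0 u)"
  have D: "(f has_derivative ?D z) (at z)" if "z \<in> S" for z
    by (rule smooth_on_has_derivative[OF f that])
  have lin: "linear (?D z)" if "z \<in> S" for z
    using has_derivative_linear[OF D[OF that]] .
  have "continuous_on S ?s"
    by (intro continuous_intros smooth_on_continuous[OF smooth_on_derivative[OF f]])
  then have "open (S \<inter> ?s -` {..<\<epsilon>})"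
    by (rule continuous_open_preimage[OF _ S(1)]) simp
  moreover have "z0 \<in> S \<inter> ?s -` {..<\<epsilon>}"
    using S(2) \<open>\<epsilon> > 0\<close> by simp
  ultimately obtain \<delta> where \<delta>: "\<delta> > 0" "ball z0 \<delta> \<subseteq> S \<inter> ?s -` {..<\<epsilon>}"
    using open_contains_ball by blast
  have "norm ((f z - ?D z0 z) - (f z' - ?D z0 z')) \<le> \<epsilon> * norm (z - z')"
    if "z \<in> ball z0 \<delta>" "z' \<in> ball z0 \<delta>" for z z'
  proof (rule differentiable_bound[OF convex_ball _ _ that,
        where f' = "\<lambda>y w. ?D y w - ?D z0 w"])
    fix y assume y: "y \<in> ball z0 \<delta>"
    then have yS: "y \<in> S" "?s y < \<epsilon>" using \<delta> by auto
    have "bounded_linear (?D z0)"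
      by (rule has_derivative_bounded_linear[OF D[OF S(2)]])
    then have "((\<lambda>z. f z - ?D z0 z) has_derivative (\<lambda>w. ?D y w - ?D z0 w)) (at y)"
      by (intro has_derivative_diff D yS bounded_linear_imp_has_derivative)
    then show "((\<lambda>z. f z - ?D z0 z) has_derivative (\<lambda>w. ?D y w - ?D z0 w)) (at y within ball z0 \<delta>)"
      by (rule has_derivative_at_withinI)
    have l: "linear (\<lambda>w. ?D y w - ?D z0 w)"
      using lin[OF yS(1)] lin[OF S(2)] by (intro linear_compose_sub)
    show "onorm (\<lambda>w. ?D y w - ?D z0 w) \<le> \<epsilon>"
    proof (rule onorm_bound)
      show "0 \<le> \<epsilon>" using \<open>\<epsilon> > 0\<close> by simp
      fix w
      have "norm (?D y w - ?D z0 w) \<le> norm w * ?s y"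
        using linear_bounded_model[OF l] .
      also have "\<dots> \<le> norm w * \<epsilon>"
        using yS(2) by (intro mult_left_mono) auto
      finally show "norm (?D y w - ?D z0 w) \<le> \<epsilon> * norm w" by (simp add: mult.commute)
    qed
  qed
  moreover have "(f z - ?D z0 z) - (f z' - ?D z0 z') = f z - f z' - ?D z0 (z - z')" for z z'
    using linear_diff[OF lin[OF S(2)]] by simp
  ultimately show ?thesis using \<delta> by (intro exI[of _ \<delta>]) auto
qed

context lie begin

text \<open>
  In the chart at the identity, right multiplication by a small element is close to a translation,
  with an error that is small relative to the length of the translation.
\<close>

lemma mult_almost_translation:
  defines "c \<equiv> chart_at (mfd_of G) \<one>"
  assumes "\<epsilon> > 0"
  shows "\<exists>\<delta>>0. \<forall>g\<in>fst c. \<forall>h\<in>fst c. dist (snd c \<one>) (snd c g) < \<delta> \<longrightarrow> dist (snd c \<one>) (snd c h) < \<delta> \<longrightarrow>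
    g \<otimes> h \<in> fst c \<and>
    norm (snd c (g \<otimes> h) - snd c g - (snd c h - snd c \<one>)) \<le> \<epsilon> * norm (snd c h - snd c \<one>)"
proof -
  note c = chart_at_props[OF charted one_point, folded c_def]
  let ?I = "snd c ` fst c" and ?x = "snd c \<one>"
  have I: "open ?I" by (rule chart_open_image[OF c(3)])
  have II: "open (?I \<times> ?I)" using I by (simp add: open_Times)
  note ci = psmooth_chart_inv[OF smooth_atlas c(1)]
  let ?m = "\<lambda>z. chart_inv c (fst z) \<otimes> chart_inv c (snd z)"
  have m: "psmooth (?I \<times> ?I) (mfd_of G) ?m"
    by (intro psmooth_mult psmooth_reparam[OF charted ci] II smooth_on_fst smooth_on_snd smooth_on_id) auto
  let ?V = "{z \<in> ?I \<times> ?I. ?m z \<in> fst c}"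
  have V: "open ?V" by (rule psmooth_open_chart[OF charted m c(1)])
  have x1: "chart_inv c ?x = \<one>" by (rule chart_inv_left[OF c(3,2)])
  have xV: "(?x, ?x) \<in> ?V" using c(2) x1 by simp
  have sm: "smooth_on ?V (snd c \<circ> ?m)" by (rule psmooth_smooth_on[OF m c(1)])
  let ?D = "frechet_derivative (snd c \<circ> ?m) (at (?x, ?x))"
  have D2: "?D (0, w) = w" for w
  proof -
    have "((\<lambda>y. (snd c \<circ> ?m) (?x, y)) has_derivative (\<lambda>w. ?D (0, w))) (at ?x)"
      by (rule has_derivative_compose[where f = "\<lambda>y. (?x, y)" and f' = "\<lambda>w. (0, w)",
            OF _ smooth_on_has_derivative[OF sm xV]]) (auto intro!: has_derivative_Pair)
    moreover have "((\<lambda>y. (snd c \<circ> ?m) (?x, y)) has_derivative (\<lambda>w. w)) (at ?x)"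
    proof (rule has_derivative_transform_within_open[OF has_derivative_ident I])
      fix y assume "y \<in> ?I"
      then show "y = (snd c \<circ> ?m) (?x, y)"
        using psmooth_carrier[OF ci] by (auto simp: x1 chart_inv_right)
    qed (use c in auto)
    ultimately have "(\<lambda>w. ?D (0, w)) = (\<lambda>w. w)" by (rule has_derivative_unique)
    then show ?thesis by (rule fun_cong)
  qed
  obtain \<delta> where \<delta>: "\<delta> > 0" "ball (?x, ?x) \<delta> \<subseteq> ?V"
    and est: "\<And>z z'. z \<in> ball (?x, ?x) \<delta> \<Longrightarrow> z' \<in> ball (?x, ?x) \<delta> \<Longrightarrow>
      norm ((snd c \<circ> ?m) z - (snd c \<circ> ?m) z' - ?D (z - z')) \<le> \<epsilon> * norm (z - z')"
    using smooth_on_strict_derivative[OF V xV sm assms(2)] by blast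
  show ?thesis
  proof (intro exI[of _ "\<delta> / 2"] conjI ballI impI)
    show "\<delta> / 2 > 0" using \<delta> by simp
    fix g h assume gh: "g \<in> fst c" "h \<in> fst c"
      "dist ?x (snd c g) < \<delta> / 2" "dist ?x (snd c h) < \<delta> / 2"
    have "dist (?x, ?x) (snd c g, snd c h) \<le> dist ?x (snd c g) + dist ?x (snd c h)"
      using norm_Pair_le[of "?x - snd c g" "?x - snd c h"] by (simp add: dist_norm)
    then have z: "(snd c g, snd c h) \<in> ball (?x, ?x) \<delta>" using gh by simp
    have z': "(snd c g, ?x) \<in> ball (?x, ?x) \<delta>"
      using gh \<delta>(1) by (simp add: dist_Pair_Pair)
    have ci': "chart_inv c (snd c g) = g" "chart_inv c (snd c h) = h"
      using gh by (simp_all add: chart_inv_left[OF c(3)])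
    have "fst c \<subseteq> carrier G"
      using openin_subset[OF chart_open[OF c(3)]] by (simp add: points)
    then have gc: "g \<in> carrier G" using gh by blast
    show "g \<otimes> h \<in> fst c" using z \<delta>(2) ci' by auto
    show "norm (snd c (g \<otimes> h) - snd c g - (snd c h - snd c \<one>)) \<le> \<epsilon> * norm (snd c h - snd c \<one>)"
      using est[OF z z'] gc by (simp add: ci' x1 D2 norm_Pair)
  qed
qed

end

text \<open>
  Suppose the differential at the identity kills \<open>\<xi> \<noteq> 0\<close>. Take \<open>a\<close> with coordinates \<open>h \<xi>\<close> for a
  tiny \<open>h\<close>. The powers of \<open>a\<close> march away from the identity at almost constant speed, so some power
  lands in a fixed compact shell around the identity. The powers of the image of \<open>a\<close> move at speed
  \<open>o(h)\<close> and hence remain arbitrarily close to the identity, whereas injectivity keeps the image of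
  the shell at a positive distance from it. This avoids the exponential map and the constant rank
  theorem.
\<close>

lemma injective_hom_immersion:
  fixes A :: "('a, 'ea::model_space) lie_grp" and B :: "('b, 'eb::model_space) lie_grp"
  assumes A: "lie A" and B: "lie B" and hom: "lie_hom A B \<alpha>" and inj: "inj_on \<alpha> (carrier A)"
    and zero: "lie_algebra_map A B \<alpha> \<xi> = 0"
  shows "\<xi> = 0"
proof (rule ccontr)
  assume \<xi>: "\<xi> \<noteq> 0"
  interpret A: lie A by fact
  interpret B: lie B by fact
  have h: "\<alpha> \<in> hom A B" and sm: "smooth_map (mfd_of A) (mfd_of B) \<alpha>"
    using hom by (auto simp: lie_hom_def)
  have one: "\<alpha> \<one>\<^bsub>A\<^esub> = \<one>\<^bsub>B\<^esub>"
    by (rule hom_one[OF h A.is_group B.is_group])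
  define c d where "c = chart_at (mfd_of A) \<one>\<^bsub>A\<^esub>" and "d = chart_at (mfd_of B) \<one>\<^bsub>B\<^esub>"
  note c = chart_at_props[OF A.charted A.one_point, folded c_def]
  note d = chart_at_props[OF B.charted B.one_point, folded d_def]
  define x0 y0 where "x0 = snd c \<one>\<^bsub>A\<^esub>" and "y0 = snd d \<one>\<^bsub>B\<^esub>"
  define f where "f = (\<lambda>x. snd d (\<alpha> (chart_inv c x)))"
  have x01: "chart_inv c x0 = \<one>\<^bsub>A\<^esub>" unfolding x0_def by (rule chart_inv_left[OF c(3,2)])
  have fx0: "f x0 = y0" by (simp add: f_def x01 one y0_def)
  let ?I = "snd c ` fst c"
  note pA = psmooth_of_smooth_map[OF A.charted sm c(1)]
  let ?V = "{x \<in> ?I. \<alpha> (chart_inv c x) \<in> fst d}"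
  have V: "open ?V" by (rule psmooth_open_chart[OF B.charted pA d(1)])
  have x0V: "x0 \<in> ?V" using c d by (simp add: x01 one) (simp add: x0_def)
  have smf: "smooth_on ?V f"
    using psmooth_smooth_on[OF pA d(1)] by (simp add: f_def comp_def)
  have "frechet_derivative f (at x0) = lie_algebra_map A B \<alpha>"
    by (simp add: lie_algebra_map_def differential_def one c_def[symmetric] d_def[symmetric] f_def x0_def comp_def)
  then have df: "(f has_derivative lie_algebra_map A B \<alpha>) (at x0)"
    using smooth_on_has_derivative[OF smf x0V] by simp
  obtain \<delta>A where \<delta>A: "\<delta>A > 0" and mA: "\<And>g h. g \<in> fst c \<Longrightarrow> h \<in> fst c \<Longrightarrow> dist x0 (snd c g) < \<delta>A \<Longrightarrow>
    dist x0 (snd c h) < \<delta>A \<Longrightarrow> g \<otimes>\<^bsub>A\<^esub> h \<in> fst c \<and>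
    norm (snd c (g \<otimes>\<^bsub>A\<^esub> h) - snd c g - (snd c h - x0)) \<le> 1/2 * norm (snd c h - x0)"
    using A.mult_almost_translation[of "1/2"] unfolding c_def[symmetric] x0_def[symmetric] by force
  obtain \<delta>B where \<delta>B: "\<delta>B > 0" and mB: "\<And>g h. g \<in> fst d \<Longrightarrow> h \<in> fst d \<Longrightarrow> dist y0 (snd d g) < \<delta>B \<Longrightarrow>
    dist y0 (snd d h) < \<delta>B \<Longrightarrow> g \<otimes>\<^bsub>B\<^esub> h \<in> fst d \<and>
    norm (snd d (g \<otimes>\<^bsub>B\<^esub> h) - snd d g - (snd d h - y0)) \<le> 1 * norm (snd d h - y0)"
    using B.mult_almost_translation[of 1] unfolding d_def[symmetric] y0_def[symmetric] by force
  obtain r' where r': "r' > 0" "cball x0 r' \<subseteq> ?V"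
    using V x0V open_contains_cball by blast
  define r where "r = min r' (\<delta>A / 2)"
  have r: "r > 0" "r < \<delta>A" "cball x0 r \<subseteq> ?V"
    using r' \<delta>A by (auto simp: r_def)
  \<comment> \<open>The power of \<open>a\<close> constructed below has distance between \<open>r / 6\<close> and \<open>r\<close> from the identity.\<close>
  define K where "K = cball x0 r - ball x0 (r / 6)"
  have "compact K" unfolding K_def by (rule compact_diff[OF compact_cball_model open_ball])
  moreover have KV: "K \<subseteq> ?V" using r(3) by (auto simp: K_def)
  then have "continuous_on K (\<lambda>x. norm (f x - y0))"
    by (intro continuous_intros continuous_on_subset[OF smooth_on_continuous[OF smf]])
  moreover have "norm (f x - y0) > 0" if x: "x \<in> K" for x
  proof -
    have xV: "x \<in> ?I" "\<alpha> (chart_inv c x) \<in> fst d" using KV x by auto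
    have "chart_inv c x \<in> carrier A"
      using A.psmooth_carrier[OF psmooth_chart_inv[OF A.smooth_atlas c(1)] xV(1)] .
    moreover have "x \<noteq> x0" using x r(1) by (auto simp: K_def)
    then have "chart_inv c x \<noteq> \<one>\<^bsub>A\<^esub>"
      using chart_inv_right[OF xV(1)] by (auto simp: x0_def)
    ultimately have "\<alpha> (chart_inv c x) \<noteq> \<one>\<^bsub>B\<^esub>"
      using inj one by (metis A.one_closed inj_onD)
    then have "f x \<noteq> y0"
      using chart_inj[OF d(3)] xV(2) d(2) by (auto simp: f_def y0_def inj_on_def)
    then show ?thesis by simp
  qed
  ultimately have "\<exists>\<mu>>0. \<forall>x\<in>K. \<mu> \<le> norm (f x - y0)"
    using continuous_attains_inf[of K "\<lambda>x. norm (f x - y0)"]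
    by (cases "K = {}") (blast intro: zero_less_one)+
  then obtain \<mu> where \<mu>: "\<mu> > 0" "\<And>x. x \<in> K \<Longrightarrow> \<mu> \<le> norm (f x - y0)"
    by blast
  define L \<eta> where "L = norm \<xi>" and "\<eta> = min \<delta>B \<mu> / (2 * r)"
  have L: "L > 0" using \<xi> by (simp add: L_def)
  have \<eta>: "\<eta> > 0" using \<delta>B \<mu> r by (simp add: \<eta>_def)
  obtain e where e: "e > 0" "\<And>y. norm (y - x0) < e \<Longrightarrow>
      norm (f y - f x0 - lie_algebra_map A B \<alpha> (y - x0)) \<le> \<eta> * norm (y - x0)"
    using df \<eta> unfolding has_derivative_at_alt by blast
  \<comment> \<open>The bound \<open>h * L < e\<close> makes the first-order estimate apply to \<open>a\<close>, and \<open>h * L \<le> r / 3\<close> makes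
    the number \<open>N\<close> of steps satisfy \<open>r / 3 \<le> N * (h * L) \<le> 2 * r / 3\<close> in spite of the rounding.\<close>
  define h where "h = min (e / 2) (r / 3) / L"
  have hL: "h * L \<le> e / 2" "h * L \<le> r / 3" "h * L > 0" "h > 0"
    using L e r by (simp_all add: h_def)
  define x1 where "x1 = x0 + h *\<^sub>R \<xi>"
  have x1: "norm (x1 - x0) = h * L" using hL by (simp add: x1_def L_def)
  have "x1 \<in> cball x0 r"
    using x1 hL r by (simp add: dist_norm norm_minus_commute)
  then have x1V: "x1 \<in> ?V" using r(3) by blast
  define a where "a = chart_inv c x1"
  have a: "a \<in> fst c" "snd c a = x1" "\<alpha> a \<in> fst d" "snd d (\<alpha> a) = f x1"
    using x1V by (auto simp: a_def f_def chart_inv_left[OF c(3)])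
  have cA: "fst c \<subseteq> carrier A" using openin_subset[OF chart_open[OF c(3)]] by (simp add: A.points)
  then have aA: "a \<in> carrier A" using a(1) by blast
  have "norm (f x1 - f x0 - lie_algebra_map A B \<alpha> (x1 - x0)) \<le> \<eta> * norm (x1 - x0)"
    using hL e(1) by (intro e(2)) (simp add: x1)
  moreover have "lie_algebra_map A B \<alpha> (x1 - x0) = 0"
    using linear_scale[OF has_derivative_linear[OF df]] zero by (simp add: x1_def)
  ultimately have b: "norm (f x1 - y0) \<le> \<eta> * (h * L)"
    by (simp add: fx0 x1)
  define N where "N = nat \<lfloor>2 * r / (3 * (h * L))\<rfloor>"
  have N1: "real N \<le> 2 * r / (3 * (h * L))"
    using hL r by (simp add: N_def)
  have N2: "2 * r / (3 * (h * L)) < real N + 1"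
    using hL r unfolding N_def by linarith
  have Nu: "real N * (h * L) \<le> 2 * r / 3"
  proof -
    have "real N * (3 * (h * L)) \<le> 2 * r"
      using N1 pos_le_divide_eq[of "3 * (h * L)" "real N" "2 * r"] hL(3) by simp
    then show ?thesis by simp
  qed
  have Nl: "real N * (h * L) \<ge> r / 3"
  proof -
    have "2 * r / 3 < (real N + 1) * (h * L)"
    proof -
      have "2 * r < (real N + 1) * (3 * (h * L))"
        using N2 pos_divide_less_eq[of "3 * (h * L)" "2 * r" "real N + 1"] hL(3) by simp
      then show ?thesis by simp
    qed
    then show ?thesis using hL(2) by (simp add: algebra_simps)
  qed
  have \<eta>r: "\<eta> * r = min \<delta>B \<mu> / 2" using r by (simp add: \<eta>_def)
  have small: "2 * (real k * norm (f x1 - y0)) < min \<delta>B \<mu>" if "k \<le> N" for k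
  proof -
    have "real k * norm (f x1 - y0) \<le> real N * (\<eta> * (h * L))"
      using that b by (intro mult_mono) auto
    also have "\<dots> = \<eta> * (real N * (h * L))" by simp
    also have "\<dots> \<le> \<eta> * (2 * r / 3)" using Nu \<eta> by (intro mult_left_mono) auto
    also have "\<dots> = min \<delta>B \<mu> / 3" using \<eta>r by (simp add: field_simps)
    finally show ?thesis using \<delta>B \<mu> by linarith
  qed
  have b': "norm (f x1 - y0) < \<delta>B"
  proof -
    have "\<eta> * (h * L) \<le> \<eta> * (r / 3)" using hL \<eta> by (intro mult_left_mono) auto
    then show ?thesis using b \<eta>r \<delta>B \<mu> by linarith
  qed
  let ?p = "\<lambda>k::nat. a [^]\<^bsub>A\<^esub> k"
  have pows: "?p k \<in> fst c \<and> norm (snd c (?p k) - x0 - (real k * h) *\<^sub>R \<xi>) \<le> 1/2 * (real k * (h * L)) \<and>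
      norm (snd d (\<alpha> (?p k)) - y0) \<le> 2 * (real k * norm (f x1 - y0))"
    if "k \<le> N" for k
    using that
  proof (induction k)
    case 0
    then show ?case using c(2) by (simp add: one x0_def y0_def)
  next
    case (Suc k)
    let ?x = "snd c (?p k)" and ?y = "snd d (\<alpha> (?p k))"
    have IH: "?p k \<in> fst c" "norm (?x - x0 - (real k * h) *\<^sub>R \<xi>) \<le> 1/2 * (real k * (h * L))"
      "norm (?y - y0) \<le> 2 * (real k * norm (f x1 - y0))"
      using Suc by auto
    have kN: "real k * (h * L) \<le> 2 * r / 3"
    proof -
      have "real k * (h * L) \<le> real N * (h * L)"
        using Suc.prems hL(3) by (intro mult_right_mono) auto
      then show ?thesis using Nu by linarith
    qed
    have "norm (?x - x0) \<le> norm (?x - x0 - (real k * h) *\<^sub>R \<xi>) + norm ((real k * h) *\<^sub>R \<xi>)"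
      using norm_triangle_sub[of "?x - x0" "(real k * h) *\<^sub>R \<xi>"] by simp
    also have "norm ((real k * h) *\<^sub>R \<xi>) = real k * (h * L)"
      using hL by (simp add: L_def)
    finally have xr: "norm (?x - x0) \<le> r" using IH(2) kN by linarith
    then have "?x \<in> ?V" using r(3) by (auto simp: dist_norm norm_minus_commute)
    then have \<alpha>k: "\<alpha> (?p k) \<in> fst d" using chart_inv_left[OF c(3) IH(1)] by simp
    have A': "?p k \<otimes>\<^bsub>A\<^esub> a \<in> fst c \<and>
        norm (snd c (?p k \<otimes>\<^bsub>A\<^esub> a) - ?x - (snd c a - x0)) \<le> 1/2 * norm (snd c a - x0)"
      using xr r x1 a hL by (intro mA IH(1)) (auto simp: dist_norm norm_minus_commute)
    have B': "\<alpha> (?p k) \<otimes>\<^bsub>B\<^esub> \<alpha> a \<in> fst d \<and>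
        norm (snd d (\<alpha> (?p k) \<otimes>\<^bsub>B\<^esub> \<alpha> a) - ?y - (snd d (\<alpha> a) - y0)) \<le> 1 * norm (snd d (\<alpha> a) - y0)"
      using small[of k] Suc.prems IH(3) b' a
      by (intro mB \<alpha>k) (auto simp: dist_norm norm_minus_commute)
    have "\<alpha> (?p (Suc k)) = \<alpha> (?p k) \<otimes>\<^bsub>B\<^esub> \<alpha> a"
      using aA hom_mult[OF h] by simp
    then have "norm (snd d (\<alpha> (?p (Suc k))) - y0) \<le>
        norm (snd d (\<alpha> (?p k) \<otimes>\<^bsub>B\<^esub> \<alpha> a) - ?y - (f x1 - y0)) + norm (f x1 - y0) + norm (?y - y0)"
      using norm_triangle_le[OF order_refl, of
          "snd d (\<alpha> (?p k) \<otimes>\<^bsub>B\<^esub> \<alpha> a) - ?y - (f x1 - y0)" "(f x1 - y0) + (?y - y0)"]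
        norm_triangle_ineq[of "f x1 - y0" "?y - y0"] by (simp add: algebra_simps)
    then have y: "norm (snd d (\<alpha> (?p (Suc k))) - y0) \<le> 2 * (real (Suc k) * norm (f x1 - y0))"
      using B' IH(3) a(4) by (simp add: algebra_simps)
    have eq: "snd c (?p (Suc k)) - x0 - (real (Suc k) * h) *\<^sub>R \<xi> =
      (snd c (?p k \<otimes>\<^bsub>A\<^esub> a) - ?x - (snd c a - x0)) + (?x - x0 - (real k * h) *\<^sub>R \<xi>)"
      by (simp add: a x1_def algebra_simps)
    have "norm (snd c (?p (Suc k)) - x0 - (real (Suc k) * h) *\<^sub>R \<xi>) \<le>
        1/2 * (h * L) + 1/2 * (real k * (h * L))"
      unfolding eq by (rule norm_triangle_le, rule add_mono) (use A' IH(2) x1 a in auto)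
    with A' y show ?case by (simp add: algebra_simps)
  qed
  let ?x = "snd c (?p N)"
  note pN = pows[OF order_refl]
  have n: "norm ((real N * h) *\<^sub>R \<xi>) = real N * (h * L)" using hL by (simp add: L_def)
  have "norm (?x - x0) \<le> norm (?x - x0 - (real N * h) *\<^sub>R \<xi>) + norm ((real N * h) *\<^sub>R \<xi>)"
    using norm_triangle_sub[of "?x - x0" "(real N * h) *\<^sub>R \<xi>"] by simp
  then have "norm (?x - x0) \<le> r" using pN n Nu by linarith
  moreover have "norm ((real N * h) *\<^sub>R \<xi>) \<le> norm (?x - x0 - (real N * h) *\<^sub>R \<xi>) + norm (?x - x0)"
    using norm_triangle_sub[of "(real N * h) *\<^sub>R \<xi>" "?x - x0"] by (simp add: norm_minus_commute)
  then have "norm (?x - x0) \<ge> r / 6" using pN n Nl by linarith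
  ultimately have "?x \<in> K" by (auto simp: K_def dist_norm norm_minus_commute)
  then have "\<mu> \<le> norm (snd d (\<alpha> (?p N)) - y0)"
    using \<mu>(2)[of ?x] pN chart_inv_left[OF c(3), of "?p N"] by (simp add: f_def)
  then show False using pN small[of N] by simp
qed

section \<open>The fibre square\<close>

lemma submanifold_charts:
  assumes "c \<in> atlas (submanifold M S)"
  shows "is_chart (mtop (submanifold M S)) c" "smooth_map (open_sub model_mfd (snd c ` fst c)) M (chart_inv c)"
    "p \<in> fst c \<Longrightarrow> \<exists>W h. openin (mtop M) W \<and> p \<in> W \<and> smooth_map (open_sub M W) model_mfd h \<and>
      (\<forall>q\<in>W \<inter> fst c. h q = snd c q)"
  using assms by (simp_all add: submanifold_def)

context principal
begin

abbreviation F where "F \<equiv> fibre_square B E"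

text \<open>
  The point set as a separate constant: expressing the topology of \<open>F\<close> by \<open>points F\<close> would be
  circular as a rewrite rule.
\<close>

definition fibre_pairs :: "('r \<times> 'r) set"
  where "fibre_pairs = {(r1, r2). r1 \<in> points T \<and> r2 \<in> points T \<and> proj E r1 = proj E r2}"

lemma mtop_fibre_square: "mtop F = subtopology (mtop (prod_mfd T T)) fibre_pairs"
  by (simp add: fibre_pairs_def fibre_square_def submanifold_def)

lemma points_fibre_square: "points F = fibre_pairs"
  unfolding mtop_fibre_square by (auto simp: fibre_pairs_def points_prod_mfd)

lemmas charted_total_square = charted_prod[OF charted_total charted_total]

text \<open>
  A trivialisation of the bundle over \<open>U\<close> gives charts of the fibre square: over \<open>U\<close> the pair
  \<open>(r, r')\<close> is recorded by \<open>r\<close> and by the group element that carries \<open>r\<close> to \<open>r'\<close>. The latter extends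
  smoothly to all pairs over \<open>U\<close> as a quotient of fibre coordinates, so the chart is one of the
  embedded submanifold.
\<close>

lemma ex_fibre_square_chart:
  assumes p: "p \<in> fibre_pairs"
  shows "\<exists>c\<in>atlas F. p \<in> fst c"
proof -
  obtain p1 p2 where p12: "p = (p1, p2)" by (cases p)
  have pp: "p1 \<in> points T" "p2 \<in> points T" "proj E p1 = proj E p2"
    using p by (auto simp: p12 fibre_pairs_def)
  obtain U e k where t: "proj E p1 \<in> U" "trivialisation U e k"
    using ex_trivialisation[OF proj_point[OF pp(1)]] by blast
  define b0 where "b0 = inv (k p1) \<otimes> k p2"
  have b0: "b0 \<in> points (mfd_of B)"
    unfolding b0_def B.points by (rule triv_quotient[OF t(2) pp t(1)])
  define c d where "c = chart_at T p1" and "d = chart_at (mfd_of B) b0"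
  note c = chart_at_props[OF charted_total pp(1), folded c_def]
  note d = chart_at_props[OF B.charted b0, folded d_def]
  have cT: "fst c \<subseteq> points T" by (rule openin_subset[OF chart_open[OF c(3)]])
  have dB: "fst d \<subseteq> carrier B" using openin_subset[OF chart_open[OF d(3)]] by (simp add: B.points)
  define q where "q = (\<lambda>(r, r'). inv (k r) \<otimes> k r')"
  let ?V = "{r \<in> points T. proj E r \<in> U}"
  define D where "D = {(r, r') \<in> fibre_pairs. r \<in> fst c \<inter> ?V \<and> q (r, r') \<in> fst d}"
  define f where "f = (\<lambda>z. (snd c (fst z), snd d (q z)))"
  define g where "g = (\<lambda>w. (chart_inv c (fst w), chart_inv c (fst w) \<bullet>\<bullet> chart_inv d (snd w)))"
  note V = triv_open[OF t(2)]
  note r = is_chart_restrict[OF c(3) V(2)]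
  let ?I = "(snd c ` (fst c \<inter> ?V)) \<times> (snd d ` fst d)"
  have I: "open ?I"
    using chart_open_image[OF r] chart_open_image[OF d(3)] by (simp add: open_Times)
  \<comment> \<open>The inverse \<open>g\<close> recovers the second point by acting with the group element on the first.\<close>
  have f: "f z \<in> ?I" "g (f z) = z" if "z \<in> D" for z
  proof -
    obtain a b where z: "z = (a, b)" by (cases z)
    have ab: "a \<in> points T" "b \<in> points T" "proj E a = proj E b" "proj E a \<in> U" 
      "a \<in> fst c" "q (a, b) \<in> fst d"
      using that by (auto simp: D_def fibre_pairs_def z)
    then show "f z \<in> ?I" by (simp add: f_def z)
    have "a \<bullet>\<bullet> q (a, b) = b"
      using triv_quotient(2)[OF t(2) ab(1-4)] by (simp add: q_def)
    then show "g (f z) = z"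
      using ab by (simp add: g_def f_def z chart_inv_left[OF c(3)] chart_inv_left[OF d(3)])
  qed
  have g: "g w \<in> D" "f (g w) = w" if "w \<in> ?I" for w
  proof -
    from that obtain a b where w: "w = (snd c a, snd d b)" "a \<in> fst c" "a \<in> ?V" "b \<in> fst d" by auto
    have bB: "b \<in> carrier B" and aT: "a \<in> points T" "proj E a \<in> U" using w dB by auto
    have gw: "g w = (a, a \<bullet>\<bullet> b)"
      using w by (simp add: g_def chart_inv_left[OF c(3)] chart_inv_left[OF d(3)])
    have "q (a, a \<bullet>\<bullet> b) = b"
      using triv_coord(1,3)[OF t(2) aT] bB by (simp add: q_def B.m_assoc[symmetric] del: B.m_assoc)
    moreover have "(a, a \<bullet>\<bullet> b) \<in> fibre_pairs"
      using aT bB by (simp add: fibre_pairs_def proj_act act_point)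
    ultimately show "g w \<in> D" "f (g w) = w"
      unfolding gw using w(2-4) aT by (simp_all add: D_def f_def w(1))
  qed
  have fD: "f ` D = ?I"
  proof (intro equalityI subsetI)
    show "w \<in> f ` D" if "w \<in> ?I" for w
      by (rule image_eqI[of _ f "g w"]) (simp_all add: g[OF that])
  qed (use f(1) in blast)
  have inj: "inj_on f D" by (rule inj_on_inverseI[of _ g]) (rule f(2))
  have chart_inv_eq: "chart_inv (D, f) w = g w" if "w \<in> ?I" for w
    using inv_into_f_eq[OF inj g(1)[OF that] g(2)[OF that]] by (simp add: chart_inv_def)
  \<comment> \<open>The formula for \<open>f\<close> makes sense without the two points having the same projection; \<open>W\<close> is the
    open set of pairs obtained by dropping this condition from \<open>D\<close>.\<close>
  define W where "W = {z \<in> (fst c \<inter> ?V) \<times> ?V. q z \<in> fst d}"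
  let ?O = "(fst c \<inter> ?V) \<times> ?V"
  have O: "openin (mtop (prod_mfd T T)) ?O"
    using chart_open[OF c(3)] V(2) by (simp add: prod_mfd_def openin_prod_Times_iff openin_Int)
  have q_psmooth: "psmooth S (mfd_of B) (\<lambda>x. q (\<phi> x))"
    if \<phi>: "psmooth S (prod_mfd T T) \<phi>" "\<And>x. x \<in> S \<Longrightarrow> \<phi> x \<in> ?O" for S and \<phi> :: "'z::model_space \<Rightarrow> 'r \<times> 'r"
  proof -
    have "psmooth S (mfd_of B) (\<lambda>x. inv (k (fst (\<phi> x))) \<otimes> k (snd (\<phi> x)))"
      by (intro B.psmooth_mult B.psmooth_inv psmooth_coord[OF t(2)] 
          psmooth_fst[OF smooth_atlas_total smooth_atlas_total \<phi>(1)] psmooth_snd[OF smooth_atlas_total smooth_atlas_total \<phi>(1)])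
        (use \<phi>(2) in \<open>auto simp: mem_Times_iff\<close>)
    then show ?thesis by (simp add: q_def case_prod_unfold)
  qed
  note sTT = smooth_atlas_prod[OF smooth_atlas_total smooth_atlas_total]
  have "smooth_map (open_sub (prod_mfd T T) ?O) (mfd_of B) q"
    by (rule smooth_map_psmoothI[OF smooth_atlas_open_sub[OF sTT O]], rule q_psmooth)
      (auto simp: psmooth_open_sub[OF O])
  then have "continuous_map (subtopology (mtop (prod_mfd T T)) ?O) (mtop (mfd_of B)) q"
    by (simp add: smooth_map_def open_sub_def)
  from openin_continuous_map_preimage[OF this chart_open[OF d(3)]]
  have "openin (subtopology (mtop (prod_mfd T T)) ?O) W"
    using openin_subset[OF O] by (simp add: W_def inf_absorb2)
  then have W: "openin (mtop (prod_mfd T T)) W"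
    using O openin_trans_full by blast
  have f_psmooth: "psmooth S model_mfd (\<lambda>x. f (\<phi> x))"
    if \<phi>: "psmooth S (prod_mfd T T) \<phi>" "\<And>x. x \<in> S \<Longrightarrow> \<phi> x \<in> W" for S and \<phi> :: "'z::model_space \<Rightarrow> 'r \<times> 'r"
  proof -
    note 1 = psmooth_fst[OF smooth_atlas_total smooth_atlas_total \<phi>(1)]
    have 2: "psmooth S (mfd_of B) (\<lambda>x. q (\<phi> x))"
      by (rule q_psmooth[OF \<phi>(1)]) (use \<phi>(2) in \<open>auto simp: W_def\<close>)
    have "{x \<in> S. fst (\<phi> x) \<in> fst c} = S" "{x \<in> S. q (\<phi> x) \<in> fst d} = S"
      using \<phi>(2) by (auto simp: W_def mem_Times_iff)
    then show ?thesis
      using psmooth_smooth_on[OF 1 c(1)] psmooth_smooth_on[OF 2 d(1)] psmooth_open[OF 1]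
      by (auto simp: psmooth_model f_def comp_def intro!: smooth_on_Pair)
  qed
  have f_smooth: "smooth_map (open_sub (prod_mfd T T) W) model_mfd f"
    by (rule smooth_map_psmoothI[OF smooth_atlas_open_sub[OF sTT W]], rule f_psmooth)
      (auto simp: psmooth_open_sub[OF W])
  have DW: "D = fibre_pairs \<inter> W"
    by (auto simp: D_def W_def fibre_pairs_def)
  have Dsub: "D \<subseteq> points (prod_mfd T T)" by (auto simp: D_def fibre_pairs_def points_prod_mfd)
  have g_psmooth: "psmooth ?I (prod_mfd T T) g"
    unfolding g_def
    by (intro psmooth_Pair charted_total psmooth_act 
        psmooth_reparam[OF charted_total psmooth_chart_inv[OF smooth_atlas_total c(1)] I]
        psmooth_reparam[OF B.charted psmooth_chart_inv[OF B.smooth_atlas d(1)] I]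
        smooth_on_fst smooth_on_snd smooth_on_id I) auto
  have "(D, f) \<in> atlas F"
  proof -
    have "is_chart (mtop F) (D, f)"
      unfolding is_chart_def fst_conv snd_conv
    proof (intro conjI)
      show D: "openin (mtop F) D"
        unfolding mtop_fibre_square DW by (rule openin_subtopology_Int2[OF W])
      show "open (f ` D)" using I fD by simp
      have st: "subtopology (mtop F) D = subtopology (mtop (prod_mfd T T)) D"
        using DW by (simp add: mtop_fibre_square subtopology_subtopology inf_absorb2)
      have "continuous_map (subtopology (mtop (prod_mfd T T)) W) euclidean f"
        using f_smooth by (simp add: smooth_map_def open_sub_def model_mfd_def)
      then have "continuous_map (subtopology (mtop F) D) (top_of_set (f ` D)) f"
        unfolding st using DW 
        by (auto simp: continuous_map_in_subtopology intro: continuous_map_from_subtopology_mono)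
      moreover have "continuous_map (top_of_set (f ` D)) (subtopology (mtop F) D) g"
        unfolding st fD using psmooth_continuous[OF g_psmooth] g(1)
        by (auto simp: continuous_map_in_subtopology)
      ultimately have "homeomorphic_maps (subtopology (mtop F) D) (top_of_set (f ` D)) f g"
        unfolding homeomorphic_maps_def fD using f(2) g(2) by auto
      then show "homeomorphic_map (subtopology (mtop F) D) (top_of_set (f ` D)) f"
        using homeomorphic_map_maps by blast
    qed
    moreover have "psmooth (f ` D) (prod_mfd T T) (chart_inv (D, f))"
      unfolding fD by (rule psmooth_cong[OF charted_total_square g_psmooth]) (simp add: chart_inv_eq)
    then have "smooth_map (open_sub model_mfd (f ` D)) (prod_mfd T T) (chart_inv (D, f))"
      using smooth_map_open_sub_model[OF _ charted_total_square, of "f ` D"] I fD by metis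
    ultimately show ?thesis
      using W f_smooth DW unfolding mtop_fibre_square
      by (auto simp: fibre_square_def submanifold_def fibre_pairs_def[symmetric])
  qed
  moreover have "p \<in> D"
    using p pp t c d by (auto simp: D_def p12 q_def b0_def[symmetric])
  ultimately show ?thesis by (metis fst_conv)
qed

lemma charted_fibre_square: "charted F"
  unfolding charted_def
proof (intro conjI ballI equalityI subsetI)
  show *: "is_chart (mtop F) c" if "c \<in> atlas F" for c
    using submanifold_charts(1) that unfolding fibre_square_def by blast
  show "p \<in> (\<Union>c\<in>atlas F. fst c)" if "p \<in> points F" for p
    using ex_fibre_square_chart[of p] that by (auto simp: points_fibre_square)
  show "p \<in> points F" if "p \<in> (\<Union>c\<in>atlas F. fst c)" for p
    using that openin_subset[OF chart_open[OF *]] by blast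
qed

lemma psmooth_fibre_square_chart_inv:
  assumes "c \<in> atlas F"
  shows "psmooth (snd c ` fst c) T (\<lambda>w. fst (chart_inv c w))"
    and "psmooth (snd c ` fst c) T (\<lambda>w. snd (chart_inv c w))"
    and "w \<in> snd c ` fst c \<Longrightarrow> proj E (fst (chart_inv c w)) = proj E (snd (chart_inv c w))"
proof -
  note ch = charted_chart[OF charted_fibre_square assms]
  have "smooth_map (open_sub model_mfd (snd c ` fst c)) (prod_mfd T T) (chart_inv c)"
    using submanifold_charts(2) assms unfolding fibre_square_def by blast
  then have "psmooth (snd c ` fst c) (prod_mfd T T) (chart_inv c)"
    using smooth_map_open_sub_model[OF chart_open_image[OF ch] charted_total_square] by blast
  then show "psmooth (snd c ` fst c) T (\<lambda>w. fst (chart_inv c w))"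
    "psmooth (snd c ` fst c) T (\<lambda>w. snd (chart_inv c w))"
    by (rule psmooth_fst_snd[OF smooth_atlas_total smooth_atlas_total])+
  show "proj E (fst (chart_inv c w)) = proj E (snd (chart_inv c w))" if "w \<in> snd c ` fst c"
  proof -
    have "chart_inv c w \<in> points F"
      using openin_subset[OF chart_open[OF ch]] chart_inv_into[OF that] by blast
    then show ?thesis by (simp add: points_fibre_square fibre_pairs_def case_prod_unfold)
  qed
qed

text \<open>
  The compatibility condition evaluated on tangent vectors of the fibre square, which are presented
  by a pair of parametrisations with the same projection.
\<close>

definition compatible_along :: "('eb \<Rightarrow> 'v) \<Rightarrow> ('r \<Rightarrow> 'er \<Rightarrow> 'v::real_normed_vector) \<Rightarrow> 
    ('z::model_space \<Rightarrow> 'r) \<Rightarrow> ('z \<Rightarrow> 'r) \<Rightarrow> 'z \<Rightarrow> 'z \<Rightarrow> bool"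
  where "compatible_along t \<omega> \<phi> \<eta> x v \<longleftrightarrow>
    \<omega> (\<eta> x) (vel T \<eta> x v) - \<omega> (\<phi> x) (vel T \<phi> x v) =
      t (maurer_cartan B (difference (\<phi> x, \<eta> x)) (vel (mfd_of B) (\<lambda>y. difference (\<phi> y, \<eta> y)) x v))"

lemma compatible_connections_iff:
  "compatible_connections B t E \<omega> \<longleftrightarrow> (\<forall>p\<in>points F. \<forall>v.
    compatible_along t \<omega> (\<lambda>w. fst (chart_inv (chart_at F p) w)) (\<lambda>w. snd (chart_inv (chart_at F p) w))
      (snd (chart_at F p) p) v)"
proof -
  have pt: "difference p \<in> points (mfd_of B)" if "p \<in> points F" for p
    using that difference_carrier by (auto simp: points_fibre_square fibre_pairs_def B.points)
  have "compatible_connections B t E \<omega> \<longleftrightarrow> (\<forall>p\<in>points F. \<forall>v.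
      \<omega> (snd p) (differential F T snd p v) - \<omega> (fst p) (differential F T fst p v) =
      t (maurer_cartan B (difference p) (differential F (mfd_of B) difference p v)))"
    using pt
    by (simp add: compatible_connections_def Let_def diff_form_def pullback_def apply_form_def
        fun_eq_iff restrict_def Ball_def if_distrib del: split_paired_All cong: if_cong)
  also have "\<dots> \<longleftrightarrow> (\<forall>p\<in>points F. \<forall>v.
    compatible_along t \<omega> (\<lambda>w. fst (chart_inv (chart_at F p) w)) (\<lambda>w. snd (chart_inv (chart_at F p) w))
      (snd (chart_at F p) p) v)"
    by (intro ball_cong refl all_cong)
      (simp add: compatible_along_def differential_eq_vel[OF charted_fibre_square]
        chart_inv_left[OF chart_at_props(3,2)[OF charted_fibre_square]])
  finally show ?thesis .
qed

text \<open>
  The pair \<open>(\<phi>, \<eta>)\<close> maps into the fibre square. It is smooth for the charts of the fibre square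
  because these extend to smooth functions on an open set of \<open>R \<times> R\<close>, so the condition at one
  tangent vector in the chosen chart can be transported to the velocity of \<open>(\<phi>, \<eta>)\<close>.
\<close>

lemma compatible_connections_along:
  fixes \<phi> \<eta> :: "'z::model_space \<Rightarrow> 'r"
  assumes comp: "compatible_connections B t E \<omega>"
    and \<phi>: "psmooth S T \<phi>" and \<eta>: "psmooth S T \<eta>"
    and eq: "\<And>y. y \<in> S \<Longrightarrow> proj E (\<phi> y) = proj E (\<eta> y)" and x: "x \<in> S"
  shows "compatible_along t \<omega> \<phi> \<eta> x v"
proof -
  let ?j = "\<lambda>y. (\<phi> y, \<eta> y)"
  define p where "p = ?j x"
  have jF: "?j y \<in> points F" if "y \<in> S" for y
    using psmooth_points[OF \<phi> that] psmooth_points[OF \<eta> that] eq[OF that] by (simp add: points_fibre_square fibre_pairs_def)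
  then have p: "p \<in> points F" using x by (simp add: p_def)
  define c where "c = chart_at F p"
  note c = chart_at_props[OF charted_fibre_square p, folded c_def]
  note ci = psmooth_fibre_square_chart_inv[OF c(1)]
  obtain W h where W: "openin (mtop (prod_mfd T T)) W" "p \<in> W"
    "smooth_map (open_sub (prod_mfd T T) W) model_mfd h" "\<And>q. q \<in> W \<inter> fst c \<Longrightarrow> h q = snd c q"
    using submanifold_charts(3)[OF c(1)[unfolded fibre_square_def] c(2)] by blast
  have j: "psmooth S (prod_mfd T T) ?j"
    by (rule psmooth_Pair[OF charted_total \<phi> charted_total \<eta>])
  have "continuous_map (top_of_set S) (mtop F) ?j"
    using psmooth_continuous[OF j] jF unfolding points_fibre_square
    by (auto simp: mtop_fibre_square continuous_map_in_subtopology)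
  from openin_continuous_map_preimage[OF this chart_open[OF c(3)]]
  have "openin (top_of_set S) {y \<in> S. ?j y \<in> fst c}" by simp
  then have "open {y \<in> S. ?j y \<in> fst c}"
    using psmooth_open[OF \<phi>] openin_open_trans by blast
  moreover have oW: "open {y \<in> S. ?j y \<in> W}" by (rule psmooth_open_preimage[OF j W(1)])
  ultimately have "open ({y \<in> S. ?j y \<in> fst c} \<inter> {y \<in> S. ?j y \<in> W})" by (rule open_Int)
  then obtain Q where Q: "open Q" "Q = {y \<in> S. ?j y \<in> fst c \<and> ?j y \<in> W}"
    by (auto simp: Collect_conj_eq Int_ac)
  have xQ: "x \<in> Q" using x c(2) W(2) by (simp add: Q p_def)
  have "psmooth {y \<in> S. ?j y \<in> W} model_mfd (\<lambda>y. h (?j y))"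
    by (rule psmooth_smooth_map_open_sub[OF charted_total_square charted_model W(1,3)
          psmooth_subset[OF j _ oW]]) auto
  then have "((\<lambda>y. h (?j y)) has_derivative frechet_derivative (\<lambda>y. h (?j y)) (at x)) (at x)"
    using xQ Q(2) by (intro smooth_on_has_derivative[of "{y \<in> S. ?j y \<in> W}"]) (auto simp: psmooth_model)
  then obtain D where "((\<lambda>y. h (?j y)) has_derivative D) (at x)" by blast
  then have D: "((\<lambda>y. snd c (?j y)) has_derivative D) (at x)"
    by (rule has_derivative_transform_within_open[OF _ Q(1) xQ]) (use W(4) Q(2) in auto)
  have cj: "chart_inv c (snd c (?j y)) = ?j y" if "y \<in> Q" for y
    using that Q(2) chart_inv_left[OF c(3)] by simp
  have im: "snd c (?j x) \<in> snd c ` fst c" using xQ Q(2) by auto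
  have 1: "vel T \<phi> x v = vel T (\<lambda>w. fst (chart_inv c w)) (snd c p) (D v)"
    unfolding p_def using cj
    by (subst vel_reparam[OF charted_total ci(1) im D, symmetric])
      (intro fun_cong[OF vel_cong[OF Q(1) xQ]], simp)
  have 2: "vel T \<eta> x v = vel T (\<lambda>w. snd (chart_inv c w)) (snd c p) (D v)"
    unfolding p_def using cj
    by (subst vel_reparam[OF charted_total ci(2) im D, symmetric])
      (intro fun_cong[OF vel_cong[OF Q(1) xQ]], simp)
  have d: "psmooth (snd c ` fst c) (mfd_of B) (\<lambda>w. difference (fst (chart_inv c w), snd (chart_inv c w)))"
    by (rule psmooth_difference[OF ci])
  have 3: "vel (mfd_of B) (\<lambda>y. difference (?j y)) x v =
      vel (mfd_of B) (\<lambda>w. difference (fst (chart_inv c w), snd (chart_inv c w))) (snd c p) (D v)"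
    unfolding p_def using cj
    by (subst vel_reparam[OF B.charted d im D, symmetric])
      (intro fun_cong[OF vel_cong[OF Q(1) xQ]], simp)
  have "compatible_along t \<omega> (\<lambda>w. fst (chart_inv c w)) (\<lambda>w. snd (chart_inv c w)) (snd c p) (D v)"
    using comp p unfolding compatible_connections_iff c_def by blast
  then show ?thesis
    unfolding compatible_along_def 1 2 3 by (simp add: chart_inv_left[OF c(3,2)]) (simp add: p_def)
qed

lemma compatible_connectionsI:
  assumes "\<And>S (\<phi> :: 'er \<times> 'eb \<Rightarrow> 'r) \<eta> x v. psmooth S T \<phi> \<Longrightarrow> psmooth S T \<eta> \<Longrightarrow>
    (\<And>y. y \<in> S \<Longrightarrow> proj E (\<phi> y) = proj E (\<eta> y)) \<Longrightarrow> x \<in> S \<Longrightarrow> compatible_along t \<omega> \<phi> \<eta> x v"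
  shows "compatible_connections B t E \<omega>"
  unfolding compatible_connections_iff
proof (intro ballI allI)
  fix p v assume p: "p \<in> points F"
  note c = chart_at_props[OF charted_fibre_square p]
  note ci = psmooth_fibre_square_chart_inv[OF c(1)]
  show "compatible_along t \<omega> (\<lambda>w. fst (chart_inv (chart_at F p) w)) (\<lambda>w. snd (chart_inv (chart_at F p) w))
      (snd (chart_at F p) p) v"
    by (rule assms[OF ci imageI[OF c(2)]])
qed

end

section \<open>Connections\<close>

lemma pullback_eq_iff:
  "pullback M M f \<omega> = apply_form M l \<omega> \<longleftrightarrow>
    (\<forall>p\<in>points M. \<forall>v. \<omega> (f p) (differential M M f p v) = l (\<omega> p v))"
  unfolding pullback_def apply_form_def
proof
  assume eq: "(\<lambda>p\<in>points M. \<lambda>v. \<omega> (f p) (differential M M f p v)) = (\<lambda>p\<in>points M. \<lambda>v. l (\<omega> p v))"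
  show "\<forall>p\<in>points M. \<forall>v. \<omega> (f p) (differential M M f p v) = l (\<omega> p v)"
    using fun_cong[OF fun_cong[OF eq]] by (simp add: restrict_def split: if_splits) metis
qed (auto intro!: restrict_ext)

lemma apply_form_id: "\<omega> \<in> extensional (points M) \<Longrightarrow> apply_form M (\<lambda>x. x) \<omega> = \<omega>"
  by (auto simp: apply_form_def extensional_def fun_eq_iff)

text \<open>
  Equality of forms is equality at all points of the manifold, since both sides take the same default
  value elsewhere.
\<close>

lemma equivariant_connections_iff:
  "\<omega> \<in> equivariant_connections G B E \<longleftrightarrow> one_form (total E) \<omega> \<and>
    (\<forall>r\<in>points (total E). \<forall>\<xi>. \<omega> r (fundamental_vector B E \<xi> r) = \<xi>) \<and>
    (\<forall>b\<in>carrier B. \<forall>r\<in>points (total E). \<forall>u.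
      \<omega> (ract E r b) (differential (total E) (total E) (\<lambda>r. ract E r b) r u) = Ad B (inv\<^bsub>B\<^esub> b) (\<omega> r u)) \<and>
    (\<forall>g\<in>carrier G. \<forall>r\<in>points (total E). \<forall>u.
      \<omega> (lact E g r) (differential (total E) (total E) (lact E g) r u) = \<omega> r u)"
proof (cases "one_form (total E) \<omega>")
  case True
  then have "\<omega> = apply_form (total E) (\<lambda>x. x) \<omega>"
    by (simp add: one_form_def apply_form_id)
  then have "pullback (total E) (total E) (lact E g) \<omega> = \<omega> \<longleftrightarrow>
      pullback (total E) (total E) (lact E g) \<omega> = apply_form (total E) (\<lambda>x. x) \<omega>" for g
    by simp
  then show ?thesis
    unfolding equivariant_connections_def connection_def mem_Collect_eq by (simp only: pullback_eq_iff) blast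
qed (simp add: equivariant_connections_def connection_def)

lemma one_form_linear: "one_form M \<omega> \<Longrightarrow> p \<in> points M \<Longrightarrow> linear (\<omega> p)"
  by (simp add: one_form_def)

lemma one_form_apply:
  fixes M :: "('p, 'e::model_space) mfd" and l :: "'v::model_space \<Rightarrow> 'w::real_normed_vector"
  assumes M: "smooth_atlas M" and \<omega>: "one_form M \<omega>" and l: "linear l"
  shows "one_form M (apply_form M l \<omega>)"
proof (rule one_formI[OF M])
  show "linear (apply_form M l \<omega> p)" if "p \<in> points M" for p
    using linear_compose[OF one_form_linear[OF \<omega> that] l] that by (simp add: apply_form_def comp_def)
  fix S and \<phi> :: "'e \<Rightarrow> 'p" and v assume \<phi>: "psmooth S M \<phi>"
  have "smooth_on S (\<lambda>x. l (\<omega> (\<phi> x) (vel M \<phi> x v)))"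
    by (rule smooth_on_bounded_linear[OF bounded_linear_model[OF l] psmooth_open[OF \<phi>]
          one_form_smooth[OF M \<omega> \<phi>]])
  then show "smooth_on S (\<lambda>x. apply_form M l \<omega> (\<phi> x) (vel M \<phi> x v))"
    by (rule smooth_on_congI[OF _ psmooth_open[OF \<phi>]])
      (simp add: apply_form_def psmooth_points[OF \<phi>])
qed (simp add: apply_form_def)

lemma one_form_add:
  fixes M :: "('p, 'e::model_space) mfd"
  assumes M: "smooth_atlas M" and \<omega>: "one_form M \<omega>" and \<omega>': "one_form M \<omega>'"
  shows "one_form M (add_form M \<omega> \<omega>')"
proof (rule one_formI[OF M])
  show "linear (add_form M \<omega> \<omega>' p)" if "p \<in> points M" for p
    using linear_compose_add[OF one_form_linear[OF \<omega> that] one_form_linear[OF \<omega>' that]] that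
    by (simp add: add_form_def)
  fix S and \<phi> :: "'e \<Rightarrow> 'p" and v assume \<phi>: "psmooth S M \<phi>"
  have "smooth_on S (\<lambda>x. \<omega> (\<phi> x) (vel M \<phi> x v) + \<omega>' (\<phi> x) (vel M \<phi> x v))"
    by (intro smooth_on_add psmooth_open[OF \<phi>] one_form_smooth[OF M \<omega> \<phi>] one_form_smooth[OF M \<omega>' \<phi>])
  then show "smooth_on S (\<lambda>x. add_form M \<omega> \<omega>' (\<phi> x) (vel M \<phi> x v))"
    by (rule smooth_on_congI[OF _ psmooth_open[OF \<phi>]])
      (simp add: add_form_def psmooth_points[OF \<phi>])
qed (simp add: add_form_def)

lemma one_form_pullback:
  fixes M :: "('p, 'e::model_space) mfd" and N :: "('q, 'f::model_space) mfd"
  assumes M: "smooth_atlas M" and N: "smooth_atlas N" and f: "smooth_map M N f" and \<omega>: "one_form N \<omega>"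
  shows "one_form M (pullback M N f \<omega>)"
proof (rule one_formI[OF M])
  note cM = smooth_atlas_charted[OF M] and cN = smooth_atlas_charted[OF N]
  show "linear (pullback M N f \<omega> p)" if "p \<in> points M" for p
    using linear_compose[OF linear_differential[OF cM cN f that]
        one_form_linear[OF \<omega> smooth_map_points[OF f that]]] that
    by (simp add: pullback_def comp_def)
  fix S and \<phi> :: "'e \<Rightarrow> 'p" and v assume \<phi>: "psmooth S M \<phi>"
  have "smooth_on S (\<lambda>x. \<omega> (f (\<phi> x)) (vel N (\<lambda>x. f (\<phi> x)) x v))"
    by (rule one_form_smooth[OF N \<omega> psmooth_smooth_map[OF cM f \<phi> cN]])
  then show "smooth_on S (\<lambda>x. pullback M N f \<omega> (\<phi> x) (vel M \<phi> x v))"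
    by (rule smooth_on_congI[OF _ psmooth_open[OF \<phi>]])
      (simp add: pullback_def psmooth_points[OF \<phi>] vel_smooth_map[OF cM cN f \<phi>])
qed (simp add: pullback_def)

section \<open>Central extensions of Lie groups with an Ad-equivariant splitting\<close>

locale split_extension = A: lie A + B: lie B + C: lie C
  for A :: "('a, 'ea::model_space) lie_grp" and B :: "('b, 'eb::model_space) lie_grp"
    and C :: "('c, 'ec::model_space) lie_grp" +
  fixes \<alpha> :: "'a \<Rightarrow> 'b" and \<beta> :: "'b \<Rightarrow> 'c" and s :: "'ec \<Rightarrow> 'eb" and t :: "'eb \<Rightarrow> 'ea"
  assumes central_ext: "central_extension A B C \<alpha> \<beta>" and Ad_split: "Ad_splitting A B C \<alpha> \<beta> s t"
begin

abbreviation "\<alpha>' \<equiv> lie_algebra_map A B \<alpha>"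
abbreviation "\<beta>' \<equiv> lie_algebra_map B C \<beta>"

lemma \<alpha>_hom: "\<alpha> \<in> hom A B" and \<beta>_hom: "\<beta> \<in> hom B C"
  and \<alpha>_smooth: "smooth_map (mfd_of A) (mfd_of B) \<alpha>" and \<beta>_smooth: "smooth_map (mfd_of B) (mfd_of C) \<beta>"
  and \<alpha>_inj: "inj_on \<alpha> (carrier A)" and \<beta>_surj: "\<beta> ` carrier B = carrier C"
  and exact: "\<alpha> ` carrier A = kernel B C \<beta>"
  and central: "a \<in> carrier A \<Longrightarrow> b \<in> carrier B \<Longrightarrow> \<alpha> a \<otimes>\<^bsub>B\<^esub> b = b \<otimes>\<^bsub>B\<^esub> \<alpha> a"
  using central_ext by (auto simp: central_extension_def lie_hom_def)

lemma \<alpha>_carrier: "a \<in> carrier A \<Longrightarrow> \<alpha> a \<in> carrier B"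
  using \<alpha>_hom by (auto simp: hom_def)

lemma \<beta>_carrier: "b \<in> carrier B \<Longrightarrow> \<beta> b \<in> carrier C"
  using \<beta>_hom by (auto simp: hom_def)

lemma \<alpha>_one: "\<alpha> \<one>\<^bsub>A\<^esub> = \<one>\<^bsub>B\<^esub>"
  by (rule hom_one[OF \<alpha>_hom A.is_group B.is_group])

lemma \<beta>_one: "\<beta> \<one>\<^bsub>B\<^esub> = \<one>\<^bsub>C\<^esub>"
  by (rule hom_one[OF \<beta>_hom B.is_group C.is_group])

lemma \<beta>_mult: "b \<in> carrier B \<Longrightarrow> b' \<in> carrier B \<Longrightarrow> \<beta> (b \<otimes>\<^bsub>B\<^esub> b') = \<beta> b \<otimes>\<^bsub>C\<^esub> \<beta> b'"
  using \<beta>_hom by (rule hom_mult)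

lemma \<alpha>_mult: "a \<in> carrier A \<Longrightarrow> a' \<in> carrier A \<Longrightarrow> \<alpha> (a \<otimes>\<^bsub>A\<^esub> a') = \<alpha> a \<otimes>\<^bsub>B\<^esub> \<alpha> a'"
  using \<alpha>_hom by (rule hom_mult)

lemma \<beta>_inv: "b \<in> carrier B \<Longrightarrow> \<beta> (inv\<^bsub>B\<^esub> b) = inv\<^bsub>C\<^esub> (\<beta> b)"
  using group_hom.hom_inv[of B C \<beta> b] \<beta>_hom
  by (simp add: group_hom_def group_hom_axioms_def B.is_group C.is_group)

lemma \<beta>_\<alpha>: "a \<in> carrier A \<Longrightarrow> \<beta> (\<alpha> a) = \<one>\<^bsub>C\<^esub>"
  using exact by (auto simp: kernel_def)

lemma linear_s: "linear s" and linear_t: "linear t"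
  and \<beta>'_s: "\<beta>' (s \<zeta>) = \<zeta>"
  and s_Ad: "b \<in> carrier B \<Longrightarrow> s (Ad C (\<beta> b) \<zeta>) = Ad B b (s \<zeta>)"
  and decomp: "\<xi> = \<alpha>' (t \<xi>) + s (\<beta>' \<xi>)"
  using Ad_split by (auto simp: Ad_splitting_def)

lemma linear_\<alpha>': "linear \<alpha>'" and linear_\<beta>': "linear \<beta>'"
  unfolding lie_algebra_map_def
  by (rule linear_differential[OF A.charted B.charted \<alpha>_smooth A.one_point]
      linear_differential[OF B.charted C.charted \<beta>_smooth B.one_point])+

lemma \<beta>'_\<alpha>': "\<beta>' (\<alpha>' \<eta>) = 0"
proof -
  have "\<beta>' (\<alpha>' \<eta>) = differential (mfd_of A) (mfd_of C) (\<lambda>a. \<beta> (\<alpha> a)) \<one>\<^bsub>A\<^esub> \<eta>"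
    using differential_compose[OF A.charted B.charted C.charted \<alpha>_smooth \<beta>_smooth A.one_point]
    by (simp add: lie_algebra_map_def \<alpha>_one)
  also have "\<dots> = differential (mfd_of A) (mfd_of C) (\<lambda>a. \<one>\<^bsub>C\<^esub>) \<one>\<^bsub>A\<^esub> \<eta>"
    by (rule differential_cong[OF A.charted A.one_point]) (simp add: A.points \<beta>_\<alpha>)
  finally show ?thesis by (simp add: differential_const[OF A.charted A.one_point])
qed

text \<open>
  The identity that characterises \<open>t\<close> involves only \<open>\<alpha>' \<circ> t\<close> and says nothing about the kernel of
  \<open>\<alpha>'\<close>, so the injectivity of \<open>\<alpha>\<close> as a map of groups has to be used.
\<close>

lemma \<alpha>'_injective: "\<alpha>' \<eta> = 0 \<Longrightarrow> \<eta> = 0"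
  using injective_hom_immersion[OF A.lie_axioms B.lie_axioms _ \<alpha>_inj] \<alpha>_hom \<alpha>_smooth
  by (auto simp: lie_hom_def)

text \<open>
  The decomposition of \<open>\<alpha>' \<eta>\<close> gives \<open>\<alpha>' \<eta> = \<alpha>' (t (\<alpha>' \<eta>))\<close>, where \<open>\<alpha>'\<close> can be cancelled.
\<close>

lemma t_\<alpha>': "t (\<alpha>' \<eta>) = \<eta>"
proof -
  have "\<alpha>' \<eta> = \<alpha>' (t (\<alpha>' \<eta>))"
    using decomp[of "\<alpha>' \<eta>"] by (simp add: \<beta>'_\<alpha>' linear_0[OF linear_s])
  then have "\<alpha>' (t (\<alpha>' \<eta>) - \<eta>) = 0" by (simp add: linear_diff[OF linear_\<alpha>'])
  then show ?thesis using \<alpha>'_injective by fastforce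
qed

lemma t_s: "t (s \<zeta>) = 0"
proof -
  have "\<alpha>' (t (s \<zeta>)) = 0" using decomp[of "s \<zeta>"] by (simp add: \<beta>'_s)
  then show ?thesis by (rule \<alpha>'_injective)
qed

lemma Ad_\<alpha>': 
  assumes b: "b \<in> carrier B"
  shows "Ad B b (\<alpha>' \<eta>) = \<alpha>' \<eta>"
proof -
  have "Ad B b (\<alpha>' \<eta>) = differential (mfd_of A) (mfd_of B) (\<lambda>a. b \<otimes>\<^bsub>B\<^esub> \<alpha> a \<otimes>\<^bsub>B\<^esub> inv\<^bsub>B\<^esub> b) \<one>\<^bsub>A\<^esub> \<eta>"
    using differential_compose[OF A.charted B.charted B.charted \<alpha>_smooth B.smooth_conj[OF b] A.one_point]
    by (simp add: Ad_def lie_algebra_map_def \<alpha>_one)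
  also have "\<dots> = \<alpha>' \<eta>"
    unfolding lie_algebra_map_def
  proof (rule differential_cong[OF A.charted A.one_point])
    fix a assume "a \<in> points (mfd_of A)"
    then have a: "a \<in> carrier A" by (simp add: A.points)
    then show "b \<otimes>\<^bsub>B\<^esub> \<alpha> a \<otimes>\<^bsub>B\<^esub> inv\<^bsub>B\<^esub> b = \<alpha> a"
      using central[OF a b] b \<alpha>_carrier[OF a] by (simp add: B.m_assoc flip: central[OF a b])
  qed
  finally show ?thesis .
qed

lemma Ad_central:
  assumes a: "a \<in> carrier A"
  shows "Ad B (\<alpha> a) \<xi> = \<xi>"
proof -
  have "Ad B (\<alpha> a) \<xi> = differential (mfd_of B) (mfd_of B) (\<lambda>x. x) \<one>\<^bsub>B\<^esub> \<xi>"
    unfolding Ad_def lie_algebra_map_def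
    by (rule differential_cong[OF B.charted B.one_point])
      (simp add: B.points central[OF a] \<alpha>_carrier[OF a] B.m_assoc)
  then show ?thesis by (simp add: differential_id[OF B.charted B.one_point])
qed

text \<open>\<open>A\<close> is abelian, being embedded in the centre of \<open>B\<close>.\<close>

lemma Ad_A:
  assumes a: "a \<in> carrier A"
  shows "Ad A a \<eta> = \<eta>"
proof -
  have comm: "a \<otimes>\<^bsub>A\<^esub> x = x \<otimes>\<^bsub>A\<^esub> a" if x: "x \<in> carrier A" for x
    using inj_onD[OF \<alpha>_inj, of "a \<otimes>\<^bsub>A\<^esub> x" "x \<otimes>\<^bsub>A\<^esub> a"] a x central[OF a \<alpha>_carrier[OF x]]
    by (simp add: \<alpha>_mult)
  have "Ad A a \<eta> = differential (mfd_of A) (mfd_of A) (\<lambda>x. x) \<one>\<^bsub>A\<^esub> \<eta>"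
    unfolding Ad_def lie_algebra_map_def
    by (rule differential_cong[OF A.charted A.one_point])
      (simp add: A.points comm a A.m_assoc)
  then show ?thesis by (simp add: differential_id[OF A.charted A.one_point])
qed

lemma \<beta>'_Ad:
  assumes b: "b \<in> carrier B"
  shows "\<beta>' (Ad B b \<xi>) = Ad C (\<beta> b) (\<beta>' \<xi>)"
  using differential_commute[OF B.charted B.charted C.charted C.charted B.smooth_conj[OF b] \<beta>_smooth
      \<beta>_smooth C.smooth_conj[OF \<beta>_carrier[OF b]] _ B.one_point] b
  by (simp add: Ad_def lie_algebra_map_def B.points \<beta>_mult \<beta>_inv \<beta>_one)

text \<open>
  The adjoint action fixes the summand \<open>\<alpha>' (t \<xi>)\<close>, because \<open>A\<close> is central, and preserves the image
  of \<open>s\<close>, because \<open>s\<close> is equivariant. So it does not change the component \<open>t\<close>.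
\<close>

lemma t_Ad:
  assumes b: "b \<in> carrier B"
  shows "t (Ad B b \<xi>) = t \<xi>"
proof -
  have "Ad B b \<xi> = Ad B b (\<alpha>' (t \<xi>)) + Ad B b (s (\<beta>' \<xi>))"
    using decomp[of \<xi>] linear_add[OF B.linear_Ad[OF b]] by metis
  then have "Ad B b \<xi> = \<alpha>' (t \<xi>) + s (Ad C (\<beta> b) (\<beta>' \<xi>))"
    by (simp add: Ad_\<alpha>'[OF b] s_Ad[OF b])
  then show ?thesis by (simp add: linear_add[OF linear_t] t_\<alpha>' t_s)
qed

end

section \<open>Connections on an equivariant central extension\<close>

locale bundle_extension = split_extension A B C \<alpha> \<beta> s t + R: principal B X R + P: principal C X P
  for A :: "('a, 'ea::model_space) lie_grp" and B :: "('b, 'eb::model_space) lie_grp"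
    and C :: "('c, 'ec::model_space) lie_grp" and \<alpha> \<beta> s t
    and X :: "('x, 'ex::model_space) mfd"
    and R :: "('r, 'er::model_space, 'x, 'b, 'g) eq_bundle"
    and P :: "('p, 'ep::model_space, 'x, 'c, 'g) eq_bundle" +
  fixes G :: "('g, 'eg::model_space) lie_grp" and actX :: "'g \<Rightarrow> 'x \<Rightarrow> 'x" and \<sigma> :: "'r \<Rightarrow> 'p"
  assumes eq_ext: "equivariant_central_extension G B C \<beta> X actX R P \<sigma>"
begin

abbreviation "d\<sigma> \<equiv> differential R.T P.T \<sigma>"
abbreviation "S \<equiv> sigma_bundle \<alpha> R \<sigma>"

lemma \<sigma>_smooth: "smooth_map R.T P.T \<sigma>"
  and proj_\<sigma>: "r \<in> points R.T \<Longrightarrow> proj P (\<sigma> r) = proj R r"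
  and \<sigma>_act: "r \<in> points R.T \<Longrightarrow> b \<in> carrier B \<Longrightarrow> \<sigma> (ract R r b) = ract P (\<sigma> r) (\<beta> b)"
  and \<sigma>_lact: "g \<in> carrier G \<Longrightarrow> r \<in> points R.T \<Longrightarrow> \<sigma> (lact R g r) = lact P g (\<sigma> r)"
  and R_eq: "equivariant_principal_bundle G B X actX R"
  and P_eq: "equivariant_principal_bundle G C X actX P"
  using eq_ext by (simp_all add: equivariant_central_extension_def)

lemma lie_G: "lie G"
  using R_eq by (simp add: lie_def lie_axioms_def equivariant_principal_bundle_def lie_group_def)

lemma left_action_smooth:
  fixes M :: "('q, 'f::model_space) mfd"
  assumes M: "smooth_atlas M" and act: "left_action G M l" and g: "g \<in> carrier G"
  shows "smooth_map M M (l g)"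
proof -
  interpret G: lie G by (rule lie_G)
  note ch = smooth_atlas_charted[OF M]
  have "smooth_map M M (\<lambda>p. l g p)"
    by (rule smooth_map_map2[OF ch G.charted ch ch _ smooth_map_const[OF ch G.charted] smooth_map_id[OF M]])
      (use act g in \<open>auto simp: left_action_def G.points\<close>)
  then show ?thesis by simp
qed

lemma lact_R_smooth: "g \<in> carrier G \<Longrightarrow> smooth_map R.T R.T (lact R g)"
  and lact_P_smooth: "g \<in> carrier G \<Longrightarrow> smooth_map P.T P.T (lact P g)"
  using left_action_smooth[OF R.smooth_atlas_total] left_action_smooth[OF P.smooth_atlas_total] R_eq P_eq
  by (simp_all add: equivariant_principal_bundle_def)

lemma \<sigma>_point: "r \<in> points R.T \<Longrightarrow> \<sigma> r \<in> points P.T"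
  by (rule smooth_map_points[OF \<sigma>_smooth])

lemmas psmooth_\<sigma> = psmooth_smooth_map[OF R.charted_total \<sigma>_smooth _ P.charted_total]
lemmas vel_\<sigma> = vel_smooth_map[OF R.charted_total P.charted_total \<sigma>_smooth]

lemma linear_d\<sigma>: "r \<in> points R.T \<Longrightarrow> linear (d\<sigma> r)"
  by (rule linear_differential[OF R.charted_total P.charted_total \<sigma>_smooth])

lemma d\<sigma>_fund:
  assumes r: "r \<in> points R.T"
  shows "d\<sigma> r (R.fund \<xi> r) = P.fund (\<beta>' \<xi>) (\<sigma> r)"
  using differential_commute[OF B.charted R.charted_total C.charted P.charted_total
      R.smooth_orbit[OF r] \<sigma>_smooth \<beta>_smooth P.smooth_orbit[OF \<sigma>_point[OF r]] _ B.one_point]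
  by (simp add: fundamental_vector_def lie_algebra_map_def B.points \<sigma>_act[OF r] R.act_one[OF r] \<beta>_one)

lemma d\<sigma>_dact:
  assumes b: "b \<in> carrier B" and r: "r \<in> points R.T"
  shows "d\<sigma> (ract R r b) (R.dact b r u) = P.dact (\<beta> b) (\<sigma> r) (d\<sigma> r u)"
  by (rule differential_commute[OF R.charted_total R.charted_total P.charted_total P.charted_total
      R.smooth_translation[OF b] \<sigma>_smooth \<sigma>_smooth P.smooth_translation[OF \<beta>_carrier[OF b]] _ r])
    (simp add: \<sigma>_act b)

lemma d\<sigma>_lact:
  assumes g: "g \<in> carrier G" and r: "r \<in> points R.T"
  shows "d\<sigma> (lact R g r) (differential R.T R.T (lact R g) r u) =
    differential P.T P.T (lact P g) (\<sigma> r) (d\<sigma> r u)"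
  by (rule differential_commute[OF R.charted_total R.charted_total P.charted_total P.charted_total
      lact_R_smooth[OF g] \<sigma>_smooth \<sigma>_smooth lact_P_smooth[OF g] _ r]) (simp add: \<sigma>_lact g)

lemma fund_sigma_bundle:
  assumes r: "r \<in> points R.T"
  shows "fundamental_vector A S \<xi> r = R.fund (\<alpha>' \<xi>) r"
  using differential_compose[OF A.charted B.charted R.charted_total \<alpha>_smooth R.smooth_orbit[OF r] A.one_point]
  by (simp add: fundamental_vector_def sigma_bundle_def lie_algebra_map_def \<alpha>_one)

lemma sigma_bundle_sel: "total S = total R" "ract S = (\<lambda>r a. ract R r (\<alpha> a))" "lact S = lact R"
  by (simp_all add: sigma_bundle_def)

lemma sigma_connections_iff:
  "\<omega> \<in> equivariant_connections G A S \<longleftrightarrow> one_form R.T \<omega> \<and>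
    (\<forall>r\<in>points R.T. \<forall>\<xi>. \<omega> r (R.fund (\<alpha>' \<xi>) r) = \<xi>) \<and>
    (\<forall>a\<in>carrier A. \<forall>r\<in>points R.T. \<forall>u. \<omega> (ract R r (\<alpha> a)) (R.dact (\<alpha> a) r u) = \<omega> r u) \<and>
    (\<forall>g\<in>carrier G. \<forall>r\<in>points R.T. \<forall>u.
      \<omega> (lact R g r) (differential R.T R.T (lact R g) r u) = \<omega> r u)"
  unfolding equivariant_connections_iff
  by (simp add: sigma_bundle_sel fund_sigma_bundle Ad_A)

subsection \<open>The bundle map is a surjective submersion\<close>

text \<open>
  Locally every point of \<open>P\<close> is a translate of the image of a section of \<open>R\<close>. Smooth
  parametrisations of \<open>P\<close> can be treated in this way without a local section of \<open>\<beta>\<close>, because only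
  the translating element of \<open>C\<close> is needed and not a lift of it to \<open>B\<close>.
\<close>

lemma ex_factorisation:
  fixes \<phi> :: "'z::model_space \<Rightarrow> 'p"
  assumes \<phi>: "psmooth Q P.T \<phi>" and x: "x \<in> Q"
  shows "\<exists>W \<eta> k. x \<in> W \<and> W \<subseteq> Q \<and> psmooth W R.T \<eta> \<and> psmooth W (mfd_of C) k \<and>
    (\<forall>y\<in>W. \<phi> y = ract P (\<sigma> (\<eta> y)) (k y))"
proof -
  obtain U e l where t: "proj P (\<phi> x) \<in> U" "R.trivialisation U e l"
    using R.ex_trivialisation[OF P.proj_point[OF psmooth_points[OF \<phi> x]]] by blast
  let ?W = "{y \<in> Q. proj P (\<phi> y) \<in> U}"
  have W: "open ?W"
    by (rule psmooth_open_preimage[OF P.psmooth_proj[OF \<phi>] R.triv_open(1)[OF t(2)]])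
  have \<phi>W: "psmooth ?W P.T \<phi>" by (rule psmooth_subset[OF \<phi> _ W]) auto
  let ?\<eta> = "\<lambda>y. e (proj P (\<phi> y))"
  have \<eta>: "psmooth ?W R.T ?\<eta>"
    by (rule R.psmooth_section[OF t(2) P.psmooth_proj[OF \<phi>W]]) simp
  have pr: "proj P (\<sigma> (?\<eta> y)) = proj P (\<phi> y)" if "y \<in> ?W" for y
    using that R.triv_section[OF t(2)] by (simp add: proj_\<sigma>)
  have k: "psmooth ?W (mfd_of C) (\<lambda>y. P.difference (\<sigma> (?\<eta> y), \<phi> y))"
    by (rule P.psmooth_difference[OF psmooth_\<sigma>[OF \<eta>] \<phi>W]) (rule pr)
  have "\<phi> y = ract P (\<sigma> (?\<eta> y)) (P.difference (\<sigma> (?\<eta> y), \<phi> y))" if "y \<in> ?W" for y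
    using P.act_difference[OF psmooth_points[OF psmooth_\<sigma>[OF \<eta>] that] psmooth_points[OF \<phi>W that] pr[OF that]]
    by simp
  moreover have "x \<in> ?W" using x t(1) by simp
  ultimately show ?thesis
    using \<eta> k by (intro exI[of _ ?W] exI[of _ ?\<eta>] exI[of _ "\<lambda>y. P.difference (\<sigma> (?\<eta> y), \<phi> y)"]) simp
qed

lemma vel_factorisation:
  assumes \<phi>: "psmooth Q P.T \<phi>" and \<eta>: "psmooth W R.T \<eta>" and k: "psmooth W (mfd_of C) k"
    and eq: "\<And>y. y \<in> W \<Longrightarrow> \<phi> y = ract P (\<sigma> (\<eta> y)) (k y)" and x: "x \<in> W"
  shows "vel P.T \<phi> x v = P.dact (k x) (\<sigma> (\<eta> x)) (d\<sigma> (\<eta> x) (vel R.T \<eta> x v)) +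
    P.fund (maurer_cartan C (k x) (vel (mfd_of C) k x v)) (\<phi> x)"
proof -
  have "vel P.T \<phi> x v = vel P.T (\<lambda>y. ract P (\<sigma> (\<eta> y)) (k y)) x v"
    by (rule fun_cong[OF vel_cong[OF psmooth_open[OF \<eta>] x]]) (rule eq)
  also have "\<dots> = P.dact (k x) (\<sigma> (\<eta> x)) (vel P.T (\<lambda>y. \<sigma> (\<eta> y)) x v) +
      P.fund (maurer_cartan C (k x) (vel (mfd_of C) k x v)) (ract P (\<sigma> (\<eta> x)) (k x))"
    by (rule P.vel_act[OF psmooth_\<sigma>[OF \<eta>] k x])
  finally show ?thesis by (simp add: vel_\<sigma>[OF \<eta> x] eq[OF x])
qed

text \<open>
  A tangent vector of \<open>P\<close> is the sum of a translate of the image of a tangent vector of \<open>R\<close> and a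
  fundamental vector. The first is hit after lifting the translating element to \<open>B\<close>, the second
  because \<open>s\<close> lifts elements of the Lie algebra.
\<close>

lemma \<sigma>_submersion:
  assumes p: "p \<in> points P.T"
  shows "\<exists>r\<in>points R.T. \<sigma> r = p \<and> (\<forall>v. \<exists>u. d\<sigma> r u = v)"
proof -
  obtain Q and \<phi> :: "'ep \<Rightarrow> 'p" and x where \<phi>: "psmooth Q P.T \<phi>" "x \<in> Q" "\<phi> x = p"
    and vel: "\<And>u. vel P.T \<phi> x u = u"
    using tangent_vector_vel[OF P.smooth_atlas_total p] by metis
  obtain W \<eta> k where W: "x \<in> W" "psmooth W R.T \<eta>" "psmooth W (mfd_of C) k"
    "\<And>y. y \<in> W \<Longrightarrow> \<phi> y = ract P (\<sigma> (\<eta> y)) (k y)"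
    using ex_factorisation[OF \<phi>(1,2)] by blast
  have "k x \<in> \<beta> ` carrier B" using C.psmooth_carrier[OF W(3,1)] \<beta>_surj by blast
  then obtain b where b: "b \<in> carrier B" "k x = \<beta> b" by blast
  note \<eta>x = psmooth_points[OF W(2,1)]
  let ?r = "ract R (\<eta> x) b"
  have r: "?r \<in> points R.T" by (rule R.act_point[OF \<eta>x b(1)])
  have \<sigma>r: "\<sigma> ?r = p" using W(4)[OF W(1)] \<phi>(3) by (simp add: \<sigma>_act[OF \<eta>x b(1)] b(2))
  have "\<exists>u. d\<sigma> ?r u = v" for v
  proof
    let ?\<zeta> = "maurer_cartan C (k x) (vel (mfd_of C) k x v)"
    have "d\<sigma> ?r (R.dact b (\<eta> x) (vel R.T \<eta> x v) + R.fund (s ?\<zeta>) ?r) =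
      P.dact (k x) (\<sigma> (\<eta> x)) (d\<sigma> (\<eta> x) (vel R.T \<eta> x v)) + P.fund ?\<zeta> p"
      using linear_add[OF linear_d\<sigma>[OF r]] d\<sigma>_dact[OF b(1) \<eta>x] d\<sigma>_fund[OF r]
      by (simp add: \<beta>'_s \<sigma>r b(2))
    also have "\<dots> = v"
      using vel_factorisation[OF \<phi>(1) W(2,3,4,1)] vel \<phi>(3) by simp
    finally show "d\<sigma> ?r (R.dact b (\<eta> x) (vel R.T \<eta> x v) + R.fund (s ?\<zeta>) ?r) = v" .
  qed
  with r \<sigma>r show ?thesis by blast
qed

lemma ex_tangent_preimage:
  "p \<in> points P.T \<Longrightarrow> \<exists>r u. r \<in> points R.T \<and> \<sigma> r = p \<and> d\<sigma> r u = v"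
  using \<sigma>_submersion by blast

text \<open>
  Such a vector projects to zero in \<open>X\<close> and hence is fundamental; its image in \<open>P\<close> is the fundamental
  vector of \<open>\<beta>' \<xi>\<close>, and fundamental vectors determine their generators.
\<close>

lemma d\<sigma>_kernel:
  assumes r: "r \<in> points R.T" and 0: "d\<sigma> r u = 0"
  shows "\<exists>\<xi>. u = R.fund \<xi> r \<and> \<beta>' \<xi> = 0"
proof -
  have "differential R.T X (proj R) r u = differential R.T X (\<lambda>r. proj P (\<sigma> r)) r u"
    by (rule differential_cong[OF R.charted_total r]) (simp add: proj_\<sigma>)
  also have "\<dots> = differential P.T X (proj P) (\<sigma> r) (d\<sigma> r u)"
    by (rule differential_compose[OF R.charted_total P.charted_total P.charted_base \<sigma>_smooth P.smooth_proj r])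
  also have "\<dots> = 0"
    unfolding 0
    by (rule linear_0[OF linear_differential[OF P.charted_total P.charted_base P.smooth_proj \<sigma>_point[OF r]]])
  finally obtain \<xi> where \<xi>: "u = R.fund \<xi> r"
    using R.vertical_fundamental[OF r] by blast
  have "P.fund (\<beta>' \<xi>) (\<sigma> r) = 0" using 0 d\<sigma>_fund[OF r] by (simp add: \<xi>)
  then show ?thesis using P.fund_injective[OF \<sigma>_point[OF r]] \<xi> by blast
qed

subsection \<open>From pairs of connections to connections\<close>

abbreviation "assembled \<equiv> assembled_form A B \<alpha> s R P \<sigma>"

lemma assembled_apply:
  "r \<in> points R.T \<Longrightarrow> assembled \<omega>\<sigma> \<omega>\<pi> r u = \<alpha>' (\<omega>\<sigma> r u) + s (\<omega>\<pi> (\<sigma> r) (d\<sigma> r u))"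
  by (simp add: assembled_form_def add_form_def apply_form_def pullback_def)

context
  fixes \<omega>\<sigma> \<omega>\<pi>
  assumes \<omega>\<sigma>: "\<omega>\<sigma> \<in> equivariant_connections G A S" and \<omega>\<pi>: "\<omega>\<pi> \<in> equivariant_connections G C P"
begin

text \<open>
  On vertical vectors the compatibility condition says that \<open>\<omega>\<sigma>\<close> is \<open>t\<close>: it is evaluated at the
  diagonal point \<open>(r, r)\<close> on the velocity of \<open>(r, r \<bullet> b)\<close> at the identity.
\<close>

lemma compatible_fund:
  assumes comp: "compatible_connections B t R \<omega>\<sigma>" and r: "r \<in> points R.T"
  shows "\<omega>\<sigma> r (R.fund \<xi> r) = t \<xi>"
proof -
  obtain Q and \<eta> :: "'eb \<Rightarrow> 'b" and x where \<eta>: "psmooth Q (mfd_of B) \<eta>" "x \<in> Q" "\<eta> x = \<one>\<^bsub>B\<^esub>"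
    and vel: "\<And>u. vel (mfd_of B) \<eta> x u = u"
    using tangent_vector_vel[OF B.smooth_atlas B.one_point] by metis
  note \<eta>c = B.psmooth_carrier[OF \<eta>(1)]
  have c: "psmooth Q R.T (\<lambda>y. r)" by (rule psmooth_const[OF R.charted_total r psmooth_open[OF \<eta>(1)]])
  have "R.compatible_along t \<omega>\<sigma> (\<lambda>y. r) (\<lambda>y. ract R r (\<eta> y)) x \<xi>"
    by (rule R.compatible_connections_along[OF comp c R.psmooth_act[OF c \<eta>(1)] _ \<eta>(2)])
      (simp add: R.proj_act[OF r] \<eta>c)
  moreover have "vel (mfd_of B) (\<lambda>y. R.difference (r, ract R r (\<eta> y))) x = vel (mfd_of B) \<eta> x"
    by (rule vel_cong[OF psmooth_open[OF \<eta>(1)] \<eta>(2)]) (simp add: R.difference_act[OF r] \<eta>c)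
  moreover have "vel R.T (\<lambda>y. ract R r (\<eta> y)) x \<xi> = R.fund \<xi> r"
    using R.fund_vel[OF \<eta> r] by (simp add: vel)
  moreover have "linear (\<omega>\<sigma> r)"
    using \<omega>\<sigma> one_form_linear r by (auto simp: sigma_connections_iff)
  ultimately show ?thesis
    using R.difference_act[OF r B.one_closed]
    by (simp add: R.compatible_along_def \<eta>(3) R.act_one[OF r] vel vel_const B.maurer_cartan_one linear_0)
qed

text \<open>
  On pairs \<open>(\<phi>, \<phi> \<bullet> b)\<close> with constant \<open>b\<close> the right hand side of the compatibility condition
  vanishes, so \<open>\<omega>\<sigma>\<close> is invariant under all of \<open>B\<close> and not only under \<open>A\<close>.
\<close>

lemma compatible_invariant:
  assumes comp: "compatible_connections B t R \<omega>\<sigma>" and r: "r \<in> points R.T" and b: "b \<in> carrier B"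
  shows "\<omega>\<sigma> (ract R r b) (R.dact b r u) = \<omega>\<sigma> r u"
proof -
  obtain Q and \<phi> :: "'er \<Rightarrow> 'r" and x where \<phi>: "psmooth Q R.T \<phi>" "x \<in> Q" "\<phi> x = r"
    and vel: "\<And>u. vel R.T \<phi> x u = u"
    using tangent_vector_vel[OF R.smooth_atlas_total r] by metis
  note \<phi>p = psmooth_points[OF \<phi>(1)]
  have "R.compatible_along t \<omega>\<sigma> \<phi> (\<lambda>y. ract R (\<phi> y) b) x u"
    by (rule R.compatible_connections_along[OF comp \<phi>(1)
          psmooth_smooth_map[OF R.charted_total R.smooth_translation[OF b] \<phi>(1) R.charted_total] _ \<phi>(2)])
      (simp add: R.proj_act b \<phi>p)
  moreover have "vel R.T (\<lambda>y. ract R (\<phi> y) b) x u = R.dact b r u"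
    using vel_smooth_map[OF R.charted_total R.charted_total R.smooth_translation[OF b] \<phi>(1,2)]
    by (simp add: vel \<phi>(3))
  moreover have "vel (mfd_of B) (\<lambda>y. R.difference (\<phi> y, ract R (\<phi> y) b)) x = vel (mfd_of B) (\<lambda>y. b) x"
    by (rule vel_cong[OF psmooth_open[OF \<phi>(1)] \<phi>(2)]) (simp add: R.difference_act \<phi>p b)
  moreover have "t (maurer_cartan B b 0) = 0"
    using linear_0[OF B.linear_maurer_cartan[OF b]] linear_0[OF linear_t] by simp
  ultimately show ?thesis
    by (simp add: R.compatible_along_def \<phi>(3) R.difference_act[OF r b] vel vel_const)
qed

lemma assembled_connection:
  assumes comp: "compatible_connections B t R \<omega>\<sigma>"
  shows "assembled \<omega>\<sigma> \<omega>\<pi> \<in> equivariant_connections G B R"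
  unfolding equivariant_connections_iff
proof (intro conjI ballI allI)
  have 1: "one_form R.T \<omega>\<sigma>" and 2: "one_form P.T \<omega>\<pi>"
    using \<omega>\<sigma>[unfolded sigma_connections_iff] \<omega>\<pi>[unfolded equivariant_connections_iff] by blast+
  show "one_form R.T (assembled \<omega>\<sigma> \<omega>\<pi>)"
    unfolding assembled_form_def
    by (intro one_form_add one_form_apply one_form_pullback R.smooth_atlas_total P.smooth_atlas_total
        \<sigma>_smooth linear_\<alpha>' linear_s 1 2)
  fix r assume r: "r \<in> points R.T"
  show "assembled \<omega>\<sigma> \<omega>\<pi> r (R.fund \<xi> r) = \<xi>" for \<xi>
    using \<omega>\<pi>[unfolded equivariant_connections_iff] \<sigma>_point[OF r] decomp[of \<xi>]
    by (simp add: assembled_apply[OF r] compatible_fund[OF comp r] d\<sigma>_fund[OF r])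
  show "assembled \<omega>\<sigma> \<omega>\<pi> (lact R g r) (differential R.T R.T (lact R g) r u) = assembled \<omega>\<sigma> \<omega>\<pi> r u"
    if g: "g \<in> carrier G" for g u
    using \<omega>\<sigma>[unfolded sigma_connections_iff] \<omega>\<pi>[unfolded equivariant_connections_iff] g r \<sigma>_point[OF r]
    by (simp add: assembled_apply smooth_map_points[OF lact_R_smooth] d\<sigma>_lact \<sigma>_lact)
  fix b u assume b: "b \<in> carrier B"
  have "assembled \<omega>\<sigma> \<omega>\<pi> (ract R r b) (R.dact b r u) =
      \<alpha>' (\<omega>\<sigma> r u) + s (Ad C (inv\<^bsub>C\<^esub> (\<beta> b)) (\<omega>\<pi> (\<sigma> r) (d\<sigma> r u)))"
    using \<omega>\<pi>[unfolded equivariant_connections_iff] \<sigma>_point[OF r] \<beta>_carrier[OF b]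
    by (simp add: assembled_apply[OF r] assembled_apply[OF R.act_point[OF r b]]
        compatible_invariant[OF comp r b] d\<sigma>_dact[OF b r] \<sigma>_act[OF r b])
  also have "\<dots> = Ad B (inv\<^bsub>B\<^esub> b) (\<alpha>' (\<omega>\<sigma> r u)) + Ad B (inv\<^bsub>B\<^esub> b) (s (\<omega>\<pi> (\<sigma> r) (d\<sigma> r u)))"
    using s_Ad[of "inv\<^bsub>B\<^esub> b"] b by (simp add: Ad_\<alpha>' \<beta>_inv)
  also have "\<dots> = Ad B (inv\<^bsub>B\<^esub> b) (assembled \<omega>\<sigma> \<omega>\<pi> r u)"
    using linear_add[OF B.linear_Ad[of "inv\<^bsub>B\<^esub> b"]] b by (simp add: assembled_apply[OF r])
  finally show "assembled \<omega>\<sigma> \<omega>\<pi> (ract R r b) (R.dact b r u) = Ad B (inv\<^bsub>B\<^esub> b) (assembled \<omega>\<sigma> \<omega>\<pi> r u)" .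
qed

lemma t_assembled: "r \<in> points R.T \<Longrightarrow> t (assembled \<omega>\<sigma> \<omega>\<pi> r u) = \<omega>\<sigma> r u"
  by (simp add: assembled_apply linear_add[OF linear_t] t_\<alpha>' t_s)

lemma \<beta>'_assembled: "r \<in> points R.T \<Longrightarrow> \<beta>' (assembled \<omega>\<sigma> \<omega>\<pi> r u) = \<omega>\<pi> (\<sigma> r) (d\<sigma> r u)"
  by (simp add: assembled_apply linear_add[OF linear_\<beta>'] \<beta>'_\<alpha>' \<beta>'_s)

end

text \<open>
  The components \<open>t\<close> and \<open>\<beta>'\<close> of the assembled form are \<open>\<omega>\<sigma>\<close> and the pullback of \<open>\<omega>\<pi>\<close>, and the
  pullback determines \<open>\<omega>\<pi>\<close> since \<open>\<sigma>\<close> is surjective on points and on tangent vectors.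
\<close>

lemma assembled_injective:
  assumes "\<omega>\<sigma> \<in> equivariant_connections G A S" "\<omega>\<pi> \<in> equivariant_connections G C P"
    and "\<omega>\<sigma>' \<in> equivariant_connections G A S" "\<omega>\<pi>' \<in> equivariant_connections G C P"
    and eq: "assembled \<omega>\<sigma> \<omega>\<pi> = assembled \<omega>\<sigma>' \<omega>\<pi>'"
  shows "\<omega>\<sigma> = \<omega>\<sigma>'" "\<omega>\<pi> = \<omega>\<pi>'"
proof -
  have extl: "\<omega>\<sigma> \<in> extensional (points R.T)" "\<omega>\<sigma>' \<in> extensional (points R.T)"
    "\<omega>\<pi> \<in> extensional (points P.T)" "\<omega>\<pi>' \<in> extensional (points P.T)"
    using assms(1,3)[unfolded sigma_connections_iff] assms(2,4)[unfolded equivariant_connections_iff]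
    by (simp_all add: one_form_def)
  show "\<omega>\<sigma> = \<omega>\<sigma>'"
  proof (rule extensionalityI[OF extl(1,2)], rule ext)
    fix r u assume "r \<in> points R.T"
    then show "\<omega>\<sigma> r u = \<omega>\<sigma>' r u"
      using t_assembled[OF assms(1,2), of r u] t_assembled[OF assms(3,4), of r u] eq by simp
  qed
  show "\<omega>\<pi> = \<omega>\<pi>'"
  proof (rule extensionalityI[OF extl(3,4)], rule ext)
    fix p v assume "p \<in> points P.T"
    then obtain r u where "r \<in> points R.T" "\<sigma> r = p" "d\<sigma> r u = v"
      using ex_tangent_preimage by blast
    then show "\<omega>\<pi> p v = \<omega>\<pi>' p v"
      using \<beta>'_assembled[OF assms(1,2), of r u] \<beta>'_assembled[OF assms(3,4), of r u] eq by simp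
  qed
qed

subsection \<open>From connections to pairs of connections\<close>

context
  fixes \<omega> assumes \<omega>: "\<omega> \<in> equivariant_connections G B R"
begin

lemma \<omega>_form: "one_form R.T \<omega>"
  and \<omega>_fund: "r \<in> points R.T \<Longrightarrow> \<omega> r (R.fund \<xi> r) = \<xi>"
  and \<omega>_dact: "b \<in> carrier B \<Longrightarrow> r \<in> points R.T \<Longrightarrow> \<omega> (ract R r b) (R.dact b r u) = Ad B (inv\<^bsub>B\<^esub> b) (\<omega> r u)"
  and \<omega>_lact: "g \<in> carrier G \<Longrightarrow> r \<in> points R.T \<Longrightarrow>
    \<omega> (lact R g r) (differential R.T R.T (lact R g) r u) = \<omega> r u"
  using \<omega> by (simp_all add: equivariant_connections_iff)

lemma linear_\<omega>: "r \<in> points R.T \<Longrightarrow> linear (\<omega> r)"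
  by (rule one_form_linear[OF \<omega>_form])

lemma \<omega>\<sigma>_connection: "apply_form R.T t \<omega> \<in> equivariant_connections G A S"
  unfolding sigma_connections_iff
proof (intro conjI ballI allI)
  show "one_form R.T (apply_form R.T t \<omega>)"
    by (rule one_form_apply[OF R.smooth_atlas_total \<omega>_form linear_t])
  fix r assume r: "r \<in> points R.T"
  show "apply_form R.T t \<omega> r (R.fund (\<alpha>' \<xi>) r) = \<xi>" for \<xi>
    by (simp add: apply_form_def r \<omega>_fund t_\<alpha>')
  show "apply_form R.T t \<omega> (ract R r (\<alpha> a)) (R.dact (\<alpha> a) r u) = apply_form R.T t \<omega> r u" 
    if a: "a \<in> carrier A" for a u
    using r \<alpha>_carrier[OF a] by (simp add: apply_form_def R.act_point \<omega>_dact t_Ad)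
  show "apply_form R.T t \<omega> (lact R g r) (differential R.T R.T (lact R g) r u) = apply_form R.T t \<omega> r u"
    if g: "g \<in> carrier G" for g u
    using r smooth_map_points[OF lact_R_smooth[OF g] r] by (simp add: apply_form_def \<omega>_lact[OF g])
qed

text \<open>
  The connection \<open>\<omega>\<close> is applied to the derivative of the difference. The adjoint action in the first
  summand disappears under \<open>t\<close>.
\<close>

lemma \<omega>\<sigma>_compatible: "compatible_connections B t R (apply_form R.T t \<omega>)"
proof (rule R.compatible_connectionsI)
  fix Q and \<phi> \<eta> :: "'er \<times> 'eb \<Rightarrow> 'r" and x v
  assume \<phi>: "psmooth Q R.T \<phi>" and \<eta>: "psmooth Q R.T \<eta>"
    and eq: "\<And>y. y \<in> Q \<Longrightarrow> proj R (\<phi> y) = proj R (\<eta> y)" and x: "x \<in> Q"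
  define b where "b = R.difference (\<phi> x, \<eta> x)"
  note p = psmooth_points[OF \<phi> x] psmooth_points[OF \<eta> x]
  have b: "b \<in> carrier B" "ract R (\<phi> x) b = \<eta> x"
    using R.difference_carrier[OF p eq[OF x]] R.act_difference[OF p eq[OF x]] by (simp_all add: b_def)
  let ?\<xi> = "maurer_cartan B b (vel (mfd_of B) (\<lambda>y. R.difference (\<phi> y, \<eta> y)) x v)"
  have "\<omega> (\<eta> x) (vel R.T \<eta> x v) = \<omega> (\<eta> x) (R.dact b (\<phi> x) (vel R.T \<phi> x v)) + \<omega> (\<eta> x) (R.fund ?\<xi> (\<eta> x))"
    using R.vel_difference[OF \<phi> \<eta> eq x, of v] linear_add[OF linear_\<omega>[OF p(2)]] by (simp add: b_def)
  also have "\<dots> = Ad B (inv\<^bsub>B\<^esub> b) (\<omega> (\<phi> x) (vel R.T \<phi> x v)) + ?\<xi>"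
    using \<omega>_dact[OF b(1) p(1)] by (simp add: b(2) \<omega>_fund[OF p(2)])
  finally have "t (\<omega> (\<eta> x) (vel R.T \<eta> x v)) = t (\<omega> (\<phi> x) (vel R.T \<phi> x v)) + t ?\<xi>"
    using b(1) by (simp add: linear_add[OF linear_t] t_Ad)
  then show "R.compatible_along t (apply_form R.T t \<omega>) \<phi> \<eta> x v"
    using p by (simp add: R.compatible_along_def apply_form_def b_def[symmetric])
qed

text \<open>
  The form \<open>\<beta>' \<circ> \<omega>\<close> kills the kernel of \<open>d\<sigma>\<close> and does not change along the fibres of \<open>\<sigma>\<close>, because
  the adjoint action of the kernel of \<open>\<beta>\<close> is trivial after projection; hence it descends to \<open>P\<close>.
\<close>

lemma descent_well_defined:
  assumes r: "r \<in> points R.T" "r' \<in> points R.T" and \<sigma>: "\<sigma> r = \<sigma> r'" and u: "d\<sigma> r u = d\<sigma> r' u'"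
  shows "\<beta>' (\<omega> r u) = \<beta>' (\<omega> r' u')"
proof -
  have pr: "proj R r = proj R r'" using proj_\<sigma>[OF r(1)] proj_\<sigma>[OF r(2)] \<sigma> by simp
  define b where "b = R.difference (r, r')"
  have b: "b \<in> carrier B" "ract R r b = r'"
    using R.difference_carrier[OF r pr] R.act_difference[OF r pr] by (simp_all add: b_def)
  have "ract P (\<sigma> r) (\<beta> b) = ract P (\<sigma> r) \<one>\<^bsub>C\<^esub>"
    using \<sigma>_act[OF r(1) b(1)] b(2) \<sigma> P.act_one[OF \<sigma>_point[OF r(1)]] by simp
  then have \<beta>b: "\<beta> b = \<one>\<^bsub>C\<^esub>"
    by (rule P.act_free[OF \<sigma>_point[OF r(1)] \<beta>_carrier[OF b(1)] C.one_closed])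
  have "d\<sigma> r' (R.dact b r u) = P.dact \<one>\<^bsub>C\<^esub> (\<sigma> r) (d\<sigma> r u)"
    using d\<sigma>_dact[OF b(1) r(1)] by (simp add: b(2) \<beta>b)
  also have "\<dots> = differential P.T P.T (\<lambda>x. x) (\<sigma> r) (d\<sigma> r u)"
    by (rule differential_cong[OF P.charted_total \<sigma>_point[OF r(1)]]) (rule P.act_one)
  also have "\<dots> = d\<sigma> r' u'"
    using u by (simp add: differential_id[OF P.charted_total \<sigma>_point[OF r(1)]])
  finally have "d\<sigma> r' (u' - R.dact b r u) = 0"
    by (simp add: linear_diff[OF linear_d\<sigma>[OF r(2)]])
  then obtain \<xi> where \<xi>: "u' - R.dact b r u = R.fund \<xi> r'" "\<beta>' \<xi> = 0"
    using d\<sigma>_kernel[OF r(2)] by blast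
  have "\<omega> r' u' = \<omega> r' (R.dact b r u) + \<omega> r' (R.fund \<xi> r')"
    using linear_add[OF linear_\<omega>[OF r(2)], of "R.dact b r u" "R.fund \<xi> r'"] by (simp add: \<xi>(1)[symmetric])
  then have "\<omega> r' u' = Ad B (inv\<^bsub>B\<^esub> b) (\<omega> r u) + \<xi>"
    using \<omega>_dact[OF b(1) r(1)] by (simp add: b(2) \<omega>_fund[OF r(2)])
  then have "\<beta>' (\<omega> r' u') = Ad C (\<beta> (inv\<^bsub>B\<^esub> b)) (\<beta>' (\<omega> r u))"
    using b(1) \<xi>(2) by (simp add: linear_add[OF linear_\<beta>'] \<beta>'_Ad)
  also have "\<beta> (inv\<^bsub>B\<^esub> b) = \<beta> (\<alpha> \<one>\<^bsub>A\<^esub>)"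
    using b(1) by (simp add: \<beta>_inv \<beta>b \<beta>_\<alpha>)
  also have "Ad C (\<beta> (\<alpha> \<one>\<^bsub>A\<^esub>)) (\<beta>' (\<omega> r u)) = \<beta>' (\<omega> r u)"
    using \<beta>'_Ad[OF \<alpha>_carrier[OF A.one_closed]] Ad_central[OF A.one_closed] by simp
  finally show ?thesis by simp
qed

text \<open>
  The value is computed on any preimage of the tangent vector; it is independent of the choice by the
  preceding lemma.
\<close>

definition descended :: "'p \<Rightarrow> 'ep \<Rightarrow> 'ec"
  where "descended = (\<lambda>p\<in>points P.T. \<lambda>v. THE w. \<exists>r u. r \<in> points R.T \<and> \<sigma> r = p \<and> d\<sigma> r u = v \<and> w = \<beta>' (\<omega> r u))"

lemma descended_\<sigma>:
  assumes "r \<in> points R.T"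
  shows "descended (\<sigma> r) (d\<sigma> r u) = \<beta>' (\<omega> r u)"
proof -
  have "(THE w. \<exists>r' u'. r' \<in> points R.T \<and> \<sigma> r' = \<sigma> r \<and> d\<sigma> r' u' = d\<sigma> r u \<and> w = \<beta>' (\<omega> r' u')) = \<beta>' (\<omega> r u)"
    using assms descent_well_defined by (intro the_equality) blast+
  then show ?thesis by (simp add: descended_def \<sigma>_point[OF assms])
qed

text \<open>
  Linearity is checked at a single point \<open>r\<close> over \<open>p\<close> at which the differential of \<open>\<sigma>\<close> is onto, so
  that both vectors are lifted to the same tangent space.
\<close>

lemma descended_linear:
  assumes "p \<in> points P.T"
  shows "linear (descended p)"
proof -
  obtain r where r: "r \<in> points R.T" "\<sigma> r = p" and sur: "\<And>v. \<exists>u. d\<sigma> r u = v"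
    using \<sigma>_submersion[OF assms] by blast
  have d: "descended p (d\<sigma> r u) = \<beta>' (\<omega> r u)" for u
    using descended_\<sigma>[OF r(1)] r(2) by simp
  show ?thesis
  proof (rule linearI)
    fix v w and c :: real
    obtain u u' where u: "v = d\<sigma> r u" "w = d\<sigma> r u'" using sur by metis
    show "descended p (v + w) = descended p v + descended p w"
      unfolding u linear_add[OF linear_d\<sigma>[OF r(1)], symmetric] d
      by (simp add: linear_add[OF linear_\<omega>[OF r(1)]] linear_add[OF linear_\<beta>'])
    show "descended p (c *\<^sub>R v) = c *\<^sub>R descended p v"
      unfolding u linear_scale[OF linear_d\<sigma>[OF r(1)], symmetric] d
      by (simp add: linear_scale[OF linear_\<omega>[OF r(1)]] linear_scale[OF linear_\<beta>'])
  qed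
qed

lemma descended_fund:
  assumes "p \<in> points P.T"
  shows "descended p (P.fund \<zeta> p) = \<zeta>"
proof -
  obtain r where r: "r \<in> points R.T" "\<sigma> r = p" using \<sigma>_submersion[OF assms] by blast
  have "P.fund \<zeta> p = d\<sigma> r (R.fund (s \<zeta>) r)"
    using d\<sigma>_fund[OF r(1)] r(2) by (simp add: \<beta>'_s)
  then show ?thesis using descended_\<sigma>[OF r(1)] r(2) by (simp add: \<omega>_fund[OF r(1)] \<beta>'_s)
qed

lemma descended_dact:
  assumes p: "p \<in> points P.T" and c: "c \<in> carrier C"
  shows "descended (ract P p c) (P.dact c p v) = Ad C (inv\<^bsub>C\<^esub> c) (descended p v)"
proof -
  obtain r u where r: "r \<in> points R.T" "\<sigma> r = p" and u: "d\<sigma> r u = v"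
    using ex_tangent_preimage[OF p] by blast
  have "c \<in> \<beta> ` carrier B" using c by (simp add: \<beta>_surj)
  then obtain b where b: "b \<in> carrier B" "\<beta> b = c" by blast
  have "descended (ract P p c) (P.dact c p v) = \<beta>' (\<omega> (ract R r b) (R.dact b r u))"
    using descended_\<sigma>[OF R.act_point[OF r(1) b(1)], of "R.dact b r u"]
    by (simp add: d\<sigma>_dact[OF b(1) r(1)] \<sigma>_act[OF r(1) b(1)] r(2) u b(2))
  also have "\<dots> = Ad C (inv\<^bsub>C\<^esub> c) (\<beta>' (\<omega> r u))"
    using b by (simp add: \<omega>_dact[OF b(1) r(1)] \<beta>'_Ad \<beta>_inv)
  also have "\<beta>' (\<omega> r u) = descended p v"
    using descended_\<sigma>[OF r(1), of u] r(2) u by simp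
  finally show ?thesis .
qed

text \<open>
  Along a factorisation \<open>\<phi> = \<sigma>(\<eta>) \<bullet> k\<close> the form becomes
  \<open>Ad(k\<inverse>) (\<beta>' (\<omega>(d\<eta>))) + \<theta>(dk)\<close>, and every term of this expression is smooth.
\<close>

lemma descended_smooth:
  fixes \<phi> :: "'z::model_space \<Rightarrow> 'p"
  assumes \<phi>: "psmooth Q P.T \<phi>"
  shows "smooth_on Q (\<lambda>x. descended (\<phi> x) (vel P.T \<phi> x v))"
proof (rule smooth_on_local)
  fix x assume x: "x \<in> Q"
  obtain W \<eta> k where W: "x \<in> W" "W \<subseteq> Q" and \<eta>: "psmooth W R.T \<eta>" and k: "psmooth W (mfd_of C) k"
    and eq: "\<And>y. y \<in> W \<Longrightarrow> \<phi> y = ract P (\<sigma> (\<eta> y)) (k y)"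
    using ex_factorisation[OF \<phi> x] by blast
  note o = psmooth_open[OF \<eta>]
  have *: "descended (\<phi> y) (vel P.T \<phi> y v) = Ad C (inv\<^bsub>C\<^esub> (k y)) (\<beta>' (\<omega> (\<eta> y) (vel R.T \<eta> y v))) +
      maurer_cartan C (k y) (vel (mfd_of C) k y v)" if y: "y \<in> W" for y
  proof -
    note ky = C.psmooth_carrier[OF k y] and \<eta>y = psmooth_points[OF \<eta> y]
    have \<phi>y: "\<phi> y \<in> points P.T" using psmooth_points[OF \<phi>] W(2) y by blast
    have "descended (\<phi> y) (vel P.T \<phi> y v) =
        descended (\<phi> y) (P.dact (k y) (\<sigma> (\<eta> y)) (d\<sigma> (\<eta> y) (vel R.T \<eta> y v))) +
        maurer_cartan C (k y) (vel (mfd_of C) k y v)"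
      using vel_factorisation[OF \<phi> \<eta> k eq y]
      by (simp add: linear_add[OF descended_linear[OF \<phi>y]] descended_fund[OF \<phi>y])
    then show ?thesis
      using descended_dact[OF \<sigma>_point[OF \<eta>y] ky] by (simp add: eq[OF y] descended_\<sigma>[OF \<eta>y])
  qed
  have "smooth_on W (\<lambda>y. Ad C (inv\<^bsub>C\<^esub> (k y)) (\<beta>' (\<omega> (\<eta> y) (vel R.T \<eta> y v))) +
      maurer_cartan C (k y) (vel (mfd_of C) k y v))"
    by (intro smooth_on_add o C.smooth_on_Ad_inv k C.smooth_on_maurer_cartan
        smooth_on_bounded_linear[OF bounded_linear_model[OF linear_\<beta>'] o]
        one_form_smooth[OF R.smooth_atlas_total \<omega>_form \<eta>])
  then have "smooth_on W (\<lambda>x. descended (\<phi> x) (vel P.T \<phi> x v))"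
    by (rule smooth_on_congI[OF _ o *])
  then show "\<exists>W. open W \<and> x \<in> W \<and> smooth_on (Q \<inter> W) (\<lambda>x. descended (\<phi> x) (vel P.T \<phi> x v))"
    using o W by (intro exI[of _ W]) (auto elim: smooth_on_subset)
qed

text \<open>
  Each property is the image under \<open>\<beta>'\<close> of the corresponding property of \<open>\<omega>\<close> at a preimage under
  \<open>\<sigma>\<close>.
\<close>

lemma descended_connection: "descended \<in> equivariant_connections G C P"
  unfolding equivariant_connections_iff
proof (intro conjI ballI allI)
  show "one_form P.T descended"
  proof (rule one_formI[OF P.smooth_atlas_total])
    show "descended \<in> extensional (points P.T)" by (simp add: descended_def)
  qed (fact descended_linear descended_smooth)+
  fix p assume p: "p \<in> points P.T"
  show "descended p (P.fund \<zeta> p) = \<zeta>" for \<zeta>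
    by (rule descended_fund[OF p])
  show "descended (ract P p c) (P.dact c p v) = Ad C (inv\<^bsub>C\<^esub> c) (descended p v)" if "c \<in> carrier C" for c v
    by (rule descended_dact[OF p that])
  fix g v assume g: "g \<in> carrier G"
  obtain r u where r: "r \<in> points R.T" "\<sigma> r = p" and u: "d\<sigma> r u = v"
    using ex_tangent_preimage[OF p] by blast
  have "descended (lact P g p) (differential P.T P.T (lact P g) p v) =
      \<beta>' (\<omega> (lact R g r) (differential R.T R.T (lact R g) r u))"
    using descended_\<sigma>[OF smooth_map_points[OF lact_R_smooth[OF g] r(1)],
        of "differential R.T R.T (lact R g) r u"]
    by (simp add: d\<sigma>_lact[OF g r(1)] \<sigma>_lact[OF g r(1)] r(2) u)
  then show "descended (lact P g p) (differential P.T P.T (lact P g) p v) = descended p v"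
    using descended_\<sigma>[OF r(1), of u] r(2) u \<omega>_lact[OF g r(1)] by simp
qed

lemma assembled_descended: "assembled (apply_form R.T t \<omega>) descended = \<omega>"
proof (rule extensionalityI)
  show "assembled (apply_form R.T t \<omega>) descended \<in> extensional (points R.T)"
    by (simp add: assembled_form_def add_form_def)
  show "\<omega> \<in> extensional (points R.T)" using \<omega>_form by (simp add: one_form_def)
  fix r assume r: "r \<in> points R.T"
  show "assembled (apply_form R.T t \<omega>) descended r = \<omega> r"
    by (rule ext) (simp add: assembled_apply[OF r] apply_form_def descended_\<sigma>[OF r] r decomp[symmetric])
qed

end

end

theorem theorem3p15:
  fixes A :: "('a, 'ea::model_space) lie_grp"
    and B :: "('b, 'eb::model_space) lie_grp"
    and C :: "('c, 'ec::model_space) lie_grp"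
    and G :: "('g, 'eg::model_space) lie_grp"
    and X :: "('x, 'ex::model_space) mfd"
    and R :: "('r, 'er::model_space, 'x, 'b, 'g) eq_bundle"
    and P :: "('p, 'ep::model_space, 'x, 'c, 'g) eq_bundle"
    and \<alpha> :: "'a \<Rightarrow> 'b" and \<beta> :: "'b \<Rightarrow> 'c" and \<sigma> :: "'r \<Rightarrow> 'p"
    and s :: "'ec \<Rightarrow> 'eb" and t :: "'eb \<Rightarrow> 'ea"
    and actX :: "'g \<Rightarrow> 'x \<Rightarrow> 'x"
  assumes "central_extension A B C \<alpha> \<beta>"
    and "Ad_splitting A B C \<alpha> \<beta> s t"
    and "lie_group G" and "manifold X" and "left_action G X actX"
    and "equivariant_central_extension G B C \<beta> X actX R P \<sigma>"
  shows "bij_betw (\<lambda>(\<omega>\<sigma>, \<omega>\<pi>). assembled_form A B \<alpha> s R P \<sigma> \<omega>\<sigma> \<omega>\<pi>)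
    {(\<omega>\<sigma>, \<omega>\<pi>). \<omega>\<sigma> \<in> equivariant_connections G A (sigma_bundle \<alpha> R \<sigma>) \<and>
       \<omega>\<pi> \<in> equivariant_connections G C P \<and>
       compatible_connections B t R \<omega>\<sigma>}
    (equivariant_connections G B R)"
proof -
  have lies: "lie A" "lie B" "lie C"
    using assms(1) by (simp_all add: lie_def lie_axioms_def central_extension_def lie_group_def)
  have bundles: "principal_bundle B X R" "principal_bundle C X P"
    using assms(6) by (simp_all add: equivariant_central_extension_def equivariant_principal_bundle_def)
  interpret bundle_extension A B C \<alpha> \<beta> s t X R P G actX \<sigma>
    using lies bundles assms
    by (simp add: bundle_extension_def bundle_extension_axioms_def split_extension_def
        split_extension_axioms_def principal_def principal_axioms_def)
  let ?D = "{(\<omega>\<sigma>, \<omega>\<pi>). \<omega>\<sigma> \<in> equivariant_connections G A S \<and> \<omega>\<pi> \<in> equivariant_connections G C P \<and>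
    compatible_connections B t R \<omega>\<sigma>}"
  show ?thesis
  proof (rule bij_betw_imageI)
    show "inj_on (\<lambda>(\<omega>\<sigma>, \<omega>\<pi>). assembled \<omega>\<sigma> \<omega>\<pi>) ?D"
      using assembled_injective by (auto simp: inj_on_def)
    show "(\<lambda>(\<omega>\<sigma>, \<omega>\<pi>). assembled \<omega>\<sigma> \<omega>\<pi>) ` ?D = equivariant_connections G B R"
    proof (intro equalityI subsetI)
      fix \<omega> assume \<omega>: "\<omega> \<in> equivariant_connections G B R"
      show "\<omega> \<in> (\<lambda>(\<omega>\<sigma>, \<omega>\<pi>). assembled \<omega>\<sigma> \<omega>\<pi>) ` ?D"
        using \<omega>\<sigma>_connection[OF \<omega>] descended_connection[OF \<omega>] \<omega>\<sigma>_compatible[OF \<omega>]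
          assembled_descended[OF \<omega>]
        by (intro image_eqI[of _ _ "(apply_form R.T t \<omega>, descended \<omega>)"]) simp_all
    qed (auto intro: assembled_connection)
  qed
qed

end
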